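(* Let $\lambda>0$, $\psi\ge 0$ and $\omega\in\mathbb{R}$ be given constants. Let $P:\mathcal{H}^1(0,1)\times\mathcal{H}^1(0,1)\to\mathcal{H}^1(0,1)$ be the linear operator $$(P(u,v))(x)=v(x)-\mathrm{e}^{-\lambda^{-1}\psi x}v(0)+\lambda^{-1}\omega\int_0^x \mathrm{e}^{-\lambda^{-1}\psi(x-s)}u(s)\,ds,\qquad x\in[0,1],$$ and let $S=\{(u,v)\in\mathcal{H}^1(0,1)\times\mathcal{H}^1(0,1): P(u,v)=0\}$. Then for all $(u_0,v_0)\in(\mathcal{H}^1(0,1)\times\mathcal{H}^1(0,1))\setminus S$ the following property holds: for every input $U\in\mathcal{C}^1(\mathbb{R}_+)$ with $U(0)=u_0(0)$, the corresponding unique solution $(u,v)\in\left(\mathcal{C}^0(\mathbb{R}_+;\mathcal{H}^1(0,1))\cap\mathcal{C}^1(\mathbb{R}_+;\mathcal{L}^2(0,1))\right)^2$ of the initial-boundary value problem $$\partial_t u(t,x)=-\lambda\,\partial_x u(t,x),\qquad \partial_t v(t,x)=\psi v(t,x)+\omega u(t,x),\qquad u(t,0)=U(t),$$ $$u(0,x)=u_0(x),\qquad v(0,x)=v_0(x),\qquad t\ge 0,\ x\in[0,1],$$ does not satisfy the condition "$\lim_{t\to\infty}v(t,x)=0$ for all $x\in[0,1]$" (i.e. it is not the case that $v(t,x)\to0$ as $t\to\infty$ for every $x\in[0,1]$).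
   Context: $\mathbb{R}_+=[0,\infty)$. $\mathcal{H}^1(0,1)$ is the Sobolev space of functions in $\mathcal{L}^2(0,1)$ with first-order weak derivative in $\mathcal{L}^2(0,1)$; its elements are identified with their continuous representatives on $[0,1]$, so that $v(t,x)$ is defined for every $x\in[0,1]$. *)

theory Defs
  imports "HOL-Analysis.Analysis"
begin

text \<open>
  Elements of the function spaces over the unit interval are represented by functions
  on the reals, of which only the restriction to the open interval (for \<open>L2\<close>, up to null
  sets) or to the closed interval (for \<open>H1\<close>) matters.
\<close>

abbreviation unit_measure :: "real measure"
  where "unit_measure \<equiv> lebesgue_on {0<..<1}"

definition L2 :: "(real \<Rightarrow> real) set"
  where "L2 = {f. f \<in> borel_measurable unit_measure \<and> integrable unit_measure (\<lambda>x. (f x)\<^sup>2)}"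

text \<open>Meaningful for elements of \<open>L2\<close> only.\<close>

definition L2_norm :: "(real \<Rightarrow> real) \<Rightarrow> real"
  where "L2_norm f = sqrt (LINT x|unit_measure. (f x)\<^sup>2)"

definition test_functions :: "(real \<Rightarrow> real) set"
  where "test_functions = {\<phi>. (\<forall>n. ((deriv ^^ n) \<phi>) differentiable_on UNIV) \<and>
    (\<exists>K. compact K \<and> K \<subseteq> {0<..<1} \<and> (\<forall>x. x \<notin> K \<longrightarrow> \<phi> x = 0))}"

definition has_weak_deriv :: "(real \<Rightarrow> real) \<Rightarrow> (real \<Rightarrow> real) \<Rightarrow> bool"
  where "has_weak_deriv f g \<longleftrightarrow> (\<forall>\<phi>\<in>test_functions.
    (LINT x|unit_measure. f x * deriv \<phi> x) = - (LINT x|unit_measure. g x * \<phi> x))"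

text \<open>
  The continuity condition selects the continuous representative on the closed interval,
  so that point values are defined everywhere, including at the end points.
\<close>

definition H1 :: "(real \<Rightarrow> real) set"
  where "H1 = {f. continuous_on {0..1} f \<and> f \<in> L2 \<and> (\<exists>g\<in>L2. has_weak_deriv f g)}"

text \<open>Some representative; weak derivatives are unique up to null sets.\<close>

definition weak_deriv :: "(real \<Rightarrow> real) \<Rightarrow> real \<Rightarrow> real"
  where "weak_deriv f = (SOME g. g \<in> L2 \<and> has_weak_deriv f g)"

definition H1_norm :: "(real \<Rightarrow> real) \<Rightarrow> real"
  where "H1_norm f = sqrt ((L2_norm f)\<^sup>2 + (L2_norm (weak_deriv f))\<^sup>2)"

definition C0_L2 :: "(real \<Rightarrow> real \<Rightarrow> real) \<Rightarrow> bool"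
  where "C0_L2 w \<longleftrightarrow> (\<forall>t\<ge>0. w t \<in> L2) \<and>
    (\<forall>t\<ge>0. ((\<lambda>s. L2_norm (\<lambda>x. w s x - w t x)) \<longlongrightarrow> 0) (at t within {0..}))"

definition C0_H1 :: "(real \<Rightarrow> real \<Rightarrow> real) \<Rightarrow> bool"
  where "C0_H1 w \<longleftrightarrow> (\<forall>t\<ge>0. w t \<in> H1) \<and>
    (\<forall>t\<ge>0. ((\<lambda>s. H1_norm (\<lambda>x. w s x - w t x)) \<longlongrightarrow> 0) (at t within {0..}))"

text \<open>Derivative at time \<open>t\<close> of an \<open>L2\<close>-valued curve on the half-line (one-sided at \<open>t = 0\<close>).\<close>

definition has_time_deriv :: "(real \<Rightarrow> real \<Rightarrow> real) \<Rightarrow> (real \<Rightarrow> real) \<Rightarrow> real \<Rightarrow> bool"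
  where "has_time_deriv w d t \<longleftrightarrow> d \<in> L2 \<and>
    ((\<lambda>s. L2_norm (\<lambda>x. (w s x - w t x) / (s - t) - d x)) \<longlongrightarrow> 0) (at t within {0..})"

text \<open>Some representative; the derivative is unique up to null sets.\<close>

definition time_deriv :: "(real \<Rightarrow> real \<Rightarrow> real) \<Rightarrow> real \<Rightarrow> real \<Rightarrow> real"
  where "time_deriv w t = (SOME d. has_time_deriv w d t)"

definition C1_L2 :: "(real \<Rightarrow> real \<Rightarrow> real) \<Rightarrow> bool"
  where "C1_L2 w \<longleftrightarrow> (\<forall>t\<ge>0. w t \<in> L2) \<and> (\<forall>t\<ge>0. \<exists>d. has_time_deriv w d t) \<and>
    C0_L2 (time_deriv w)"

definition C1_halfline :: "(real \<Rightarrow> real) \<Rightarrow> bool"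
  where "C1_halfline U \<longleftrightarrow> (\<exists>U'. continuous_on {0..} U' \<and>
    (\<forall>t\<ge>0. (U has_real_derivative U' t) (at t within {0..})))"

definition P_op :: "real \<Rightarrow> real \<Rightarrow> real \<Rightarrow> (real \<Rightarrow> real) \<times> (real \<Rightarrow> real) \<Rightarrow> real \<Rightarrow> real"
  where "P_op lam psi om = (\<lambda>(u, v) x. v x - exp (- (psi / lam) * x) * v 0
    + om / lam * (LINT s:{0..x}|lebesgue. exp (- (psi / lam) * (x - s)) * u s))"

definition S_set :: "real \<Rightarrow> real \<Rightarrow> real \<Rightarrow> ((real \<Rightarrow> real) \<times> (real \<Rightarrow> real)) set"
  where "S_set lam psi om = {w \<in> H1 \<times> H1. \<forall>x\<in>{0..1}. P_op lam psi om w x = 0}"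

text \<open>
  The differential equations are identities in \<open>L2\<close> at each time, i.e. they hold almost
  everywhere in space. The boundary and initial values are values of continuous
  representatives, hence prescribed pointwise.
\<close>

definition is_solution ::
  "real \<Rightarrow> real \<Rightarrow> real \<Rightarrow> (real \<Rightarrow> real) \<Rightarrow> (real \<Rightarrow> real) \<Rightarrow> (real \<Rightarrow> real) \<Rightarrow>
   (real \<Rightarrow> real \<Rightarrow> real) \<Rightarrow> (real \<Rightarrow> real \<Rightarrow> real) \<Rightarrow> bool"
  where "is_solution lam psi om u0 v0 U u v \<longleftrightarrow>
    C0_H1 u \<and> C1_L2 u \<and> C0_H1 v \<and> C1_L2 v \<and>
    (\<forall>t\<ge>0. AE x in unit_measure. time_deriv u t x = - lam * weak_deriv (u t) x) \<and>
    (\<forall>t\<ge>0. AE x in unit_measure. time_deriv v t x = psi * v t x + om * u t x) \<and>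
    (\<forall>t\<ge>0. u t 0 = U t) \<and>
    (\<forall>x\<in>{0..1}. u 0 x = u0 x) \<and>
    (\<forall>x\<in>{0..1}. v 0 x = v0 x)"

end

theory Submission
  imports Defs
begin

text \<open>
  The first equation is a transport equation: its solution is \<open>u t x = W (x - lam * t)\<close>, where the
  profile \<open>W\<close> is the initial datum on the unit interval, continued to the negative half-line by the
  input (\<open>transport_profile_exists\<close>). The second equation is a linear ordinary differential equation at
  each point \<open>x\<close>. If \<open>G\<close> is an antiderivative of \<open>exp (psi / lam * y) * W y\<close>, its solution is
  \<open>exp (psi * t) * (v0 x + om / lam * exp (- (psi / lam) * x) * (G x - G (x - lam * t)))\<close>.
  The input influences this only through \<open>G (x - lam * t)\<close>, that is, in the same way at the point \<open>x\<close>
  as it did at the point 0 a time \<open>x / lam\<close> earlier. Comparing the two values gives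
  \<open>v (t + x / lam) x = exp (psi * (t + x / lam)) * P (u0, v0) x + v t 0\<close>
  (\<open>P_op_propagates\<close>). If \<open>v\<close> tended to 0 both at \<open>x\<close> and at 0, the first summand would tend to 0 as
  well, which is impossible for nonnegative \<open>psi\<close> unless \<open>P (u0, v0) x = 0\<close>. Outside \<open>S_set\<close> some \<open>x\<close>
  violates this, whatever the input is.

  The larger part of the work is to show that these formulas define a solution in the sense of
  Sobolev-valued curves, and the only one. The bridge is the description of \<open>H1\<close> by primitives of
  square-integrable functions (\<open>H1_primitive\<close>). One direction is the lemma of du Bois-Reymond
  (\<open>weak_deriv_increment\<close>), for which smooth cut-off functions are constructed; the other one is
  integration by parts (\<open>integration_by_parts_primitives\<close>), a consequence of Fubini's theorem.

  That the travelling profile is continuous with values in \<open>H1\<close> and differentiable with values in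
  \<open>L2\<close> rests on two facts about the whole line: translations are continuous in the mean
  (\<open>translation_continuous_L2\<close>), and the difference quotients of a primitive converge to its derivative
  in the mean (\<open>translation_average_L2\<close>). The formula for \<open>v\<close> differs from a multiple of \<open>v0\<close> by a
  continuously differentiable function and needs only uniform continuity and the mean value theorem.

  Uniqueness is proved by the energy method: the squared norm of the difference of two solutions
  satisfies a differential inequality that forces it to vanish (\<open>energy_derivative\<close>,
  \<open>Gronwall_zero\<close>). For \<open>u\<close> the sign of the boundary term is decisive, for \<open>v\<close> the agreement of the
  sources already established.
\<close>

section \<open>Square-integrable functions\<close>

text \<open>
  The measure is a parameter because translations are studied on the whole line with \<open>lborel\<close>,
  where they are isometries, whereas the evolution takes place in \<open>L2\<close> over the unit interval.
\<close>

definition square_integrable :: "'a measure \<Rightarrow> ('a \<Rightarrow> real) set"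
  where "square_integrable M = {f \<in> borel_measurable M. integrable M (\<lambda>x. (f x)\<^sup>2)}"

text \<open>
  The square of the norm has the same limits to zero as the norm and is subadditive up to a factor 2
  by an elementary inequality (\<open>sq_norm_add_le\<close>).
\<close>

definition sq_norm :: "'a measure \<Rightarrow> ('a \<Rightarrow> real) \<Rightarrow> real"
  where "sq_norm M f = (LINT x|M. (f x)\<^sup>2)"

lemma L2_eq_square_integrable: "L2 = square_integrable unit_measure"
  by (auto simp: L2_def square_integrable_def)

lemma L2_norm_eq_sq_norm: "L2_norm f = sqrt (sq_norm unit_measure f)"
  by (simp add: L2_norm_def sq_norm_def)

lemma sq_norm_nonneg [simp]: "0 \<le> sq_norm M f"
  by (simp add: sq_norm_def)

lemma square_integrable_measurable: "f \<in> square_integrable M \<Longrightarrow> f \<in> borel_measurable M"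
  by (simp add: square_integrable_def)

lemma square_integrable_mult_integrable:
  assumes "f \<in> square_integrable M" "g \<in> square_integrable M"
  shows "integrable M (\<lambda>x. f x * g x)"
proof (rule Bochner_Integration.integrable_bound)
  show "integrable M (\<lambda>x. (f x)\<^sup>2 + (g x)\<^sup>2)"
    using assms by (auto simp: square_integrable_def)
  show "(\<lambda>x. f x * g x) \<in> borel_measurable M"
    using assms by (auto simp: square_integrable_def)
  have "\<bar>a * b\<bar> \<le> a\<^sup>2 + b\<^sup>2" for a b :: real
  proof -
    have "0 \<le> \<bar>a\<bar> * \<bar>b\<bar>"
      by simp
    then show ?thesis
      using sum_squares_bound[of "\<bar>a\<bar>" "\<bar>b\<bar>"] unfolding abs_mult power2_abs by linarith
  qed
  then show "AE x in M. norm (f x * g x) \<le> norm ((f x)\<^sup>2 + (g x)\<^sup>2)"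
    by simp
qed

lemma square_integrable_cmult:
  assumes "f \<in> square_integrable M"
  shows "(\<lambda>x. c * f x) \<in> square_integrable M"
  using assms by (auto simp: square_integrable_def power_mult_distrib)

lemma square_integrable_add:
  assumes "f \<in> square_integrable M" "g \<in> square_integrable M"
  shows "(\<lambda>x. f x + g x) \<in> square_integrable M"
proof -
  have "(\<lambda>x. (f x + g x)\<^sup>2) = (\<lambda>x. (f x)\<^sup>2 + (g x)\<^sup>2 + 2 * (f x * g x))"
    by (auto simp: power2_sum)
  then show ?thesis
    using assms square_integrable_mult_integrable[OF assms] by (auto simp: square_integrable_def)
qed

lemma square_integrable_diff:
  assumes "f \<in> square_integrable M" "g \<in> square_integrable M"
  shows "(\<lambda>x. f x - g x) \<in> square_integrable M"
  using square_integrable_add[OF assms(1) square_integrable_cmult[OF assms(2), of "-1"]] by simp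

lemma sq_norm_cmult: "sq_norm M (\<lambda>x. c * f x) = c\<^sup>2 * sq_norm M f"
  by (simp add: sq_norm_def power_mult_distrib)

lemma sq_norm_add_le:
  assumes "f \<in> square_integrable M" "g \<in> square_integrable M"
  shows "sq_norm M (\<lambda>x. f x + g x) \<le> 2 * sq_norm M f + 2 * sq_norm M g"
proof -
  have "(LINT x|M. (f x + g x)\<^sup>2) \<le> (LINT x|M. 2 * (f x)\<^sup>2 + 2 * (g x)\<^sup>2)"
  proof (rule integral_mono)
    show "integrable M (\<lambda>x. (f x + g x)\<^sup>2)"
      using square_integrable_add[OF assms] by (simp add: square_integrable_def)
    show "integrable M (\<lambda>x. 2 * (f x)\<^sup>2 + 2 * (g x)\<^sup>2)"
      using assms by (auto simp: square_integrable_def)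
    show "(f x + g x)\<^sup>2 \<le> 2 * (f x)\<^sup>2 + 2 * (g x)\<^sup>2" for x
      using sum_squares_bound[of "f x" "g x"] by (simp add: power2_sum)
  qed
  then show ?thesis
    using assms by (simp add: sq_norm_def square_integrable_def)
qed

lemma sq_norm_triple_le:
  assumes "f \<in> square_integrable M" "g \<in> square_integrable M" "h \<in> square_integrable M"
  shows "sq_norm M (\<lambda>x. f x + g x + h x) \<le> 4 * sq_norm M f + 4 * sq_norm M g + 2 * sq_norm M h"
  using sq_norm_add_le[OF square_integrable_add[OF assms(1,2)] assms(3)] sq_norm_add_le[OF assms(1,2)]
  by simp

lemma nn_integral_square:
  assumes "f \<in> square_integrable M"
  shows "(\<integral>\<^sup>+x. (ennreal \<bar>f x\<bar>)\<^sup>2 \<partial>M) = ennreal (sq_norm M f)"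
proof -
  have "(\<integral>\<^sup>+x. (ennreal \<bar>f x\<bar>)\<^sup>2 \<partial>M) = (\<integral>\<^sup>+x. ennreal ((f x)\<^sup>2) \<partial>M)"
    by (simp add: ennreal_power)
  also have "\<dots> = ennreal (sq_norm M f)"
    unfolding sq_norm_def using assms by (intro nn_integral_eq_integral) (auto simp: square_integrable_def)
  finally show ?thesis .
qed

lemma Cauchy_Schwarz_integral:
  assumes "f \<in> square_integrable M" "g \<in> square_integrable M"
  shows "(LINT x|M. f x * g x)\<^sup>2 \<le> sq_norm M f * sq_norm M g"
proof -
  have [measurable]: "f \<in> borel_measurable M" "g \<in> borel_measurable M"
    using assms by (auto simp: square_integrable_def)
  have "ennreal \<bar>LINT x|M. f x * g x\<bar> \<le> (\<integral>\<^sup>+x. norm (f x * g x) \<partial>M)"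
    using integral_norm_bound_ennreal[OF square_integrable_mult_integrable[OF assms]] by simp
  also have "\<dots> = (\<integral>\<^sup>+x. ennreal \<bar>f x\<bar> * ennreal \<bar>g x\<bar> \<partial>M)"
    by (simp add: abs_mult ennreal_mult)
  finally have "(ennreal \<bar>LINT x|M. f x * g x\<bar>)\<^sup>2 \<le> (\<integral>\<^sup>+x. ennreal \<bar>f x\<bar> * ennreal \<bar>g x\<bar> \<partial>M)\<^sup>2"
    by (rule power_mono) simp
  also have "\<dots> \<le> ennreal (sq_norm M f) * ennreal (sq_norm M g)"
    using Cauchy_Schwarz_nn_integral[of "\<lambda>x. ennreal \<bar>f x\<bar>" M "\<lambda>x. ennreal \<bar>g x\<bar>"]
    by (simp add: nn_integral_square[OF assms(1)] nn_integral_square[OF assms(2)])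
  finally show ?thesis
    by (simp add: ennreal_power ennreal_mult[symmetric])
qed

lemma tendsto_inner_zero:
  assumes "g \<in> square_integrable M" "\<forall>\<^sub>F s in F. f s \<in> square_integrable M"
    and "((\<lambda>s. sq_norm M (f s)) \<longlongrightarrow> 0) F"
  shows "((\<lambda>s. LINT x|M. g x * f s x) \<longlongrightarrow> 0) F"
proof -
  have "((\<lambda>s. (LINT x|M. g x * f s x)\<^sup>2) \<longlongrightarrow> 0) F"
  proof (rule tendsto_sandwich[OF _ _ tendsto_const])
    show "\<forall>\<^sub>F s in F. (LINT x|M. g x * f s x)\<^sup>2 \<le> sq_norm M g * sq_norm M (f s)"
      using assms(2) by eventually_elim (rule Cauchy_Schwarz_integral[OF assms(1)])
    show "((\<lambda>s. sq_norm M g * sq_norm M (f s)) \<longlongrightarrow> 0) F"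
      using tendsto_mult_left[OF assms(3)] by simp
  qed simp
  then show ?thesis
    by (simp add: tendsto_null_power)
qed

lemma tendsto_sq_norm_add:
  assumes "\<forall>\<^sub>F s in F. f s \<in> square_integrable M" "\<forall>\<^sub>F s in F. g s \<in> square_integrable M"
    and "((\<lambda>s. sq_norm M (f s)) \<longlongrightarrow> 0) F" "((\<lambda>s. sq_norm M (g s)) \<longlongrightarrow> 0) F"
  shows "((\<lambda>s. sq_norm M (\<lambda>x. f s x + g s x)) \<longlongrightarrow> 0) F"
proof (rule tendsto_sandwich[OF _ _ tendsto_const])
  show "\<forall>\<^sub>F s in F. sq_norm M (\<lambda>x. f s x + g s x) \<le> 2 * sq_norm M (f s) + 2 * sq_norm M (g s)"
    using assms(1,2) by eventually_elim (rule sq_norm_add_le)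
  show "((\<lambda>s. 2 * sq_norm M (f s) + 2 * sq_norm M (g s)) \<longlongrightarrow> 0) F"
    using tendsto_add[OF tendsto_mult_left[OF assms(3), of 2] tendsto_mult_left[OF assms(4), of 2]] by simp
qed simp

lemma sq_norm_tendsto_zero_dominated:
  assumes "\<And>n. s n \<in> borel_measurable M" "integrable M b"
    and "AE x in M. (\<lambda>n. s n x) \<longlonglongrightarrow> 0" "\<And>n. AE x in M. (s n x)\<^sup>2 \<le> b x"
  shows "(\<lambda>n. sq_norm M (s n)) \<longlonglongrightarrow> 0"
proof -
  have "(\<lambda>n. LINT x|M. (s n x)\<^sup>2) \<longlonglongrightarrow> (LINT x|M. 0)"
  proof (rule integral_dominated_convergence[where w = b])
    show "AE x in M. (\<lambda>n. (s n x)\<^sup>2) \<longlonglongrightarrow> 0"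
      using assms(3) by eventually_elim (rule tendsto_null_power, auto)
    show "AE x in M. norm ((s n x)\<^sup>2) \<le> b x" for n
      using assms(4)[of n] by simp
  qed (use assms in auto)
  then show ?thesis
    by (simp add: sq_norm_def)
qed

section \<open>Translations in the mean\<close>

lemma square_integrable_translate:
  fixes w :: "real \<Rightarrow> real"
  assumes "w \<in> square_integrable lborel"
  shows "(\<lambda>y. w (y + h)) \<in> square_integrable lborel"
    and "sq_norm lborel (\<lambda>y. w (y + h)) = sq_norm lborel w"
proof -
  have [measurable]: "w \<in> borel_measurable borel" and i: "integrable lborel (\<lambda>x. (w x)\<^sup>2)"
    using assms by (auto simp: square_integrable_def)
  show "(\<lambda>y. w (y + h)) \<in> square_integrable lborel"
    using lborel_integrable_real_affine[OF i, of 1 h] by (simp add: square_integrable_def add.commute)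
  show "sq_norm lborel (\<lambda>y. w (y + h)) = sq_norm lborel w"
    using lborel_integral_real_affine[of 1 "\<lambda>x. (w x)\<^sup>2" h] by (simp add: sq_norm_def add.commute)
qed

text \<open>
  Clamping \<open>w\<close> to a bounded range is a small change by dominated convergence. A bounded \<open>w\<close>
  is an almost everywhere limit of continuous functions; after cutting these off outside a
  neighbourhood of the support and clamping them to the same range, dominated convergence applies
  once more.
\<close>

lemma continuous_dense_square_integrable:
  fixes w :: "real \<Rightarrow> real"
  assumes w: "w \<in> square_integrable lborel" and supp: "\<And>x. R < \<bar>x\<bar> \<Longrightarrow> w x = 0" and "e > 0"
  obtains c where "continuous_on UNIV c" "\<And>x. R + 1 < \<bar>x\<bar> \<Longrightarrow> c x = 0" 
    "c \<in> square_integrable lborel" "bounded (range c)" "sq_norm lborel (\<lambda>x. w x - c x) < e"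
proof -
  have [measurable]: "w \<in> borel_measurable borel" and i: "integrable lborel (\<lambda>x. (w x)\<^sup>2)"
    using w by (auto simp: square_integrable_def)
  (* the level of truncation is a natural number, so that dominated convergence along sequences applies *)
  define clamp where "clamp k x = max (- real k) (min (real k) x)" for k and x :: real
  have clamp_cont: "continuous_on UNIV (clamp k)" for k
    unfolding clamp_def by (intro continuous_intros)
  have [measurable]: "clamp k \<in> borel_measurable borel" for k
    using clamp_cont by (rule borel_measurable_continuous_onI)
  have clamp_le: "\<bar>clamp k x\<bar> \<le> real k" for k x
    by (auto simp: clamp_def)
  have "(\<lambda>k. sq_norm lborel (\<lambda>x. w x - clamp k (w x))) \<longlonglongrightarrow> 0"
  proof (rule sq_norm_tendsto_zero_dominated[where b = "\<lambda>x. (w x)\<^sup>2"])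
    have "(\<lambda>k. w x - clamp k (w x)) \<longlonglongrightarrow> 0" for x
    proof (rule tendsto_eventually)
      obtain N :: nat where "\<bar>w x\<bar> \<le> real N"
        using real_arch_simple by blast
      then show "\<forall>\<^sub>F k in sequentially. w x - clamp k (w x) = 0"
        by (intro eventually_sequentiallyI[of N]) (auto simp: clamp_def)
    qed
    then show "AE x in lborel. (\<lambda>k. w x - clamp k (w x)) \<longlonglongrightarrow> 0"
      by simp
    have "\<bar>w x - clamp k (w x)\<bar> \<le> \<bar>w x\<bar>" for x k
      by (auto simp: clamp_def)
    then show "AE x in lborel. (w x - clamp k (w x))\<^sup>2 \<le> (w x)\<^sup>2" for k
      by (simp add: abs_le_square_iff)
  qed (use i in auto)
  then have "\<forall>\<^sub>F k in sequentially. sq_norm lborel (\<lambda>x. w x - clamp k (w x)) < e / 4"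
    using \<open>e > 0\<close> by (intro order_tendstoD(2)) auto
  then obtain k where k: "sq_norm lborel (\<lambda>x. w x - clamp k (w x)) < e / 4"
    using eventually_happens'[OF sequentially_bot] by blast
  have "w measurable_on UNIV"
    by (intro lebesgue_measurable_imp_measurable_on) (auto simp: lebesgue_on_UNIV_eq measurable_completion)
  then obtain N g where N: "negligible N" and g: "\<And>n. continuous_on UNIV (g n)"
    and lim: "\<And>x. x \<notin> N \<Longrightarrow> (\<lambda>n. g n x) \<longlonglongrightarrow> w x"
    by (auto simp: measurable_on_def)
  (* 1 on [-R, R], where w lives, and 0 outside [-R - 1, R + 1] *)
  define cut where "cut x = max 0 (min 1 (R + 1 - \<bar>x\<bar>))" for x :: real
  have cut_cont: "continuous_on UNIV cut"
    unfolding cut_def by (intro continuous_intros)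
  have cut_w: "cut x * w x = w x" for x
    using supp[of x] by (cases "R < \<bar>x\<bar>") (auto simp: cut_def)
  define c where "c n x = clamp k (cut x * g n x)" for n x
  have c_cont: "continuous_on UNIV (c n)" for n
    unfolding c_def using g cut_cont
    by (intro continuous_on_compose2[OF clamp_cont] continuous_on_mult) auto
  have [measurable]: "c n \<in> borel_measurable borel" for n
    using c_cont by (rule borel_measurable_continuous_onI)
  have c_supp: "c n x = 0" if "R + 1 < \<bar>x\<bar>" for n x
    using that by (simp add: c_def cut_def clamp_def)
  have ind: "integrable lborel (\<lambda>x. C * indicator {- (R + 1)..R + 1} x)" for C :: real
    by (cases "0 \<le> R + 1") (auto intro!: integrable_mult_right integrable_real_indicator)
  have c_bound: "(c n x)\<^sup>2 \<le> (real k)\<^sup>2 * indicator {- (R + 1)..R + 1} x" for n x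
  proof (cases "R + 1 < \<bar>x\<bar>")
    case False
    then have "x \<in> {- (R + 1)..R + 1}" by auto
    moreover have "(c n x)\<^sup>2 \<le> (real k)\<^sup>2"
      using clamp_le[of k] unfolding c_def by (metis abs_le_square_iff abs_of_nat)
    ultimately show ?thesis by simp
  qed (simp add: c_supp)
  have c_sq: "c n \<in> square_integrable lborel" for n
    unfolding square_integrable_def
    by (auto intro!: Bochner_Integration.integrable_bound[OF ind[of "(real k)\<^sup>2"]] simp: c_bound[simplified])
  have "(\<lambda>n. sq_norm lborel (\<lambda>x. clamp k (w x) - c n x)) \<longlonglongrightarrow> 0"
  proof (rule sq_norm_tendsto_zero_dominated)
    show "integrable lborel (\<lambda>x. (2 * real k)\<^sup>2 * indicator {- (R + 1)..R + 1} x)"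
      by (rule ind)
    have "N \<in> null_sets lebesgue"
      using N negligible_iff_null_sets by blast
    then have "AE x in lborel. x \<notin> N"
      by (metis AE_completion_iff AE_not_in)
    then show "AE x in lborel. (\<lambda>n. clamp k (w x) - c n x) \<longlonglongrightarrow> 0"
    proof eventually_elim
      fix x assume "x \<notin> N"
      then have "(\<lambda>n. cut x * g n x) \<longlonglongrightarrow> cut x * w x"
        by (intro tendsto_intros lim)
      then have "(\<lambda>n. clamp k (cut x * g n x)) \<longlonglongrightarrow> clamp k (cut x * w x)"
        by (rule continuous_on_tendsto_compose[OF clamp_cont]) auto
      then have "(\<lambda>n. c n x) \<longlonglongrightarrow> clamp k (w x)"
        by (simp add: c_def cut_w)
      from tendsto_diff[OF tendsto_const[of "clamp k (w x)"] this] show "(\<lambda>n. clamp k (w x) - c n x) \<longlonglongrightarrow> 0"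
        by simp
    qed
    have "(clamp k (w x) - c n x)\<^sup>2 \<le> (2 * real k)\<^sup>2 * indicator {- (R + 1)..R + 1} x" for n x
    proof (cases "R + 1 < \<bar>x\<bar>")
      case True
      then show ?thesis
        using supp[of x] by (simp add: c_supp clamp_def)
    next
      case False
      then have "x \<in> {- (R + 1)..R + 1}" by auto
      moreover have "\<bar>clamp k (w x) - c n x\<bar> \<le> \<bar>2 * real k\<bar>"
        using clamp_le[of k "w x"] clamp_le[of k "cut x * g n x"] by (simp add: c_def)
      ultimately show ?thesis
        by (metis abs_le_square_iff indicator_simps(1) mult.right_neutral)
    qed
    then show "AE x in lborel. (clamp k (w x) - c n x)\<^sup>2 \<le> (2 * real k)\<^sup>2 * indicator {- (R + 1)..R + 1} x" for n
      by simp
  qed auto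
  then have "\<forall>\<^sub>F n in sequentially. sq_norm lborel (\<lambda>x. clamp k (w x) - c n x) < e / 4"
    using \<open>e > 0\<close> by (intro order_tendstoD(2)) auto
  then obtain n where n: "sq_norm lborel (\<lambda>x. clamp k (w x) - c n x) < e / 4"
    using eventually_happens'[OF sequentially_bot] by blast
  have ck: "(\<lambda>x. clamp k (w x)) \<in> square_integrable lborel"
    unfolding square_integrable_def
  proof (safe intro!: Bochner_Integration.integrable_bound[OF i])
    have "\<bar>clamp k (w x)\<bar> \<le> \<bar>w x\<bar>" for x
      by (auto simp: clamp_def)
    then show "AE x in lborel. norm ((clamp k (w x))\<^sup>2) \<le> norm ((w x)\<^sup>2)"
      by (simp add: abs_le_square_iff)
  qed auto
  have "sq_norm lborel (\<lambda>x. (w x - clamp k (w x)) + (clamp k (w x) - c n x)) < e"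
    using sq_norm_add_le[OF square_integrable_diff[OF w ck] square_integrable_diff[OF ck c_sq[of n]]] n k
    by linarith
  then have "sq_norm lborel (\<lambda>x. w x - c n x) < e"
    by simp
  moreover have "bounded (range (c n))"
    unfolding bounded_iff using clamp_le by (auto simp: c_def)
  ultimately show ?thesis
    using that[of "c n"] c_cont c_supp c_sq by auto
qed

text \<open>
  For a continuous function of compact support this is dominated convergence. The general case
  follows by density, because translating the approximation error does not change its norm.
\<close>

lemma translation_continuous_L2:
  fixes w :: "real \<Rightarrow> real"
  assumes w: "w \<in> square_integrable lborel" and supp: "\<And>x. R < \<bar>x\<bar> \<Longrightarrow> w x = 0"
  shows "((\<lambda>h. sq_norm lborel (\<lambda>y. w (y + h) - w y)) \<longlongrightarrow> 0) (at 0)"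
proof -
  have c_case: "((\<lambda>h. sq_norm lborel (\<lambda>y. c (y + h) - c y)) \<longlongrightarrow> 0) (at 0)"
    if cont: "continuous_on UNIV c" and supp: "\<And>x. R + 1 < \<bar>x\<bar> \<Longrightarrow> c x = 0" and "bounded (range c)"
    for c :: "real \<Rightarrow> real"
  proof -
    have [measurable]: "c \<in> borel_measurable borel"
      using cont by (rule borel_measurable_continuous_onI)
    obtain B where B: "\<bar>c x\<bar> \<le> B" for x
      using \<open>bounded (range c)\<close> by (auto simp: bounded_iff)
    have small: "(\<lambda>n. sq_norm lborel (\<lambda>y. c (y + X n) - c y)) \<longlonglongrightarrow> 0"
      if X: "X \<longlonglongrightarrow> 0" "\<And>n. \<bar>X n\<bar> \<le> 1" for X :: "nat \<Rightarrow> real"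
    proof (rule sq_norm_tendsto_zero_dominated)
      show "integrable lborel (\<lambda>x. (2 * B)\<^sup>2 * indicator {- (R + 2)..R + 2} x)"
        by (cases "0 \<le> R + 2") (auto intro!: integrable_mult_right integrable_real_indicator)
      have "(\<lambda>n. c (y + X n) - c y) \<longlonglongrightarrow> 0" for y
      proof -
        have "(\<lambda>n. y + X n) \<longlonglongrightarrow> y"
          using tendsto_add[OF tendsto_const X(1)] by simp
        from continuous_on_tendsto_compose[OF cont this] show ?thesis
          by (simp add: LIM_zero_iff)
      qed
      then show "AE y in lborel. (\<lambda>n. c (y + X n) - c y) \<longlonglongrightarrow> 0"
        by simp
      have "(c (y + X n) - c y)\<^sup>2 \<le> (2 * B)\<^sup>2 * indicator {- (R + 2)..R + 2} y" for n y
      proof (cases "y \<in> {- (R + 2)..R + 2}")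
        case False
        then have "R + 1 < \<bar>y\<bar>" "R + 1 < \<bar>y + X n\<bar>"
          using X(2)[of n] by auto
        then show ?thesis by (simp add: supp)
      next
        case True
        have "\<bar>c (y + X n) - c y\<bar> \<le> \<bar>2 * B\<bar>"
          using B[of y] B[of "y + X n"] by linarith
        then show ?thesis
          using True by (metis abs_le_square_iff indicator_simps(1) mult.right_neutral)
      qed
      then show "AE y in lborel. (c (y + X n) - c y)\<^sup>2 \<le> (2 * B)\<^sup>2 * indicator {- (R + 2)..R + 2} y" for n
        by simp
    qed auto
    show ?thesis
      unfolding tendsto_at_iff_sequentially
    proof safe
      fix X :: "nat \<Rightarrow> real" assume X: "X \<longlonglongrightarrow> 0"
      have "\<forall>\<^sub>F n in sequentially. \<bar>X n\<bar> < 1"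
        using order_tendstoD(2)[OF tendsto_rabs[OF X], of 1] by simp
      then obtain N where N: "\<And>n. n \<ge> N \<Longrightarrow> \<bar>X n\<bar> < 1"
        by (auto simp: eventually_sequentially)
      have "(\<lambda>n. sq_norm lborel (\<lambda>y. c (y + X (n + N)) - c y)) \<longlonglongrightarrow> 0"
        using LIMSEQ_ignore_initial_segment[OF X, of N] N by (intro small) (auto simp: less_imp_le)
      then show "((\<lambda>h. sq_norm lborel (\<lambda>y. c (y + h) - c y)) \<circ> X) \<longlonglongrightarrow> 0"
        using LIMSEQ_offset[of "\<lambda>n. sq_norm lborel (\<lambda>y. c (y + X n) - c y)" N 0] by (simp add: o_def)
    qed
  qed
  show ?thesis
  proof (rule order_tendstoI)
    fix e :: real assume "0 < e"
    then have e: "e / 16 > 0" by simp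
    obtain c where c: "continuous_on UNIV c" "\<And>x. R + 1 < \<bar>x\<bar> \<Longrightarrow> c x = 0"
      "c \<in> square_integrable lborel" "bounded (range c)" "sq_norm lborel (\<lambda>x. w x - c x) < e / 16"
      by (rule continuous_dense_square_integrable[OF w, of R "e / 16"]) (use supp e in blast)+
    have "\<forall>\<^sub>F h in at 0. sq_norm lborel (\<lambda>y. c (y + h) - c y) < e / 16"
      using c_case[OF c(1,2,4)] \<open>e / 16 > 0\<close> by (rule order_tendstoD(2))
    then show "\<forall>\<^sub>F h in at 0. sq_norm lborel (\<lambda>y. w (y + h) - w y) < e"
    proof eventually_elim
      case (elim h)
      have wc: "(\<lambda>y. w y - c y) \<in> square_integrable lborel"
        by (rule square_integrable_diff[OF w c(3)])
      have cw: "(\<lambda>y. (-1) * (w y - c y)) \<in> square_integrable lborel"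
        by (rule square_integrable_cmult[OF wc])
      have "sq_norm lborel (\<lambda>y. w (y + h) - w y) =
        sq_norm lborel (\<lambda>y. (w (y + h) - c (y + h)) + (c (y + h) - c y) + (-1) * (w y - c y))"
        by simp
      also have "\<dots> \<le> 4 * sq_norm lborel (\<lambda>y. w (y + h) - c (y + h)) + 4 * sq_norm lborel (\<lambda>y. c (y + h) - c y)
          + 2 * sq_norm lborel (\<lambda>y. (-1) * (w y - c y))"
        by (intro sq_norm_triple_le cw square_integrable_translate(1)[OF wc]
            square_integrable_diff[OF square_integrable_translate(1)[OF c(3)] c(3)])
      also have "sq_norm lborel (\<lambda>y. (-1) * (w y - c y)) = sq_norm lborel (\<lambda>y. w y - c y)"
        by (subst sq_norm_cmult) simp
      also have "sq_norm lborel (\<lambda>y. w (y + h) - c (y + h)) = sq_norm lborel (\<lambda>y. w y - c y)"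
        by (rule square_integrable_translate(2)[OF wc])
      finally show ?case
        using elim c(5) \<open>0 < e\<close> by linarith
    qed
  qed (auto intro!: always_eventually intro: order_less_le_trans[OF _ sq_norm_nonneg])
qed

text \<open>
  The average of \<open>w\<close> over the segment from \<open>y\<close> to \<open>y + h\<close> is the difference quotient of a primitive
  of \<open>w\<close>, so this is the mean-square differentiability of primitives. The square of an average is at
  most the average of the squares (Cauchy-Schwarz), and after exchanging the integrals each translation
  by \<open>h * r\<close> is controlled by the continuity of translations. The bound is stated for the nonnegative
  integral because Tonelli's theorem applies to it directly.
\<close>

lemma translation_average_L2:
  fixes w :: "real \<Rightarrow> real"
  assumes w: "w \<in> square_integrable lborel" and supp: "\<And>x. R < \<bar>x\<bar> \<Longrightarrow> w x = 0" and "e > 0"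
  obtains d where "d > 0" "\<And>h. \<bar>h\<bar> < d \<Longrightarrow>
    (\<integral>\<^sup>+y. ennreal ((LINT r:{0..1}|lborel. w (y + h * r) - w y)\<^sup>2) \<partial>lborel) \<le> ennreal e"
proof -
  have [measurable]: "w \<in> borel_measurable borel"
    using w by (auto simp: square_integrable_def)
  have "\<forall>\<^sub>F h in at 0. sq_norm lborel (\<lambda>y. w (y + h) - w y) < e"
    using translation_continuous_L2[OF w supp] \<open>e > 0\<close> by (rule order_tendstoD(2))
  then obtain d where d: "d > 0" "\<And>h. h \<noteq> 0 \<Longrightarrow> \<bar>h\<bar> < d \<Longrightarrow> sq_norm lborel (\<lambda>y. w (y + h) - w y) < e"
    by (auto simp: eventually_at dist_real_def)
  show ?thesis
  proof (rule that[OF \<open>d > 0\<close>])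
    fix h :: real assume h: "\<bar>h\<bar> < d"
    have jensen: "ennreal ((LINT r:{0..1}|lborel. w (y + h * r) - w y)\<^sup>2)
      \<le> (\<integral>\<^sup>+r. ennreal ((w (y + h * r) - w y)\<^sup>2) * indicator {0..1} r \<partial>lborel)" for y
    proof -
      let ?k = "\<lambda>r. indicator {0..1} r *\<^sub>R (w (y + h * r) - w y)"
      have "ennreal \<bar>integral\<^sup>L lborel ?k\<bar> \<le> (\<integral>\<^sup>+r. ennreal \<bar>?k r\<bar> \<partial>lborel)"
        using integral_norm_bound_ennreal[of lborel ?k]
        by (cases "integrable lborel ?k") (auto simp: not_integrable_integral_eq)
      also have "\<dots> = (\<integral>\<^sup>+r. ennreal \<bar>?k r\<bar> * indicator {0..1} r \<partial>lborel)"
        by (intro nn_integral_cong) (auto split: split_indicator)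
      finally have "(ennreal \<bar>integral\<^sup>L lborel ?k\<bar>)\<^sup>2
        \<le> (\<integral>\<^sup>+r. ennreal \<bar>?k r\<bar> * indicator {0..1} r \<partial>lborel)\<^sup>2"
        by (rule power_mono) simp
      also have "\<dots> \<le> (\<integral>\<^sup>+r. (ennreal \<bar>?k r\<bar>)\<^sup>2 \<partial>lborel) * (\<integral>\<^sup>+r. (indicator {0..1} r)\<^sup>2 \<partial>(lborel :: real measure))"
        by (rule Cauchy_Schwarz_nn_integral) auto
      also have "(\<integral>\<^sup>+r. (indicator {0..1} r)\<^sup>2 \<partial>(lborel :: real measure)) = (\<integral>\<^sup>+r. indicator {0..1} r \<partial>(lborel :: real measure))"
        by (intro nn_integral_cong) (auto split: split_indicator)
      also have "\<dots> = 1"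
        by simp
      also have "(\<integral>\<^sup>+r. (ennreal \<bar>?k r\<bar>)\<^sup>2 \<partial>lborel)
        = (\<integral>\<^sup>+r. ennreal ((w (y + h * r) - w y)\<^sup>2) * indicator {0..1} r \<partial>lborel)"
        by (intro nn_integral_cong) (auto split: split_indicator simp: ennreal_power)
      finally show ?thesis
        by (simp add: set_lebesgue_integral_def ennreal_power)
    qed
    have "(\<integral>\<^sup>+y. ennreal ((LINT r:{0..1}|lborel. w (y + h * r) - w y)\<^sup>2) \<partial>lborel)
      \<le> (\<integral>\<^sup>+y. \<integral>\<^sup>+r. ennreal ((w (y + h * r) - w y)\<^sup>2) * indicator {0..1} r \<partial>lborel \<partial>lborel)"
      by (intro nn_integral_mono jensen)
    also have "\<dots> = (\<integral>\<^sup>+r. \<integral>\<^sup>+y. ennreal ((w (y + h * r) - w y)\<^sup>2) * indicator {0..1} r \<partial>lborel \<partial>lborel)"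
      by (rule lborel_pair.Fubini') measurable
    also have "\<dots> \<le> (\<integral>\<^sup>+r. ennreal e * indicator {0..1} r \<partial>(lborel :: real measure))"
    proof (rule nn_integral_mono)
      fix r :: real
      show "(\<integral>\<^sup>+y. ennreal ((w (y + h * r) - w y)\<^sup>2) * indicator {0..1} r \<partial>lborel) \<le> ennreal e * indicator {0..1} r"
      proof (cases "r \<in> {0..1}")
        case True
        have "\<bar>h * r\<bar> \<le> \<bar>h\<bar>"
          using True by (simp add: abs_mult mult_left_le)
        then have "sq_norm lborel (\<lambda>y. w (y + h * r) - w y) \<le> e"
          using h d(2)[of "h * r"] \<open>e > 0\<close> by (cases "h * r = 0") (auto simp: sq_norm_def)
        moreover have "(\<integral>\<^sup>+y. ennreal ((w (y + h * r) - w y)\<^sup>2) \<partial>lborel) = ennreal (sq_norm lborel (\<lambda>y. w (y + h * r) - w y))"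
          using nn_integral_square[OF square_integrable_diff[OF square_integrable_translate(1)[OF w] w], of "h * r"]
          by (simp add: ennreal_power)
        ultimately show ?thesis
          using True by (simp add: ennreal_leI)
      qed simp
    qed
    also have "\<dots> = ennreal e"
      by (simp add: nn_integral_cmult)
    finally show "(\<integral>\<^sup>+y. ennreal ((LINT r:{0..1}|lborel. w (y + h * r) - w y)\<^sup>2) \<partial>lborel) \<le> ennreal e" .
  qed
qed

section \<open>Integration by parts on the unit interval\<close>

lemma finite_measure_unit: "finite_measure unit_measure"
  by (rule finite_measure_lebesgue_on) simp

lemma AE_unit_measure_iff: "(AE x in unit_measure. P x) \<longleftrightarrow> (AE x in lborel. x \<in> {0<..<1} \<longrightarrow> P x)"
  by (simp add: AE_restrict_space_iff AE_completion_iff)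

lemma L2_imp_integrable:
  assumes "f \<in> L2"
  shows "integrable unit_measure f"
proof (rule finite_measure.square_integrable_imp_integrable[OF finite_measure_unit])
  show "f \<in> borel_measurable unit_measure" "integrable unit_measure (\<lambda>x. (f x)\<^sup>2)"
    using assms unfolding L2_def by blast+
qed

lemma nn_integral_unit_measure:
  "(\<integral>\<^sup>+x. f x \<partial>unit_measure) = (\<integral>\<^sup>+x. f x * indicator {0<..<1} x \<partial>lborel)"
  by (simp add: nn_integral_restrict_space nn_integral_completion)

lemma sq_norm_unit_bounded:
  assumes "\<And>x. x \<in> {0<..<1} \<Longrightarrow> \<bar>f x\<bar> \<le> e"
  shows "sq_norm unit_measure f \<le> e\<^sup>2"
  unfolding sq_norm_def
proof (rule integral_real_bounded)
  have "(f x)\<^sup>2 \<le> e\<^sup>2" if "x \<in> {0<..<1}" for x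
    using assms[OF that] by (metis abs_ge_self abs_le_square_iff order_trans)
  then have "(\<integral>\<^sup>+x. ennreal ((f x)\<^sup>2) \<partial>unit_measure) \<le> (\<integral>\<^sup>+x. ennreal (e\<^sup>2) * indicator {0<..<1} (x::real) \<partial>lborel)"
    unfolding nn_integral_unit_measure by (intro nn_integral_mono) (auto split: split_indicator simp: ennreal_leI)
  also have "\<dots> = ennreal (e\<^sup>2)"
    by (simp add: nn_integral_cmult)
  finally show "(\<integral>\<^sup>+x. ennreal ((f x)\<^sup>2) \<partial>unit_measure) \<le> ennreal (e\<^sup>2)" .
qed simp

lemma continuous_in_L2:
  assumes "continuous_on {0..1} f"
  shows "f \<in> L2"
proof -
  have m: "f \<in> borel_measurable unit_measure"
    by (rule continuous_imp_measurable_on_sets_lebesgue[OF continuous_on_subset[OF assms]]) auto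
  have "compact (f ` {0..1})"
    by (rule compact_continuous_image[OF assms]) simp
  then obtain B where B: "\<forall>x\<in>{0..1}. \<bar>f x\<bar> \<le> B"
    using compact_imp_bounded[of "f ` {0..1}"] by (auto simp: bounded_iff)
  have "integrable unit_measure (\<lambda>x. (f x)\<^sup>2)"
  proof (rule finite_measure.integrable_const_bound[OF finite_measure_unit])
    have "(f x)\<^sup>2 \<le> B\<^sup>2" if "x \<in> {0..1}" for x
      using bspec[OF B that] by (metis abs_ge_self abs_le_square_iff order_trans)
    then show "AE x in unit_measure. norm ((f x)\<^sup>2) \<le> B\<^sup>2"
      by (intro AE_I2) auto
  qed (use m in auto)
  with m show ?thesis by (simp add: L2_def)
qed

lemma unit_integrable_imp_absolutely_integrable:
  fixes f :: "real \<Rightarrow> real"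
  assumes "integrable unit_measure f"
  shows "f absolutely_integrable_on {0..1}"
proof -
  have "f absolutely_integrable_on {0<..<1}"
    using assms by (simp add: set_integrable_def integrable_restrict_space)
  moreover have "negligible {x \<in> {0<..<1} - {0..1}. f x \<noteq> 0}" "negligible {x \<in> {0..1} - {0<..<1}. f x \<noteq> 0}"
    by (rule negligible_subset[of "{0,1}"]; auto)+
  ultimately show ?thesis
    using absolutely_integrable_spike_set_eq by blast
qed

lemma unit_integrable_imp_integrable_on:
  fixes f :: "real \<Rightarrow> real"
  assumes "integrable unit_measure f" "0 \<le> a" "b \<le> 1"
  shows "f integrable_on {a..b}"
proof -
  have "f absolutely_integrable_on {a..b}"
    by (rule set_integrable_subset[OF unit_integrable_imp_absolutely_integrable[OF assms(1)]]) (use assms in auto)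
  then show ?thesis
    using set_lebesgue_integral_eq_integral(1) by blast
qed

lemma integral_unit_measure:
  fixes f :: "real \<Rightarrow> real"
  assumes "integrable unit_measure f"
  shows "(LINT x|unit_measure. f x) = integral {0..1} f"
proof -
  have "(LINT x|unit_measure. f x) = integral {0<..<1} f"
    by (rule lebesgue_integral_eq_integral[OF assms]) simp
  also have "\<dots> = integral {0..1} f"
    by (rule integral_open_interval_real[symmetric])
  finally show ?thesis .
qed

text \<open>
  Fubini's theorem and translations are applied to Borel functions on the line; this is the passage
  from Lebesgue measurable functions on the interval.
\<close>

lemma borel_representative:
  fixes f :: "real \<Rightarrow> real"
  assumes "f \<in> borel_measurable unit_measure"
  obtains f' where "f' \<in> borel_measurable borel" "\<And>x. x \<notin> {0<..<1} \<Longrightarrow> f' x = 0"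
    "AE x in unit_measure. f' x = f x"
proof -
  have "(\<lambda>x. if x \<in> {0<..<1} then f x else 0) \<in> borel_measurable lebesgue"
    using assms by (rule borel_measurable_if_I) simp
  then obtain g where g: "g \<in> borel_measurable lborel"
    "AE x in lborel. (if x \<in> {0<..<1} then f x else 0) = g x"
    using completion_ex_borel_measurable_real by blast
  show ?thesis
  proof (rule that[of "\<lambda>x. g x * indicator {0<..<1} x"])
    show "AE x in unit_measure. g x * indicator {0<..<1} x = f x"
      unfolding AE_unit_measure_iff using g(2) by eventually_elim (auto split: if_splits)
  qed (use g(1) in auto)
qed

lemma borel_measurable_unit:
  fixes f :: "real \<Rightarrow> real"
  assumes "f \<in> borel_measurable borel"
  shows "f \<in> borel_measurable unit_measure"
  using assms by (simp add: measurable_restrict_space1 measurable_completion)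

lemma unit_measure_eq_lborel:
  fixes f :: "real \<Rightarrow> real"
  assumes "f \<in> borel_measurable borel" "\<And>x. x \<notin> {0<..<1} \<Longrightarrow> f x = (0::real)"
  shows "integrable unit_measure f \<longleftrightarrow> integrable lborel f"
    and "(LINT x|unit_measure. f x) = (LINT x|lborel. f x)"
proof -
  have eq: "(\<lambda>x. indicator {0<..<1} x * f x) = f"
    using assms(2) by (auto simp: fun_eq_iff split: split_indicator)
  show "integrable unit_measure f \<longleftrightarrow> integrable lborel f"
    using assms(1) by (simp add: integrable_restrict_space eq integrable_completion)
  show "(LINT x|unit_measure. f x) = (LINT x|lborel. f x)"
    using assms(1) by (simp add: integral_restrict_space eq integral_completion)
qed

lemma integral_cong_AE_unit:
  fixes f g :: "real \<Rightarrow> real"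
  assumes "AE x in unit_measure. f x = g x" "0 \<le> a" "b \<le> 1"
  shows "integral {a..b} f = integral {a..b} g"
proof -
  have "AE x in lebesgue. x \<in> {0<..<1} \<longrightarrow> f x = g x"
    using assms(1) by (simp add: AE_restrict_space_iff)
  then obtain N where N: "N \<in> null_sets lebesgue" "{x. \<not> (x \<in> {0<..<1} \<longrightarrow> f x = g x)} \<subseteq> N"
    by (auto simp: eventually_ae_filter)
  then have "negligible (N \<union> {0,1})"
    by (simp add: negligible_iff_null_sets)
  then show ?thesis
  proof (rule integral_spike)
    fix x assume x: "x \<in> {a..b} - (N \<union> {0,1})"
    then have "x \<in> {0<..<1}"
      using assms(2,3) by auto
    with x N(2) show "g x = f x"
      by auto
  qed
qed

text \<open>
  Integration by parts in its symmetric form: the square is split along its diagonal, a null set,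
  into two triangles, and Fubini's theorem evaluates the integral of \<open>a s * b x\<close> over each of them.
\<close>

lemma product_of_primitives_lborel:
  fixes a b :: "real \<Rightarrow> real"
  assumes a: "integrable lborel a" and b: "integrable lborel b"
  shows "integrable lborel (\<lambda>x. (LINT s:{..x}|lborel. a s) * b x)"
    and "(LINT x|lborel. (LINT s:{..x}|lborel. a s) * b x) + (LINT x|lborel. (LINT s:{..x}|lborel. b s) * a x)
      = (LINT x|lborel. a x) * (LINT x|lborel. b x)"
proof -
  have [measurable]: "p \<in> borel_measurable borel" if "integrable lborel p" for p :: "real \<Rightarrow> real"
    using that by simp
  have meas: "Measurable.pred (lborel \<Otimes>\<^sub>M lborel) (\<lambda>z. snd z \<le> (fst z :: real))"
    by measurable
  have prod: "integrable (lborel \<Otimes>\<^sub>M lborel) (\<lambda>(x, s). indicator {..x} s * p s * q x)"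
    if p: "integrable lborel p" and q: "integrable lborel q" for p q :: "real \<Rightarrow> real"
  proof (rule Bochner_Integration.integrable_bound)
    note [measurable] = p[THEN borel_measurable_integrable] q[THEN borel_measurable_integrable]
    show "integrable (lborel \<Otimes>\<^sub>M lborel) (\<lambda>z. q (fst z) * p (snd z))"
    proof (rule lborel_pair.Fubini_integrable)
      show "integrable lborel (\<lambda>x. LINT y|lborel. norm (q (fst (x, y)) * p (snd (x, y))))"
        using q by (simp add: abs_mult)
      show "AE x in lborel. integrable lborel (\<lambda>y. q (fst (x, y)) * p (snd (x, y)))"
        using p by simp
    qed measurable
    have "(\<lambda>(x, s). indicator {..x} s * p s * q x) = (\<lambda>z. (if snd z \<le> fst z then 1 else 0) * p (snd z) * q (fst z))"
      by (auto simp: fun_eq_iff split: split_indicator)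
    moreover have "(\<lambda>z. (if snd z \<le> fst z then 1 else 0) * p (snd z) * q (fst z)) \<in> borel_measurable (lborel \<Otimes>\<^sub>M lborel)"
      using meas by measurable
    ultimately show "(\<lambda>(x, s). indicator {..x} s * p s * q x) \<in> borel_measurable (lborel \<Otimes>\<^sub>M lborel)"
      by simp
    show "AE z in lborel \<Otimes>\<^sub>M lborel. norm (case z of (x, s) \<Rightarrow> indicator {..x} s * p s * q x) \<le> norm (q (fst z) * p (snd z))"
      by (auto simp: abs_mult split: split_indicator)
  qed
  have eq: "(LINT s:{..x}|lborel. p s) * q x = (LINT s|lborel. indicator {..x} s * p s * q x)" for p q :: "real \<Rightarrow> real" and x
    by (simp add: set_lebesgue_integral_def)
  show "integrable lborel (\<lambda>x. (LINT s:{..x}|lborel. a s) * b x)"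
    unfolding eq using lborel_pair.integrable_fst[OF prod[OF a b]] .
  have I1: "integrable lborel (\<lambda>x. LINT s|lborel. indicator {..x} s * a s * b x)"
    using lborel_pair.integrable_fst[OF prod[OF a b]] .
  have I2: "integrable lborel (\<lambda>s. LINT x|lborel. indicator {..x} s * b s * a x)"
    using lborel_pair.integrable_snd[OF prod[OF b a]] .
  have sum: "(LINT s|lborel. indicator {..x} s * a s * b x) + (LINT s|lborel. indicator {..s} x * b x * a s)
     = (LINT s|lborel. a s) * b x" for x
  proof -
    have i: "integrable lborel (\<lambda>s. indicator {..x} s * a s * b x)" "integrable lborel (\<lambda>s. indicator {..s} x * b x * a s)"
      using integrable_mult_left[OF integrable_real_mult_indicator[OF _ a, of "{..x}"], of "b x"]
        integrable_mult_left[OF integrable_real_mult_indicator[OF _ a, of "{x..}"], of "b x"]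
      by (simp_all add: indicator_def mult_ac)
    then have "(LINT s|lborel. indicator {..x} s * a s * b x) + (LINT s|lborel. indicator {..s} x * b x * a s)
      = (LINT s|lborel. indicator {..x} s * a s * b x + indicator {..s} x * b x * a s)"
      by (rule Bochner_Integration.integral_add[symmetric])
    also have "\<dots> = (LINT s|lborel. a s * b x)"
    proof (rule integral_cong_AE)
      have "AE s in lborel. s \<noteq> x"
        by (rule AE_lborel_singleton)
      then show "AE s in lborel. indicator {..x} s * a s * b x + indicator {..s} x * b x * a s = a s * b x"
        by eventually_elim (auto split: split_indicator)
    qed (use i a in auto)
    finally show ?thesis by simp
  qed
  have "(LINT x|lborel. (LINT s:{..x}|lborel. a s) * b x) + (LINT x|lborel. (LINT s:{..x}|lborel. b s) * a x)
    = (LINT x|lborel. LINT s|lborel. indicator {..x} s * a s * b x)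
      + (LINT x|lborel. LINT s|lborel. indicator {..x} s * b s * a x)"
    unfolding eq ..
  also have "(LINT x|lborel. LINT s|lborel. indicator {..x} s * b s * a x)
    = (LINT s|lborel. LINT x|lborel. indicator {..x} s * b s * a x)"
    using lborel_pair.integral_fst[OF prod[OF b a]] lborel_pair.integral_snd[OF prod[OF b a]] by simp
  also have "(LINT x|lborel. LINT s|lborel. indicator {..x} s * a s * b x) + \<dots>
    = (LINT x|lborel. (LINT s|lborel. a s) * b x)"
    by (subst Bochner_Integration.integral_add[OF I1 I2, symmetric]) (simp only: sum)
  finally show "(LINT x|lborel. (LINT s:{..x}|lborel. a s) * b x) + (LINT x|lborel. (LINT s:{..x}|lborel. b s) * a x)
      = (LINT x|lborel. a x) * (LINT x|lborel. b x)"
    by simp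
qed

lemma integrable_borel_representative:
  fixes f :: "real \<Rightarrow> real"
  assumes "integrable unit_measure f"
  obtains f' where "integrable lborel f'" "\<And>x. x \<notin> {0<..<1} \<Longrightarrow> f' x = 0"
    "AE x in unit_measure. f' x = f x" "(LINT x|lborel. f' x) = (LINT x|unit_measure. f x)"
proof -
  obtain f' where f': "f' \<in> borel_measurable borel" "\<And>x. x \<notin> {0<..<1} \<Longrightarrow> f' x = 0"
    "AE x in unit_measure. f' x = f x"
    by (rule borel_representative[OF borel_measurable_integrable[OF assms]]) blast
  have m: "f' \<in> borel_measurable unit_measure"
    by (rule borel_measurable_unit[OF f'(1)])
  have "AE x in unit_measure. f x = f' x"
    using f'(3) by eventually_elim simp
  then have "integrable unit_measure f'"
    by (rule integrable_cong_AE_imp[OF assms m])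
  moreover have "(LINT x|unit_measure. f' x) = (LINT x|unit_measure. f x)"
    by (rule integral_cong_AE[OF m borel_measurable_integrable[OF assms] f'(3)])
  ultimately show ?thesis
    using that[of f'] unit_measure_eq_lborel[OF f'(1,2)] f'(2,3) by simp
qed

lemma primitive_eq_lborel:
  fixes f f' :: "real \<Rightarrow> real"
  assumes f: "integrable unit_measure f" and f': "integrable lborel f'" "\<And>x. x \<notin> {0<..<1} \<Longrightarrow> f' x = 0"
    "AE x in unit_measure. f' x = f x" and x: "x \<in> {0..1}"
  shows "integral {0..x} f = (LINT s:{..x}|lborel. f' s)"
proof -
  have "integral {0..x} f = integral {0..x} f'"
    using x by (intro integral_cong_AE_unit[OF AE_mp[OF f'(3)]]) auto
  also have "\<dots> = (LINT s:{0..x}|lborel. f' s)"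
    by (rule set_borel_integral_eq_integral(2)[symmetric])
      (use integrable_mult_indicator[OF _ f'(1), of "{0..x}"] in \<open>simp add: set_integrable_def\<close>)
  also have "\<dots> = (LINT s:{..x}|lborel. f' s)"
    unfolding set_lebesgue_integral_def
    by (rule Bochner_Integration.integral_cong) (auto simp: f'(2) split: split_indicator)
  finally show ?thesis .
qed

text \<open>
  This single identity serves twice: with a test function as \<open>B\<close> it shows that primitives have weak
  derivatives, and with \<open>A = B\<close> it gives the boundary terms of the energy identity.
\<close>

lemma integration_by_parts_primitives:
  fixes a b A B :: "real \<Rightarrow> real"
  assumes a: "integrable unit_measure a" and b: "integrable unit_measure b"
    and A: "\<And>x. x \<in> {0..1} \<Longrightarrow> A x = A 0 + integral {0..x} a"
    and B: "\<And>x. x \<in> {0..1} \<Longrightarrow> B x = B 0 + integral {0..x} b"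
  shows "(LINT x|unit_measure. A x * b x) + (LINT x|unit_measure. B x * a x) = A 1 * B 1 - A 0 * B 0"
proof -
  obtain a' where a': "integrable lborel a'" "\<And>x. x \<notin> {0<..<1} \<Longrightarrow> a' x = 0"
    "AE x in unit_measure. a' x = a x" "(LINT x|lborel. a' x) = (LINT x|unit_measure. a x)"
    by (rule integrable_borel_representative[OF a]) blast
  obtain b' where b': "integrable lborel b'" "\<And>x. x \<notin> {0<..<1} \<Longrightarrow> b' x = 0"
    "AE x in unit_measure. b' x = b x" "(LINT x|lborel. b' x) = (LINT x|unit_measure. b x)"
    by (rule integrable_borel_representative[OF b]) blast
  have part: "(LINT x|unit_measure. P x * q x) = P 0 * (LINT x|lborel. q' x) + (LINT x|lborel. (LINT s:{..x}|lborel. p' s) * q' x)"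
    if p: "integrable unit_measure p" and P: "\<And>x. x \<in> {0..1} \<Longrightarrow> P x = P 0 + integral {0..x} p"
      and p': "integrable lborel p'" "\<And>x. x \<notin> {0<..<1} \<Longrightarrow> p' x = 0" "AE x in unit_measure. p' x = p x"
      and q: "integrable unit_measure q"
      and q': "integrable lborel q'" "\<And>x. x \<notin> {0<..<1} \<Longrightarrow> q' x = 0" "AE x in unit_measure. q' x = q x"
    for P p p' q q' :: "real \<Rightarrow> real"
  proof -
    let ?h = "\<lambda>x. P 0 * q' x + (LINT s:{..x}|lborel. p' s) * q' x"
    have ih: "integrable lborel ?h"
      using product_of_primitives_lborel(1)[OF p'(1) q'(1)] q'(1) by simp
    then have mh: "?h \<in> borel_measurable borel"
      by simp
    have "AE x in unit_measure. P x * q x = ?h x"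
      using q'(3) AE_space[of unit_measure]
    proof eventually_elim
      case (elim x)
      then have "P x = P 0 + (LINT s:{..x}|lborel. p' s)"
        using P[of x] primitive_eq_lborel[OF p p', of x] by simp
      then show ?case
        using elim by (simp add: algebra_simps)
    qed
    moreover have "(\<lambda>x. P x * q x) \<in> borel_measurable unit_measure"
    proof -
      have "continuous_on {0..1} (\<lambda>x. P 0 + integral {0..x} p)"
        by (intro continuous_on_add continuous_on_const indefinite_integral_continuous_1 unit_integrable_imp_integrable_on[OF p]) auto
      then have "continuous_on {0..1} P"
        by (rule continuous_on_eq) (simp add: P[symmetric])
      then show ?thesis
        using continuous_in_L2[of P] q by (auto simp: L2_def)
    qed
    ultimately have "(LINT x|unit_measure. P x * q x) = (LINT x|unit_measure. ?h x)"
      using borel_measurable_unit[OF mh] by (intro integral_cong_AE) auto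
    also have "\<dots> = (LINT x|lborel. ?h x)"
      using mh q'(2) by (intro unit_measure_eq_lborel(2)) auto
    also have "\<dots> = P 0 * (LINT x|lborel. q' x) + (LINT x|lborel. (LINT s:{..x}|lborel. p' s) * q' x)"
      using product_of_primitives_lborel(1)[OF p'(1) q'(1)] q'(1) by simp
    finally show ?thesis .
  qed
  have "A 1 = A 0 + (LINT x|lborel. a' x)" "B 1 = B 0 + (LINT x|lborel. b' x)"
    using A[of 1] B[of 1] integral_unit_measure[OF a] integral_unit_measure[OF b] a'(4) b'(4) by auto
  then show ?thesis
    using part[OF a A a'(1-3) b b'(1-3)] part[OF b B b'(1-3) a a'(1-3)]
      product_of_primitives_lborel(2)[OF a'(1) b'(1)]
    by (simp add: algebra_simps)
qed

section \<open>Smooth cut-off functions\<close>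

text \<open>
  A whole family of iterated derivatives is carried along, so that closure properties are proved by
  writing down the family instead of by induction on iterated \<open>deriv\<close>.
\<close>

definition smooth :: "(real \<Rightarrow> real) \<Rightarrow> bool"
  where "smooth f \<longleftrightarrow> (\<exists>F. F 0 = f \<and> (\<forall>n x. (F n has_real_derivative F (Suc n) x) (at x)))"

lemma smooth_imp_deriv_differentiable:
  assumes "smooth f"
  shows "((deriv ^^ n) f) differentiable_on UNIV"
proof -
  obtain F where F: "F 0 = f" "\<And>n x. (F n has_real_derivative F (Suc n) x) (at x)"
    using assms by (auto simp: smooth_def)
  have "(deriv ^^ n) f = F n"
  proof (induction n)
    case (Suc n)
    show ?case
      unfolding funpow.simps o_apply Suc by (rule ext) (rule DERIV_imp_deriv[OF F(2)])
  qed (simp add: F)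
  moreover have "F n differentiable (at x)" for x
    unfolding real_differentiable_def using F(2) by blast
  ultimately show ?thesis
    by (simp add: differentiable_on_def)
qed

text \<open>
  Prefixing \<open>f\<close> to the derivatives of \<open>f'\<close> gives the family for \<open>f\<close>.
\<close>

lemma smooth_antiderivative:
  assumes "\<And>x. (f has_real_derivative f' x) (at x)" "smooth f'"
  shows "smooth f"
proof -
  obtain F where F: "F 0 = f'" "\<And>n x. (F n has_real_derivative F (Suc n) x) (at x)"
    using assms(2) by (auto simp: smooth_def)
  have "(case_nat f F n has_real_derivative case_nat f F (Suc n) x) (at x)" for n x
    using F assms(1) by (cases n) auto
  then show ?thesis
    unfolding smooth_def by (intro exI[of _ "case_nat f F"]) auto
qed

lemma smooth_affine:
  assumes "smooth f"
  shows "smooth (\<lambda>x. f (a * x + b))"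
proof -
  obtain F where F: "F 0 = f" "\<And>n x. (F n has_real_derivative F (Suc n) x) (at x)"
    using assms by (auto simp: smooth_def)
  have "((\<lambda>x. a ^ n * F n (a * x + b)) has_real_derivative a ^ Suc n * F (Suc n) (a * x + b)) (at x)" for n x
    by (rule derivative_eq_intros DERIV_chain2[OF F(2)] refl | simp)+
  then show ?thesis
    unfolding smooth_def using F(1) by (intro exI[of _ "\<lambda>n x. a ^ n * F n (a * x + b)"]) auto
qed

lemma smooth_lincomb:
  assumes "smooth f" "smooth g"
  shows "smooth (\<lambda>x. a * f x + b * g x)"
proof -
  obtain F where F: "F 0 = f" "\<And>n x. (F n has_real_derivative F (Suc n) x) (at x)"
    using assms by (auto simp: smooth_def)
  obtain G where G: "G 0 = g" "\<And>n x. (G n has_real_derivative G (Suc n) x) (at x)"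
    using assms by (auto simp: smooth_def)
  have "((\<lambda>x. a * F n x + b * G n x) has_real_derivative a * F (Suc n) x + b * G (Suc n) x) (at x)" for n x
    by (intro DERIV_add DERIV_cmult F G)
  then show ?thesis
    unfolding smooth_def using F(1) G(1) by (intro exI[of _ "\<lambda>n x. a * F n x + b * G n x"]) auto
qed

text \<open>
  The combinatorial core of the Leibniz rule, which is Pascal's rule after a shift of the index.
\<close>

lemma Leibniz_sum:
  fixes f g :: "nat \<Rightarrow> real"
  shows "(\<Sum>i\<le>n. real (n choose i) * (f (Suc i) * g (n - i) + f i * g (Suc n - i)))
    = (\<Sum>i\<le>Suc n. real (Suc n choose i) * (f i * g (Suc n - i)))"
proof -
  have A: "(\<Sum>i\<le>Suc n. real (Suc n choose i) * (f i * g (Suc n - i)))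
    = f 0 * g (Suc n) + (\<Sum>i\<le>n. real (Suc n choose Suc i) * (f (Suc i) * g (n - i)))"
    by (subst sum.atMost_Suc_shift) simp
  have B: "(\<Sum>i\<le>Suc n. real (n choose i) * (f i * g (Suc n - i)))
    = f 0 * g (Suc n) + (\<Sum>i\<le>n. real (n choose Suc i) * (f (Suc i) * g (n - i)))"
    by (subst sum.atMost_Suc_shift) simp
  note A
  also have "(\<Sum>i\<le>n. real (Suc n choose Suc i) * (f (Suc i) * g (n - i)))
    = (\<Sum>i\<le>n. real (n choose i) * (f (Suc i) * g (n - i))) + (\<Sum>i\<le>n. real (n choose Suc i) * (f (Suc i) * g (n - i)))"
    by (simp add: sum.distrib[symmetric] algebra_simps)
  also have "f 0 * g (Suc n) + ((\<Sum>i\<le>n. real (n choose i) * (f (Suc i) * g (n - i))) + (\<Sum>i\<le>n. real (n choose Suc i) * (f (Suc i) * g (n - i))))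
    = (\<Sum>i\<le>n. real (n choose i) * (f (Suc i) * g (n - i))) + (\<Sum>i\<le>Suc n. real (n choose i) * (f i * g (Suc n - i)))"
    unfolding B by simp
  also have "(\<Sum>i\<le>Suc n. real (n choose i) * (f i * g (Suc n - i))) = (\<Sum>i\<le>n. real (n choose i) * (f i * g (Suc n - i)))"
    by simp
  finally show ?thesis
    by (simp add: sum.distrib algebra_simps)
qed

lemma smooth_mult:
  assumes "smooth f" "smooth g"
  shows "smooth (\<lambda>x. f x * g x)"
proof -
  obtain F where F: "F 0 = f" "\<And>n x. (F n has_real_derivative F (Suc n) x) (at x)"
    using assms by (auto simp: smooth_def)
  obtain G where G: "G 0 = g" "\<And>n x. (G n has_real_derivative G (Suc n) x) (at x)"
    using assms by (auto simp: smooth_def)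
  define L where "L n x = (\<Sum>i\<le>n. real (n choose i) * (F i x * G (n - i) x))" for n x
  have "(L n has_real_derivative L (Suc n) x) (at x)" for n x
  proof -
    have "((\<lambda>x. \<Sum>i\<le>n. real (n choose i) * (F i x * G (n - i) x)) has_real_derivative
      (\<Sum>i\<le>n. real (n choose i) * (F (Suc i) x * G (n - i) x + F i x * G (Suc n - i) x))) (at x)"
    proof (intro DERIV_sum DERIV_cmult)
      fix i assume "i \<in> {..n}"
      then have "Suc n - i = Suc (n - i)" by auto
      then show "((\<lambda>x. F i x * G (n - i) x) has_real_derivative F (Suc i) x * G (n - i) x + F i x * G (Suc n - i) x) (at x)"
        using DERIV_mult[OF F(2)[of i x] G(2)[of "n - i" x]] by (simp add: mult.commute)
    qed
    then show ?thesis
      unfolding L_def[abs_def] Leibniz_sum[of n "\<lambda>i. F i x" "\<lambda>i. G i x"] .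
  qed
  then show ?thesis
    unfolding smooth_def using F(1) G(1) by (intro exI[of _ L]) (auto simp: L_def[abs_def])
qed

lemma poly_times_exp_minus_tendsto_0: "((\<lambda>z::real. poly p z * exp (- z)) \<longlongrightarrow> 0) at_top"
proof -
  have "((\<lambda>z. \<Sum>i\<le>degree p. coeff p i * (z ^ i / exp z)) \<longlongrightarrow> 0) at_top"
    by (intro tendsto_null_sum tendsto_mult_right_zero tendsto_power_div_exp_0)
  then show ?thesis
    by (simp add: poly_altdef exp_minus sum_distrib_left divide_inverse mult_ac)
qed

text \<open>
  All derivatives have the form \<open>p (1 / x) * exp (- (1 / x))\<close> with a polynomial \<open>p\<close> for positive \<open>x\<close>:
  differentiation replaces \<open>p\<close> by \<open>X\<^sup>2 * (p - p')\<close>. At the origin exponential decay beats every polynomial.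
\<close>

lemma smooth_exp_minus_inverse: "smooth (\<lambda>x. if x > 0 then exp (- (1 / x)) else 0)"
proof -
  define p where "p n = rec_nat [:1::real:] (\<lambda>_ q. monom 1 2 * (q - pderiv q)) n" for n :: nat
  have p: "p 0 = [:1:]" "p (Suc n) = monom 1 2 * (p n - pderiv (p n))" for n
    by (simp_all add: p_def)
  define F where "F n x = (if x > 0 then poly (p n) (1 / x) * exp (- (1 / x)) else 0)" for n and x :: real
  have "(F n has_real_derivative F (Suc n) x) (at x)" for n x
  proof -
    consider "x > 0" | "x < 0" | "x = 0" by linarith
    then show ?thesis
    proof cases
      case 1
      have inv: "((\<lambda>x. 1 / x) has_real_derivative - (1 / x\<^sup>2)) (at x)"
        using 1 by (auto intro!: derivative_eq_intros simp: power2_eq_square)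
      have "((\<lambda>x. poly (p n) (1 / x) * exp (- (1 / x))) has_real_derivative F (Suc n) x) (at x)"
        by (rule DERIV_cong[OF DERIV_mult[OF DERIV_chain2[OF poly_DERIV inv]
              DERIV_chain2[OF DERIV_exp DERIV_minus[OF inv]]]])
          (use 1 in \<open>simp add: F_def p poly_monom power_one_over algebra_simps\<close>)
      then show ?thesis
        by (rule DERIV_cong_ev[THEN iffD1, rotated -1])
          (use 1 eventually_nhds_in_open[of "{0<..}" x] in \<open>auto simp: F_def elim!: eventually_mono\<close>)
    next
      case 2
      have "((\<lambda>x. 0) has_real_derivative F (Suc n) x) (at x)"
        using 2 by (simp add: F_def)
      then show ?thesis
        by (rule DERIV_cong_ev[THEN iffD1, rotated -1])
          (use 2 eventually_nhds_in_open[of "{..<0}" x] in \<open>auto simp: F_def elim!: eventually_mono\<close>)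
    next
      case 3
      have "((\<lambda>y. poly (pCons 0 (p n)) (1 / y) * exp (- (1 / y))) \<longlongrightarrow> 0) (at_right (0::real))"
        by (rule filterlim_compose[OF poly_times_exp_minus_tendsto_0])
          (use filterlim_inverse_at_top_right in \<open>simp add: inverse_eq_divide\<close>)
      then have "((\<lambda>y. (F n y - F n 0) / (y - 0)) \<longlongrightarrow> 0) (at_right 0)"
        by (rule Lim_transform_eventually)
          (use eventually_at_right_less[of 0] in \<open>auto simp: F_def elim!: eventually_mono\<close>)
      moreover have "((\<lambda>y. (F n y - F n 0) / (y - 0)) \<longlongrightarrow> 0) (at_left 0)"
        by (rule tendsto_eventually) (auto simp: F_def eventually_at_filter)
      ultimately show ?thesis
        unfolding has_field_derivative_iff 3 by (simp add: F_def filterlim_split_at)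
    qed
  qed
  moreover have "F 0 = (\<lambda>x. if x > 0 then exp (- (1 / x)) else 0)"
    by (auto simp: F_def p)
  ultimately show ?thesis
    unfolding smooth_def by blast
qed

text \<open>
  The normalised antiderivative of the bump \<open>h x * h (1 - x)\<close>, where \<open>h\<close> is the flat function above.
\<close>

lemma smooth_step:
  obtains H H' :: "real \<Rightarrow> real"
  where "smooth H" "\<And>x. (H has_real_derivative H' x) (at x)" "continuous_on UNIV H'"
    "\<And>x. 0 \<le> H' x" "\<And>x. x \<notin> {0..1} \<Longrightarrow> H' x = 0" "\<And>x. x \<le> 0 \<Longrightarrow> H x = 0" "\<And>x. 1 \<le> x \<Longrightarrow> H x = 1"
    "\<And>x. 0 \<le> H x" "\<And>x. H x \<le> 1"
proof -
  define h where "h x = (if x > 0 then exp (- (1 / x)) else 0)" for x :: real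
  define b where "b x = h x * h (- 1 * x + 1)" for x
  have b_smooth: "smooth b"
    unfolding b_def using smooth_exp_minus_inverse by (intro smooth_mult smooth_affine) (auto simp: h_def[abs_def])
  have b_cont: "continuous_on UNIV b"
    using smooth_imp_deriv_differentiable[OF b_smooth, of 0] by (simp add: differentiable_imp_continuous_on)
  have b_nonneg: "0 \<le> b x" for x by (auto simp: b_def h_def)
  have b_pos: "0 < b x" if "x \<in> {0<..<1}" for x using that by (auto simp: b_def h_def)
  have b_zero: "b x = 0" if "x \<notin> {0<..<1}" for x using that by (auto simp: b_def h_def)
  obtain B where B: "\<And>x. (B has_real_derivative b x) (at x)"
    using einterval_antiderivative[of "-\<infinity>" "\<infinity>" b] b_cont
    by (auto simp: continuous_on_eq_continuous_at has_real_derivative_iff_has_vector_derivative)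
  have mono: "B x \<le> B y" if "x \<le> y" for x y
    using DERIV_nonneg_imp_nondecreasing[OF that, of B] B b_nonneg by blast
  have zero: "(B has_real_derivative 0) (at z)" if "z \<notin> {0<..<1}" for z
    using B[of z] b_zero[OF that] by simp
  have left: "B x = B 0" if "x \<le> 0" for x
  proof (cases "x = 0")
    case False
    have "continuous_on {x..0} B"
      using B by (meson DERIV_isCont continuous_at_imp_continuous_on)
    then show ?thesis
      using DERIV_isconst_end[of x 0 B] that False zero by fastforce
  qed simp
  have right: "B x = B 1" if "1 \<le> x" for x
  proof (cases "x = 1")
    case False
    have "continuous_on {1..x} B"
      using B by (meson DERIV_isCont continuous_at_imp_continuous_on)
    then show ?thesis
      using DERIV_isconst_end[of 1 x B] that False zero by fastforce
  qed simp
  have "continuous_on {0..1} B"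
    using B by (meson DERIV_isCont continuous_at_imp_continuous_on)
  then have lt: "B 0 < B 1"
    using B b_pos by (intro DERIV_pos_imp_increasing_open[of 0 1 B]) auto
  (* normalises the total increase of B to 1 *)
  define c where "c = 1 / (B 1 - B 0)"
  have c: "c > 0" using lt by (simp add: c_def)
  define H where "H x = c * (B x - B 0)" for x
  show thesis
  proof (rule that[of H "\<lambda>x. c * b x"])
    show D: "(H has_real_derivative c * b x) (at x)" for x
      unfolding H_def by (auto intro!: derivative_eq_intros B)
    have "smooth (\<lambda>x. c * b x + 0 * b x)"
      by (intro smooth_lincomb b_smooth)
    then show "smooth H"
      by (intro smooth_antiderivative[OF D]) simp
    show "continuous_on UNIV (\<lambda>x. c * b x)"
      by (intro continuous_intros b_cont)
    show "0 \<le> c * b x" for x using c b_nonneg[of x] by simp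
    show "c * b x = 0" if "x \<notin> {0..1}" for x using that b_zero[of x] by auto
    show "H x = 0" if "x \<le> 0" for x using left[OF that] by (simp add: H_def)
    show one: "H x = 1" if "1 \<le> x" for x using right[OF that] lt by (simp add: H_def c_def)
    show "0 \<le> H x" for x
      using mono[of 0 x] left[of x] c by (cases "0 \<le> x") (auto simp: H_def)
    show "H x \<le> 1" for x
    proof -
      have "c * (B x - B 0) \<le> c * (B 1 - B 0)"
        using mono[of x 1] right[of x] c by (cases "x \<le> 1") auto
      then show ?thesis using lt by (simp add: H_def c_def)
    qed
  qed
qed

lemma continuous_integrable_unit:
  fixes f :: "real \<Rightarrow> real"
  shows "continuous_on {0..1} f \<Longrightarrow> integrable unit_measure f"
  by (rule L2_imp_integrable[OF continuous_in_L2])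

text \<open>
  The rescaled derivatives of a smooth step at \<open>x\<close> have mass 1 and concentrate in \<open>[x, x + 1 / k]\<close>.
\<close>

lemma approximate_identity:
  fixes H H' f :: "real \<Rightarrow> real"
  assumes H: "\<And>x. (H has_real_derivative H' x) (at x)" "continuous_on UNIV H'" "\<And>x. 0 \<le> H' x"
      "\<And>x. x \<notin> {0..1} \<Longrightarrow> H' x = 0" "\<And>x. x \<le> 0 \<Longrightarrow> H x = 0" "\<And>x. 1 \<le> x \<Longrightarrow> H x = 1"
    and f: "continuous_on {0..1} f" and x: "x \<in> {0<..<1}"
  shows "(\<lambda>k. LINT z|unit_measure. f z * (real k * H' (real k * (z - x)))) \<longlonglongrightarrow> f x"
proof (rule LIMSEQ_I)
  fix e :: real assume "0 < e"
  then obtain d where d: "d > 0" "\<And>z. z \<in> {0..1} \<Longrightarrow> \<bar>z - x\<bar> < d \<Longrightarrow> \<bar>f z - f x\<bar> < e / 2"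
    using f x unfolding continuous_on_iff dist_real_def
    by (metis atLeastAtMost_iff greaterThanLessThan_iff half_gt_zero less_imp_le)
  (* steps of width below m stay within d of x and inside the interval *)
  define m where "m = min d (1 - x)"
  have "m > 0" using d x by (auto simp: m_def)
  then obtain N :: nat where N: "1 / m < real N"
    using reals_Archimedean2 by blast
  show "\<exists>N. \<forall>k\<ge>N. norm ((LINT z|unit_measure. f z * (real k * H' (real k * (z - x)))) - f x) < e"
  proof (intro exI[of _ N] allI impI)
    fix k assume "k \<ge> N"
    then have "1 / m < real k" using N by simp
    then have k: "k > 0" "1 < real k * m"
      using \<open>m > 0\<close> by (auto simp: field_simps intro: gr0I)
    define D where "D z = real k * H' (real k * (z - x))" for z
    have D_cont: "continuous_on {0..1} D"
      unfolding D_def by (intro continuous_intros continuous_on_compose2[OF H(2)]) auto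
    have "((\<lambda>z. H (real k * (z - x))) has_real_derivative D z) (at z)" for z
    proof -
      have "((\<lambda>z. real k * (z - x)) has_real_derivative real k) (at z)"
        by (auto intro!: derivative_eq_intros)
      from DERIV_chain2[OF H(1) this] show ?thesis
        by (simp add: D_def mult.commute)
    qed
    then have "(D has_integral H (real k * (1 - x)) - H (real k * (0 - x))) {0..1}"
      by (intro fundamental_theorem_of_calculus)
        (auto simp: has_real_derivative_iff_has_vector_derivative[symmetric] intro: has_field_derivative_at_within)
    moreover have "1 \<le> real k * (1 - x)"
      using k(2) mult_left_mono[of m "1 - x" "real k"] by (simp add: m_def)
    moreover have "real k * (0 - x) \<le> 0"
      using x by (simp add: mult_nonneg_nonpos)
    ultimately have D_int: "(LINT z|unit_measure. D z) = 1"
      using integral_unit_measure[OF continuous_integrable_unit[OF D_cont]] H(5,6) by (simp add: integral_unique)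
    have i: "integrable unit_measure (\<lambda>z. f z * D z)" "integrable unit_measure (\<lambda>z. f x * D z)"
      "integrable unit_measure (\<lambda>z. (f z - f x) * D z)" "integrable unit_measure (\<lambda>z. e / 2 * D z)"
      by (intro continuous_integrable_unit continuous_intros f D_cont)+
    have bound: "\<bar>(f z - f x) * D z\<bar> \<le> e / 2 * D z" if "z \<in> {0<..<1}" for z
    proof (cases "real k * (z - x) \<in> {0..1}")
      case True
      then have "real k * (z - x) < real k * m"
        using k(2) by (meson atLeastAtMost_iff order_le_less_trans)
      then have "z - x < m" using k by simp
      moreover have "0 \<le> z - x"
        using True k by (simp add: zero_le_mult_iff)
      ultimately have "\<bar>f z - f x\<bar> \<le> e / 2"
        using d(2)[of z] that by (simp add: m_def)
      moreover have "0 \<le> D z" using H(3) by (simp add: D_def)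
      ultimately show ?thesis
        using mult_right_mono[of "\<bar>f z - f x\<bar>" "e / 2" "D z"] by (simp add: abs_mult)
    qed (use H(4) in \<open>simp add: D_def\<close>)
    have "(LINT z|unit_measure. f z * D z) - f x = (LINT z|unit_measure. f z * D z) - (LINT z|unit_measure. f x * D z)"
      by (simp add: D_int)
    also have "\<dots> = (LINT z|unit_measure. (f z - f x) * D z)"
      by (subst Bochner_Integration.integral_diff[OF i(1,2), symmetric]) (simp add: algebra_simps)
    finally have "\<bar>(LINT z|unit_measure. f z * D z) - f x\<bar> \<le> (LINT z|unit_measure. \<bar>(f z - f x) * D z\<bar>)"
      using integral_abs_bound[of unit_measure "\<lambda>z. (f z - f x) * D z"] by simp
    also have "\<dots> \<le> (LINT z|unit_measure. e / 2 * D z)"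
      by (rule integral_mono[OF integrable_abs[OF i(3)] i(4)]) (use bound in auto)
    also have "\<dots> = e / 2"
      by (simp add: D_int)
    finally show "norm ((LINT z|unit_measure. f z * (real k * H' (real k * (z - x)))) - f x) < e"
      using \<open>0 < e\<close> by (simp add: D_def)
  qed
qed

section \<open>Sobolev functions as primitives\<close>

text \<open>
  The working description of \<open>H1\<close>: \<open>f\<close> is absolutely continuous on the closed interval with
  derivative \<open>g\<close> in \<open>L2\<close>. That it amounts to membership in \<open>H1\<close> with weak derivative \<open>g\<close> is
  \<open>weak_deriv_imp_H1_primitive\<close> and \<open>H1_primitive_imp_weak_deriv\<close>.
\<close>

definition H1_primitive :: "(real \<Rightarrow> real) \<Rightarrow> (real \<Rightarrow> real) \<Rightarrow> bool"
  where "H1_primitive f g \<longleftrightarrow> g \<in> L2 \<and> (\<forall>x\<in>{0..1}. f x = f 0 + integral {0..x} g)"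

lemma H1_primitive_L2: "H1_primitive f g \<Longrightarrow> g \<in> L2"
  unfolding H1_primitive_def by blast

lemma H1_primitive_eq: "H1_primitive f g \<Longrightarrow> x \<in> {0..1} \<Longrightarrow> f x = f 0 + integral {0..x} g"
  unfolding H1_primitive_def by blast

text \<open>
  The lemma of du Bois-Reymond. The difference of two steepening smooth steps at \<open>x\<close> and \<open>y\<close> is a test
  function that tends to the indicator of \<open>(x, y]\<close>, while its derivative tends to the difference
  of the point masses at \<open>x\<close> and \<open>y\<close>.
\<close>

lemma weak_deriv_increment:
  assumes f: "continuous_on {0..1} f" and g: "g \<in> L2" and fg: "has_weak_deriv f g"
    and xy: "0 < x" "x < y" "y < 1"
  shows "f y - f x = integral {x..y} g"
proof -
  obtain H H' :: "real \<Rightarrow> real" where H: "smooth H" "\<And>x. (H has_real_derivative H' x) (at x)" "continuous_on UNIV H'"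
    "\<And>x. 0 \<le> H' x" "\<And>x. x \<notin> {0..1} \<Longrightarrow> H' x = 0" "\<And>x. x \<le> 0 \<Longrightarrow> H x = 0" "\<And>x. 1 \<le> x \<Longrightarrow> H x = 1"
    "\<And>x. 0 \<le> H x" "\<And>x. H x \<le> 1"
    by (rule smooth_step) blast
  define D where "D k c z = real k * H' (real k * (z - c))" for k c z
  define \<phi> where "\<phi> k z = H (real k * (z - x)) - H (real k * (z - y))" for k z
  have step_deriv: "((\<lambda>z. H (real k * (z - c))) has_real_derivative D k c z) (at z)" for k c z
  proof -
    have "((\<lambda>z. real k * (z - c)) has_real_derivative real k) (at z)"
      by (auto intro!: derivative_eq_intros)
    from DERIV_chain2[OF H(2) this] show ?thesis
      by (simp add: D_def mult.commute)
  qed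
  have \<phi>_deriv: "deriv (\<phi> k) z = D k x z - D k y z" for k z
    unfolding \<phi>_def by (intro DERIV_imp_deriv DERIV_diff step_deriv)
  have D_cont: "continuous_on {0..1} (D k c)" for k c
    unfolding D_def by (intro continuous_intros continuous_on_compose2[OF H(3)]) auto
  have \<phi>_cont: "continuous_on S (\<phi> k)" for S k
    unfolding \<phi>_def
    by (intro continuous_on_diff continuous_at_imp_continuous_on ballI DERIV_isCont[OF step_deriv])
  (* for k >= N the second step, of width 1 / k, is completed before the end point 1 *)
  obtain N :: nat where N: "1 / (1 - y) < real N"
    using reals_Archimedean2 by blast
  have test: "\<phi> k \<in> test_functions" if "k \<ge> N" for k
  proof -
    have "1 / (1 - y) < real k" using N that by simp
    then have k: "k > 0" "1 < real k * (1 - y)"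
      using xy by (auto simp: field_simps intro: gr0I)
    have "smooth (\<lambda>z. 1 * H (real k * z + - (real k * x)) + (-1) * H (real k * z + - (real k * y)))"
      by (intro smooth_lincomb smooth_affine H)
    then have sm: "smooth (\<phi> k)"
      by (simp add: \<phi>_def[abs_def] right_diff_distrib)
    have y1: "y + 1 / real k < 1"
      using k xy by (simp add: field_simps)
    have "\<phi> k z = 0" if "z \<notin> {x..y + 1 / real k}" for z
    proof (cases "z < x")
      case True
      then show ?thesis
        using xy H(6) by (simp add: \<phi>_def mult_nonneg_nonpos)
    next
      case False
      then have "1 / real k < z - y" using that by simp
      then have "1 \<le> real k * (z - y)"
        using k(1) by (simp add: field_simps)
      moreover have "real k * (z - y) \<le> real k * (z - x)"
        using xy by (intro mult_left_mono) auto
      ultimately show ?thesis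
        using H(7) by (simp add: \<phi>_def)
    qed
    then have "\<exists>K. compact K \<and> K \<subseteq> {0<..<1} \<and> (\<forall>z. z \<notin> K \<longrightarrow> \<phi> k z = 0)"
      using xy y1 by (intro exI[of _ "{x..y + 1 / real k}"]) auto
    then show ?thesis
      using smooth_imp_deriv_differentiable[OF sm] by (simp add: test_functions_def)
  qed
  have g_int: "integrable unit_measure g" by (rule L2_imp_integrable[OF g])
  have eq: "(LINT z|unit_measure. f z * D k x z) - (LINT z|unit_measure. f z * D k y z)
     = - (LINT z|unit_measure. g z * \<phi> k z)" if "k \<ge> N" for k
  proof -
    have i: "integrable unit_measure (\<lambda>z. f z * D k c z)" for c
      by (intro continuous_integrable_unit continuous_on_mult f D_cont)
    have "(LINT z|unit_measure. f z * deriv (\<phi> k) z) = - (LINT z|unit_measure. g z * \<phi> k z)"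
      using fg test[OF that] by (auto simp: has_weak_deriv_def)
    then show ?thesis
      using Bochner_Integration.integral_diff[OF i[of x] i[of y]] by (simp add: \<phi>_deriv algebra_simps)
  qed
  have "(\<lambda>k. (LINT z|unit_measure. f z * D k x z) - (LINT z|unit_measure. f z * D k y z)) \<longlonglongrightarrow> f x - f y"
    unfolding D_def by (intro tendsto_diff approximate_identity[OF H(2-7) f]) (use xy in auto)
  moreover have "(\<lambda>k. - (LINT z|unit_measure. g z * \<phi> k z)) \<longlonglongrightarrow> - (LINT z|unit_measure. g z * indicator {x<..y} z)"
  proof (intro tendsto_minus integral_dominated_convergence[where w = "\<lambda>z. \<bar>g z\<bar>"])
    have gm: "g \<in> borel_measurable unit_measure" using g_int by (rule borel_measurable_integrable)
    show "(\<lambda>z. g z * indicator {x<..y} z) \<in> borel_measurable unit_measure"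
      by (intro borel_measurable_times gm borel_measurable_unit) simp
    show "(\<lambda>z. g z * \<phi> k z) \<in> borel_measurable unit_measure" for k
      by (intro borel_measurable_times gm borel_measurable_unit borel_measurable_continuous_onI \<phi>_cont)
    have "\<bar>\<phi> k z\<bar> \<le> 1" for k z
      using H(8,9)[of "real k * (z - x)"] H(8,9)[of "real k * (z - y)"] unfolding \<phi>_def by linarith
    then have "\<bar>g z\<bar> * \<bar>\<phi> k z\<bar> \<le> \<bar>g z\<bar>" for k z
      by (simp add: mult_left_le)
    then show "AE z in unit_measure. norm (g z * \<phi> k z) \<le> \<bar>g z\<bar>" for k
      by (simp add: abs_mult)
    have step_lim: "(\<lambda>k. H (real k * (z - c))) \<longlonglongrightarrow> (if c < z then 1 else 0)" for z c
    proof (cases "c < z")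
      case True
      obtain M :: nat where M: "1 / (z - c) < real M"
        using reals_Archimedean2 by blast
      have "H (real k * (z - c)) = 1" if "k \<ge> M" for k
      proof -
        have "1 / (z - c) \<le> real k" using M that by linarith
        then show ?thesis using True by (intro H) (simp add: field_simps)
      qed
      then show ?thesis
        using True by (intro tendsto_eventually eventually_sequentiallyI[of M]) simp
    next
      case False
      then show ?thesis
        by (simp add: H(6) mult_nonneg_nonpos)
    qed
    have "(\<lambda>k. g z * \<phi> k z) \<longlonglongrightarrow> g z * indicator {x<..y} z" for z
      using tendsto_mult_left[OF tendsto_diff[OF step_lim[of z x] step_lim[of z y]], of "g z"] xy
      by (auto simp: \<phi>_def indicator_def split: if_splits)
    then show "AE z in unit_measure. (\<lambda>k. g z * \<phi> k z) \<longlonglongrightarrow> g z * indicator {x<..y} z"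
      by simp
  qed (use g_int in auto)
  then have "(\<lambda>k. (LINT z|unit_measure. f z * D k x z) - (LINT z|unit_measure. f z * D k y z)) \<longlonglongrightarrow>
    - (LINT z|unit_measure. g z * indicator {x<..y} z)"
    by (rule Lim_transform_eventually) (use eq in \<open>auto simp: eventually_sequentially intro!: exI[of _ N]\<close>)
  ultimately have "f x - f y = - (LINT z|unit_measure. g z * indicator {x<..y} z)"
    by (rule LIMSEQ_unique)
  also have "(LINT z|unit_measure. g z * indicator {x<..y} z) = integral {0..1} (\<lambda>z. g z * indicator {x<..y} z)"
    by (intro integral_unit_measure integrable_real_mult_indicator g_int)
      (use xy in \<open>auto simp: sets_restrict_space_iff\<close>)
  also have "\<dots> = integral {0..1} (\<lambda>z. if z \<in> {x..y} then g z else 0)"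
  proof (rule integral_spike[of "{x}"])
  qed (auto simp: indicator_def)
  also have "\<dots> = integral {x..y} g"
    using integral_restrict_Int[of "{0..1}" "{x..y}" g] xy by (simp add: Int_absorb1)
  finally show ?thesis by simp
qed

lemma L2_primitive_continuous:
  assumes "g \<in> L2"
  shows "continuous_on {0..1} (\<lambda>x. integral {0..x} g)"
  by (intro indefinite_integral_continuous_1 unit_integrable_imp_integrable_on L2_imp_integrable assms) auto

text \<open>
  The increments are known strictly inside the interval; continuity carries them to the end points.
\<close>

lemma weak_deriv_imp_H1_primitive:
  assumes f: "continuous_on {0..1} f" and g: "g \<in> L2" and fg: "has_weak_deriv f g"
  shows "H1_primitive f g"
proof -
  define k where "k x = f x - integral {0..x} g" for x
  have k_cont: "continuous_on (closure {0<..<1}) k"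
    unfolding k_def using L2_primitive_continuous[OF g] f by (auto intro: continuous_intros)
  have le: "k x = k y" if "0 < x" "x < y" "y < 1" for x y
  proof -
    have "integral {0..x} g + integral {x..y} g = integral {0..y} g"
      using that by (intro Henstock_Kurzweil_Integration.integral_combine unit_integrable_imp_integrable_on L2_imp_integrable g) auto
    then show ?thesis
      using weak_deriv_increment[OF f g fg that] by (simp add: k_def)
  qed
  have const: "k x = k (1 / 2)" if "x \<in> {0<..<1}" for x
  proof (cases x "1 / 2 :: real" rule: linorder_cases)
    case less
    show ?thesis by (rule le) (use less that in auto)
  next
    case greater
    show ?thesis by (rule le[symmetric]) (use greater that in auto)
  qed (simp only:)
  have const': "k x = k (1 / 2)" if "x \<in> {0..1}" for x
    using continuous_constant_on_closure[OF k_cont const, of x] that by simp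
  have "f x = f 0 + integral {0..x} g" if "x \<in> {0..1}" for x
    using const'[OF that] const'[of 0] by (simp add: k_def)
  then show ?thesis
    using g unfolding H1_primitive_def by blast
qed

lemma H1_primitive_continuous:
  assumes "H1_primitive f g"
  shows "continuous_on {0..1} f"
proof -
  have "continuous_on {0..1} (\<lambda>x. f 0 + integral {0..x} g)"
    by (intro continuous_on_add continuous_on_const L2_primitive_continuous H1_primitive_L2[OF assms])
  then show ?thesis
    by (rule continuous_on_eq) (rule H1_primitive_eq[OF assms, symmetric])
qed

lemma C1_imp_H1_primitive:
  assumes "\<And>x. x \<in> {0..1} \<Longrightarrow> (f has_real_derivative g x) (at x)" "continuous_on {0..1} g"
  shows "H1_primitive f g"
  unfolding H1_primitive_def
proof (intro conjI ballI)
  show "g \<in> L2" by (rule continuous_in_L2[OF assms(2)])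
  fix x :: real assume x: "x \<in> {0..1}"
  have "(g has_integral f x - f 0) {0..x}"
    using x assms(1) by (intro fundamental_theorem_of_calculus)
      (auto simp: has_real_derivative_iff_has_vector_derivative[symmetric] intro: has_field_derivative_at_within)
  then show "f x = f 0 + integral {0..x} g"
    by (simp add: integral_unique)
qed

lemma H1_primitive_imp_weak_deriv:
  assumes "H1_primitive f g"
  shows "has_weak_deriv f g"
  unfolding has_weak_deriv_def
proof
  fix \<phi> assume \<phi>: "\<phi> \<in> test_functions"
  have d: "((deriv ^^ n) \<phi>) differentiable_on UNIV" for n
    using \<phi> by (simp add: test_functions_def)
  have D: "(\<phi> has_real_derivative deriv \<phi> x) (at x)" for x
    using d[of 0] by (auto simp: differentiable_on_def DERIV_deriv_iff_real_differentiable)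
  have c: "continuous_on {0..1} (deriv \<phi>)"
    using differentiable_imp_continuous_on[OF d[of 1]] by (auto intro: continuous_on_subset)
  obtain K where "K \<subseteq> {0<..<1}" "\<And>x. x \<notin> K \<Longrightarrow> \<phi> x = 0"
    using \<phi> by (auto simp: test_functions_def)
  moreover from this(1) have "0 \<notin> K" "1 \<notin> K"
    by auto
  ultimately have ends: "\<phi> 0 = 0" "\<phi> 1 = 0"
    by blast+
  have "H1_primitive \<phi> (deriv \<phi>)"
    by (rule C1_imp_H1_primitive[OF D c])
  from integration_by_parts_primitives[OF L2_imp_integrable[OF H1_primitive_L2[OF assms]]
      continuous_integrable_unit[OF c] H1_primitive_eq[OF assms] H1_primitive_eq[OF this]]
  show "(LINT x|unit_measure. f x * deriv \<phi> x) = - (LINT x|unit_measure. g x * \<phi> x)"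
    using ends by (simp add: mult.commute)
qed

lemma H1_primitive_imp_H1: "H1_primitive f g \<Longrightarrow> f \<in> H1"
  unfolding H1_def
  using H1_primitive_continuous H1_primitive_imp_weak_deriv continuous_in_L2 H1_primitive_L2 by blast

lemma H1_imp_weak_deriv_primitive:
  assumes "f \<in> H1"
  shows "H1_primitive f (weak_deriv f)"
proof -
  have "weak_deriv f \<in> L2 \<and> has_weak_deriv f (weak_deriv f)"
    unfolding weak_deriv_def by (rule someI_ex[of "\<lambda>g. g \<in> L2 \<and> has_weak_deriv f g"]) (use assms in \<open>auto simp: H1_def\<close>)
  then show ?thesis
    using assms by (intro weak_deriv_imp_H1_primitive) (auto simp: H1_def)
qed

text \<open>
  Valid for both signs of \<open>h\<close>: parametrising the segment from \<open>y\<close> to \<open>y + h\<close> by \<open>r\<close> from 0 to 1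
  turns the oriented integral into an average, which avoids a case distinction in the applications.
\<close>

lemma average_eq_difference_quotient:
  fixes w :: "real \<Rightarrow> real"
  assumes w: "integrable lborel w" and h: "h \<noteq> 0"
  shows "(LINT r:{0..1}|lborel. w (y + h * r)) = ((LINT s:{..y + h}|lborel. w s) - (LINT s:{..y}|lborel. w s)) / h"
proof -
  have i: "integrable lborel (\<lambda>s. indicator A s * w s)" if "A \<in> sets borel" for A
    using integrable_mult_indicator[OF _ w, of A] that unfolding real_scaleR_def sets_lborel .
  have "(LINT s:{..y + h}|lborel. w s) - (LINT s:{..y}|lborel. w s)
    = (LINT s|lborel. indicator {..y + h} s * w s - indicator {..y} s * w s)"
    unfolding set_lebesgue_integral_def using Bochner_Integration.integral_diff[OF i[of "{..y + h}"] i[of "{..y}"]] by simp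
  also have "\<dots> = \<bar>h\<bar> * (LINT r|lborel. indicator {..y + h} (y + h * r) * w (y + h * r) - indicator {..y} (y + h * r) * w (y + h * r))"
    using lborel_integral_real_affine[OF h, of "\<lambda>s. indicator {..y + h} s * w s - indicator {..y} s * w s" y] by simp
  also have "(LINT r|lborel. indicator {..y + h} (y + h * r) * w (y + h * r) - indicator {..y} (y + h * r) * w (y + h * r))
    = (LINT r|lborel. sgn h * (indicator {0..1} r * w (y + h * r)))"
  proof (rule integral_cong_AE)
    have [measurable]: "w \<in> borel_measurable borel" using w by simp
    show "(\<lambda>r. indicator {..y + h} (y + h * r) * w (y + h * r) - indicator {..y} (y + h * r) * w (y + h * r)) \<in> borel_measurable lborel"
      by measurable
    show "(\<lambda>r. sgn h * (indicator {0..1} r * w (y + h * r))) \<in> borel_measurable lborel"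
      by measurable
    have "AE r in lborel. r \<noteq> (0::real)" "AE r in lborel. r \<noteq> (1::real)"
      by (rule AE_lborel_singleton)+
    then show "AE r in lborel. indicator {..y + h} (y + h * r) * w (y + h * r) - indicator {..y} (y + h * r) * w (y + h * r)
      = sgn h * (indicator {0..1} r * w (y + h * r))"
    proof eventually_elim
      case (elim r)
      have "y + h * r \<le> y + h \<longleftrightarrow> (if h > 0 then r \<le> 1 else r \<ge> 1)"
        using h mult_le_cancel_left[of h r 1] by auto
      moreover have "y + h * r \<le> y \<longleftrightarrow> (if h > 0 then r \<le> 0 else r \<ge> 0)"
        using h by (auto simp: mult_le_0_iff)
      ultimately show ?case
        using elim h by (auto simp: indicator_def sgn_if)
    qed
  qed
  also have "\<bar>h\<bar> * (LINT r|lborel. sgn h * (indicator {0..1} r * w (y + h * r))) = h * (LINT r:{0..1}|lborel. w (y + h * r))"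
    by (simp add: set_lebesgue_integral_def sgn_if)
  finally show ?thesis
    using h by (simp add: field_simps)
qed

lemma L2_borel_representative:
  assumes d: "d \<in> L2"
  obtains w where "w \<in> square_integrable lborel" "integrable lborel w" "\<And>x. x \<notin> {0<..<1} \<Longrightarrow> w x = 0"
    "AE x in unit_measure. w x = d x"
proof -
  obtain w where w: "integrable lborel w" "\<And>x. x \<notin> {0<..<1} \<Longrightarrow> w x = 0"
    "AE x in unit_measure. w x = d x"
    by (rule integrable_borel_representative[OF L2_imp_integrable[OF d]]) blast
  have wm: "w \<in> borel_measurable borel" using w(1) by simp
  have "integrable unit_measure (\<lambda>x. (w x)\<^sup>2)"
  proof (rule integrable_cong_AE_imp)
    show "integrable unit_measure (\<lambda>x. (d x)\<^sup>2)" using d unfolding L2_def by blast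
    show "(\<lambda>x. (w x)\<^sup>2) \<in> borel_measurable unit_measure"
      using wm by (intro borel_measurable_unit) simp
    show "AE x in unit_measure. (d x)\<^sup>2 = (w x)\<^sup>2"
      using w(3) by eventually_elim simp
  qed
  then have "integrable lborel (\<lambda>x. (w x)\<^sup>2)"
    using unit_measure_eq_lborel(1)[of "\<lambda>x. (w x)\<^sup>2"] wm w(2) by simp
  then have "w \<in> square_integrable lborel"
    using wm by (simp add: square_integrable_def)
  then show ?thesis
    using that w by blast
qed

text \<open>
  Outside the unit interval \<open>w\<close> vanishes, so its primitive on the line is constant on either side.
\<close>

lemma primitive_eq_lborel_clamped:
  assumes "d \<in> L2" "integrable lborel w" and w: "\<And>x. x \<notin> {0<..<1} \<Longrightarrow> w x = 0" and "AE x in unit_measure. w x = d x"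
  shows "(LINT s:{..x}|lborel. w s) = integral {0..max 0 (min 1 x)} d"
proof -
  have "(LINT s:{..x}|lborel. w s) = (LINT s:{..max 0 (min 1 x)}|lborel. w s)"
    unfolding set_lebesgue_integral_def
  proof (rule Bochner_Integration.integral_cong)
    show "indicator {..x} s *\<^sub>R w s = indicator {..max 0 (min 1 x)} s *\<^sub>R w s" for s
      using w[of s] by (cases "s \<in> {0<..<1}") (auto simp: indicator_def)
  qed simp
  also have "\<dots> = integral {0..max 0 (min 1 x)} d"
    by (rule primitive_eq_lborel[OF L2_imp_integrable[OF assms(1)] assms(2-4), symmetric]) auto
  finally show ?thesis .
qed

text \<open>
  If the primitive vanishes, then so do all its difference quotients, and these converge in the
  mean to \<open>w\<close> by \<open>translation_average_L2\<close>.
\<close>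

lemma zero_primitive_imp_AE_zero:
  fixes d :: "real \<Rightarrow> real"
  assumes d: "d \<in> L2" and zero: "\<And>x. x \<in> {0..1} \<Longrightarrow> integral {0..x} d = 0"
  shows "AE x in unit_measure. d x = 0"
proof -
  obtain w where sq: "w \<in> square_integrable lborel" and w: "integrable lborel w" "\<And>x. x \<notin> {0<..<1} \<Longrightarrow> w x = 0"
    "AE x in unit_measure. w x = d x"
    by (rule L2_borel_representative[OF d]) blast
  have wm: "w \<in> borel_measurable borel" using w(1) by simp
  have prim: "(LINT s:{..x}|lborel. w s) = 0" for x
    using primitive_eq_lborel_clamped[OF d w, of x] zero[of "max 0 (min 1 x)"] by simp
  have small: "(\<integral>\<^sup>+y. ennreal ((w y)\<^sup>2) \<partial>lborel) \<le> ennreal e" if pos: "e > 0" for e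
  proof -
    have supp: "w x = 0" if "1 < \<bar>x\<bar>" for x
      using that by (intro w(2)) auto
    obtain \<delta> where \<delta>: "\<delta> > 0" "\<And>h. \<bar>h\<bar> < \<delta> \<Longrightarrow>
      (\<integral>\<^sup>+y. ennreal ((LINT r:{0..1}|lborel. w (y + h * r) - w y)\<^sup>2) \<partial>lborel) \<le> ennreal e"
      by (rule translation_average_L2[OF sq, of 1 e]) (use supp pos in blast)+
    have h: "\<delta> / 2 \<noteq> 0" "\<bar>\<delta> / 2\<bar> < \<delta>" using \<delta>(1) by auto
    have "(LINT r:{0..1}|lborel. w (y + \<delta> / 2 * r) - w y) = - w y" for y
    proof -
      have i: "set_integrable lborel {0..1} (\<lambda>r. w (y + \<delta> / 2 * r))"
        unfolding set_integrable_def
        by (intro integrable_mult_indicator lborel_integrable_real_affine w h) simp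
      have "(LINT r:{0..1}|lborel. w (y + \<delta> / 2 * r) - w y)
        = (LINT r:{0..1}|lborel. w (y + \<delta> / 2 * r)) - (LINT r:{0..1::real}|lborel. w y)"
        by (rule set_integral_diff(2)[OF i]) (simp add: set_integrable_def)
      then show ?thesis
        unfolding average_eq_difference_quotient[OF w(1) h(1)] prim by (simp add: set_lebesgue_integral_def)
    qed
    then show ?thesis
      using \<delta>(2)[OF h(2)] by simp
  qed
  have "(\<integral>\<^sup>+y. ennreal ((w y)\<^sup>2) \<partial>lborel) = 0"
    using ennreal_le_epsilon[of 0 "\<integral>\<^sup>+y. ennreal ((w y)\<^sup>2) \<partial>lborel"] small by simp
  then have "AE y in lborel. w y = 0"
    using wm by (subst (asm) nn_integral_0_iff_AE) auto
  then have "AE y in unit_measure. w y = 0"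
    unfolding AE_unit_measure_iff by eventually_elim simp
  with w(3) show ?thesis
    by eventually_elim simp
qed

lemma H1_primitive_unique:
  assumes "H1_primitive f g" "H1_primitive f g'"
  shows "AE x in unit_measure. g x = g' x"
proof -
  have g: "g \<in> L2" "g' \<in> L2" using assms H1_primitive_L2 by blast+
  have "integral {0..x} (\<lambda>x. g x - g' x) = 0" if "x \<in> {0..1}" for x
  proof -
    have "g integrable_on {0..x}" "g' integrable_on {0..x}"
      using g that by (auto intro!: unit_integrable_imp_integrable_on L2_imp_integrable)
    then have "integral {0..x} (\<lambda>x. g x - g' x) = integral {0..x} g - integral {0..x} g'"
      by (rule Henstock_Kurzweil_Integration.integral_diff)
    also have "\<dots> = 0"
      using H1_primitive_eq[OF assms(1) that] H1_primitive_eq[OF assms(2) that] by linarith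
    finally show ?thesis .
  qed
  moreover have "(\<lambda>x. g x - g' x) \<in> L2"
    using g by (simp add: L2_eq_square_integrable square_integrable_diff)
  ultimately have "AE x in unit_measure. g x - g' x = 0"
    by (intro zero_primitive_imp_AE_zero) auto
  then show ?thesis by simp
qed

section \<open>Energy estimates and uniqueness\<close>

lemma tendsto_L2_norm_iff:
  "((\<lambda>s. L2_norm (f s)) \<longlongrightarrow> 0) F \<longleftrightarrow> ((\<lambda>s. sq_norm unit_measure (f s)) \<longlongrightarrow> 0) F"
proof
  assume "((\<lambda>s. L2_norm (f s)) \<longlongrightarrow> 0) F"
  then have "((\<lambda>s. (L2_norm (f s))\<^sup>2) \<longlongrightarrow> 0) F"
    by (rule tendsto_null_power) simp
  then show "((\<lambda>s. sq_norm unit_measure (f s)) \<longlongrightarrow> 0) F"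
    by (simp add: L2_norm_eq_sq_norm)
next
  assume "((\<lambda>s. sq_norm unit_measure (f s)) \<longlongrightarrow> 0) F"
  from tendsto_real_sqrt[OF this] show "((\<lambda>s. L2_norm (f s)) \<longlongrightarrow> 0) F"
    by (simp add: L2_norm_eq_sq_norm)
qed

lemma sq_norm_cong_AE:
  assumes "f \<in> square_integrable M" "g \<in> square_integrable M" "AE x in M. f x = g x"
  shows "sq_norm M f = sq_norm M g"
  unfolding sq_norm_def
proof (rule integral_cong_AE)
  show "AE x in M. (f x)\<^sup>2 = (g x)\<^sup>2"
    using assms(3) by eventually_elim simp
qed (use assms in \<open>auto simp: square_integrable_def\<close>)

lemma sq_norm_zero_imp_AE_zero:
  assumes "f \<in> square_integrable M" "sq_norm M f = 0"
  shows "AE x in M. f x = 0"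
proof -
  have "AE x in M. (f x)\<^sup>2 = 0"
    using assms integral_nonneg_eq_0_iff_AE[of M "\<lambda>x. (f x)\<^sup>2"] by (auto simp: square_integrable_def sq_norm_def)
  then show ?thesis by simp
qed

lemma L2_add: "f \<in> L2 \<Longrightarrow> g \<in> L2 \<Longrightarrow> (\<lambda>x. f x + g x) \<in> L2"
  unfolding L2_eq_square_integrable by (rule square_integrable_add)

lemma L2_diff: "f \<in> L2 \<Longrightarrow> g \<in> L2 \<Longrightarrow> (\<lambda>x. f x - g x) \<in> L2"
  unfolding L2_eq_square_integrable by (rule square_integrable_diff)

lemma L2_cmult: "f \<in> L2 \<Longrightarrow> (\<lambda>x. c * f x) \<in> L2"
  unfolding L2_eq_square_integrable by (rule square_integrable_cmult)

lemma difference_quotient_in_L2: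
  assumes "f \<in> L2" "g \<in> L2" "d \<in> L2"
  shows "(\<lambda>x. (f x - g x) / c - d x) \<in> L2"
  using L2_diff[OF L2_cmult[OF L2_diff[OF assms(1,2)], of "1 / c"] assms(3)] by simp

lemma halfline_limit_point:
  fixes t :: real
  assumes "0 \<le> t"
  shows "at t within {0..} \<noteq> bot"
proof
  assume "at t within {0..} = bot"
  moreover have "at_right t \<le> at t within {0..}"
    using assms by (intro at_le) auto
  ultimately show False
    using trivial_limit_at_right_real[of t] by (metis bot.extremum_uniqueI)
qed

text \<open>
  From here on all limits of \<open>L2_norm\<close> are replaced by limits of squared norms.
\<close>

lemma has_time_deriv_sq_norm:
  "has_time_deriv w d t \<longleftrightarrow> d \<in> L2 \<and>
    ((\<lambda>s. sq_norm unit_measure (\<lambda>x. (w s x - w t x) / (s - t) - d x)) \<longlongrightarrow> 0) (at t within {0..})"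
  unfolding has_time_deriv_def tendsto_L2_norm_iff ..

lemma has_time_deriv_diff:
  assumes w: "\<And>s. 0 \<le> s \<Longrightarrow> w s \<in> L2" "has_time_deriv w d t"
    and w': "\<And>s. 0 \<le> s \<Longrightarrow> w' s \<in> L2" "has_time_deriv w' d' t" and t: "0 \<le> t"
  shows "has_time_deriv (\<lambda>s x. w s x - w' s x) (\<lambda>x. d x - d' x) t"
proof -
  have d: "d \<in> L2" "d' \<in> L2"
    using assms by (auto simp: has_time_deriv_def)
  define q where "q s x = (w s x - w t x) / (s - t) - d x" for s x
  define q' where "q' s x = (w' s x - w' t x) / (s - t) - d' x" for s x
  have q: "q s \<in> L2" "q' s \<in> L2" if "0 \<le> s" for s
    unfolding q_def q'_def using that t d w(1) w'(1) by (auto intro!: difference_quotient_in_L2)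
  have ev: "\<forall>\<^sub>F s in at t within {0..}. 0 \<le> s"
    by (simp add: eventually_at_filter)
  have "((\<lambda>s. sq_norm unit_measure (\<lambda>x. q s x + (-1) * q' s x)) \<longlongrightarrow> 0) (at t within {0..})"
  proof (rule tendsto_sq_norm_add)
    show "\<forall>\<^sub>F s in at t within {0..}. q s \<in> square_integrable unit_measure"
      using ev by eventually_elim (use q L2_eq_square_integrable in blast)
    show "\<forall>\<^sub>F s in at t within {0..}. (\<lambda>x. (-1) * q' s x) \<in> square_integrable unit_measure"
      using ev by eventually_elim (use q L2_eq_square_integrable square_integrable_cmult in blast)
    show "((\<lambda>s. sq_norm unit_measure (q s)) \<longlongrightarrow> 0) (at t within {0..})"
      using w(2) by (simp add: has_time_deriv_sq_norm q_def[abs_def])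
    show "((\<lambda>s. sq_norm unit_measure (\<lambda>x. (-1) * q' s x)) \<longlongrightarrow> 0) (at t within {0..})"
      unfolding sq_norm_cmult using w'(2) by (simp add: has_time_deriv_sq_norm q'_def[abs_def])
  qed
  moreover have "(\<lambda>x. q s x + (-1) * q' s x) = (\<lambda>x. (w s x - w' s x - (w t x - w' t x)) / (s - t) - (d x - d' x))" for s
    by (simp add: q_def q'_def fun_eq_iff diff_divide_distrib)
  ultimately show ?thesis
    using L2_diff[OF d] by (simp add: has_time_deriv_sq_norm)
qed

lemma has_time_deriv_unique:
  assumes w: "\<And>s. 0 \<le> s \<Longrightarrow> w s \<in> L2" and d: "has_time_deriv w d t" "has_time_deriv w d' t" and t: "0 \<le> t"
  shows "AE x in unit_measure. d x = d' x"
proof -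
  have D: "has_time_deriv (\<lambda>s x. w s x - w s x) (\<lambda>x. d x - d' x) t"
    by (rule has_time_deriv_diff[OF w d(1) w d(2) t])
  then have dd: "(\<lambda>x. d x - d' x) \<in> square_integrable unit_measure"
    by (simp add: has_time_deriv_def L2_eq_square_integrable)
  have "((\<lambda>s. sq_norm unit_measure (\<lambda>x. - (d x - d' x))) \<longlongrightarrow> 0) (at t within {0..})"
    using D by (simp add: has_time_deriv_sq_norm)
  moreover have "sq_norm unit_measure (\<lambda>x. - (d x - d' x)) = sq_norm unit_measure (\<lambda>x. d x - d' x)"
    by (simp only: sq_norm_def power2_minus)
  ultimately have "sq_norm unit_measure (\<lambda>x. d x - d' x) = 0"
    using tendsto_unique[OF halfline_limit_point[OF t] tendsto_const] by simp
  from sq_norm_zero_imp_AE_zero[OF dd this] show ?thesis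
    by simp
qed

lemma C1_L2_time_deriv:
  assumes "C1_L2 w" "0 \<le> t"
  shows "has_time_deriv w (time_deriv w t) t"
  unfolding time_deriv_def using assms by (intro someI_ex[of "\<lambda>d. has_time_deriv w d t"]) (simp add: C1_L2_def)

text \<open>
  The chain rule for the squared norm along a differentiable curve. With \<open>q s\<close> denoting the error of
  the difference quotient, \<open>z s = z t + (s - t) * (d + q s)\<close>; expanding the square leaves \<open>2 * <z t, d>\<close>
  and terms that vanish in the limit by Cauchy-Schwarz.
\<close>

lemma energy_derivative:
  assumes z: "\<And>s. 0 \<le> s \<Longrightarrow> z s \<in> L2" and d: "has_time_deriv z d t" and t: "0 \<le> t"
  shows "((\<lambda>s. sq_norm unit_measure (z s)) has_real_derivative 2 * (LINT x|unit_measure. z t x * d x)) (at t within {0..})"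
proof -
  let ?M = unit_measure
  define q where "q s x = (z s x - z t x) / (s - t) - d x" for s x
  have sq: "d \<in> square_integrable ?M" "z t \<in> square_integrable ?M"
    using d z[OF t] by (auto simp: has_time_deriv_def L2_eq_square_integrable)
  have q: "q s \<in> square_integrable ?M" if "0 \<le> s" for s
    unfolding q_def L2_eq_square_integrable[symmetric] using that t d z
    by (auto intro!: difference_quotient_in_L2 simp: has_time_deriv_def)
  have ev: "\<forall>\<^sub>F s in at t within {0..}. 0 \<le> s"
    by (simp add: eventually_at_filter)
  have ev_q: "\<forall>\<^sub>F s in at t within {0..}. q s \<in> square_integrable ?M"
    using ev by eventually_elim (rule q)
  have q_lim: "((\<lambda>s. sq_norm ?M (q s)) \<longlongrightarrow> 0) (at t within {0..})"
    using d by (simp add: has_time_deriv_sq_norm q_def[abs_def])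
  define r where "r s = 2 * (LINT x|?M. z t x * d x) + 2 * (LINT x|?M. z t x * q s x)
     + (s - t) * (sq_norm ?M d + 2 * (LINT x|?M. d x * q s x) + sq_norm ?M (q s))" for s
  have "(r \<longlongrightarrow> 2 * (LINT x|?M. z t x * d x) + 2 * 0 + (t - t) * (sq_norm ?M d + 2 * 0 + 0)) (at t within {0..})"
    unfolding r_def by (intro tendsto_intros tendsto_inner_zero sq ev_q q_lim)
  then have "(r \<longlongrightarrow> 2 * (LINT x|?M. z t x * d x)) (at t within {0..})"
    by simp
  moreover have "\<forall>\<^sub>F s in at t within {0..}. r s = (sq_norm ?M (z s) - sq_norm ?M (z t)) / (s - t)"
  proof -
    have "\<forall>\<^sub>F s in at t within {0..}. 0 \<le> s \<and> s \<noteq> t"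
      by (simp add: eventually_at_filter)
    then show ?thesis
    proof eventually_elim
      case (elim s)
      have i: "integrable ?M (\<lambda>x. z t x * d x)" "integrable ?M (\<lambda>x. z t x * q s x)" "integrable ?M (\<lambda>x. d x * q s x)"
        by (intro square_integrable_mult_integrable sq q; use elim in simp)+
      have i2: "integrable ?M (\<lambda>x. (d x)\<^sup>2)" "integrable ?M (\<lambda>x. (q s x)\<^sup>2)" "integrable ?M (\<lambda>x. (z t x)\<^sup>2)"
        using sq q[of s] elim unfolding square_integrable_def by blast+
      have zs: "z s x = z t x + (s - t) * (d x + q s x)" for x
        using elim by (simp add: q_def)
      have "(z s x)\<^sup>2 = (z t x)\<^sup>2 + (s - t) * (2 * (z t x * d x) + 2 * (z t x * q s x)
        + (s - t) * ((d x)\<^sup>2 + 2 * (d x * q s x) + (q s x)\<^sup>2))" for x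
        unfolding zs[of x] by (simp add: power2_eq_square algebra_simps)
      then have "sq_norm ?M (z s) = (LINT x|?M. (z t x)\<^sup>2 + (s - t) * (2 * (z t x * d x) + 2 * (z t x * q s x)
        + (s - t) * ((d x)\<^sup>2 + 2 * (d x * q s x) + (q s x)\<^sup>2)))"
        by (simp add: sq_norm_def)
      also have "\<dots> = sq_norm ?M (z t) + (s - t) * r s"
        unfolding r_def sq_norm_def using i i2 by simp
      finally show ?case
        using elim by simp
    qed
  qed
  ultimately have "((\<lambda>s. (sq_norm ?M (z s) - sq_norm ?M (z t)) / (s - t)) \<longlongrightarrow> 2 * (LINT x|?M. z t x * d x)) (at t within {0..})"
    by (rule Lim_transform_eventually)
  then show ?thesis
    by (simp add: has_field_derivative_iff)
qed

lemma Gronwall_zero: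
  fixes E E' :: "real \<Rightarrow> real"
  assumes E: "\<And>t. 0 \<le> t \<Longrightarrow> (E has_real_derivative E' t) (at t within {0..})"
    and le: "\<And>t. 0 \<le> t \<Longrightarrow> E' t \<le> c * E t" and nonneg: "\<And>t. 0 \<le> E t" and "E 0 = 0" and "0 \<le> t"
  shows "E t = 0"
proof -
  (* the integrating factor makes F nonincreasing *)
  define F where "F s = exp (- c * s) * E s" for s
  have F: "(F has_real_derivative exp (- c * s) * (E' s - c * E s)) (at s within {0..})" if "0 \<le> s" for s
    unfolding F_def by (rule derivative_eq_intros E[OF that] refl | simp add: algebra_simps)+
  have "F t \<le> F 0"
  proof (rule DERIV_nonpos_imp_decreasing_open[OF \<open>0 \<le> t\<close>])
    fix s assume s: "0 < s" "s < t"
    then have "at s within {0..} = at s"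
      by (intro at_within_interior) simp
    then have "(F has_real_derivative exp (- c * s) * (E' s - c * E s)) (at s)"
      using F[of s] s by simp
    moreover have "exp (- c * s) * (E' s - c * E s) \<le> 0"
      using le[of s] s by (simp add: mult_nonneg_nonpos)
    ultimately show "\<exists>y. (F has_real_derivative y) (at s) \<and> y \<le> 0"
      by blast
  next
    have "continuous_on {0..} F"
      using F by (auto intro!: DERIV_continuous_on)
    then show "continuous_on {0..t} F"
      by (rule continuous_on_subset) auto
  qed
  then have "exp (- c * t) * E t \<le> 0"
    by (simp add: F_def \<open>E 0 = 0\<close>)
  then show ?thesis
    using nonneg[of t] by (simp add: mult_le_0_iff)
qed

lemma continuous_sq_norm_zero:
  assumes "continuous_on {0..1} f" "sq_norm unit_measure f = 0" "x \<in> {0..1}"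
  shows "f x = 0"
proof -
  have c: "continuous_on {0..1} (\<lambda>x. (f x)\<^sup>2)"
    using assms(1) by (intro continuous_intros)
  have "integral {0..1} (\<lambda>x. (f x)\<^sup>2) = 0"
    using integral_unit_measure[OF continuous_integrable_unit[OF c]] assms(2) by (simp add: sq_norm_def)
  then show ?thesis
    using integral_eq_0_iff[OF c] assms(3) by auto
qed

lemma H1_primitive_inner_self:
  assumes "H1_primitive f g"
  shows "2 * (LINT x|unit_measure. f x * g x) = (f 1)\<^sup>2 - (f 0)\<^sup>2"
  using integration_by_parts_primitives[OF L2_imp_integrable[OF H1_primitive_L2[OF assms]]
      L2_imp_integrable[OF H1_primitive_L2[OF assms]] H1_primitive_eq[OF assms] H1_primitive_eq[OF assms]]
  by (simp add: power2_eq_square)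

lemma H1_primitive_lincomb:
  assumes "H1_primitive f g" "H1_primitive f' g'"
  shows "H1_primitive (\<lambda>x. a * f x + b * f' x) (\<lambda>x. a * g x + b * g' x)"
  unfolding H1_primitive_def
proof (intro conjI ballI)
  note L2 = H1_primitive_L2[OF assms(1)] H1_primitive_L2[OF assms(2)]
  show "(\<lambda>x. a * g x + b * g' x) \<in> L2"
    by (intro L2_add L2_cmult L2)
  fix x :: real assume x: "x \<in> {0..1}"
  have i: "g integrable_on {0..x}" "g' integrable_on {0..x}"
    using x by (intro unit_integrable_imp_integrable_on L2_imp_integrable L2; simp)+
  have "integral {0..x} (\<lambda>x. a * g x + b * g' x) = integral {0..x} (\<lambda>x. a * g x) + integral {0..x} (\<lambda>x. b * g' x)"
    using i by (intro Henstock_Kurzweil_Integration.integral_add integrable_on_mult_right)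
  also have "\<dots> = a * integral {0..x} g + b * integral {0..x} g'"
    by simp
  finally show "a * f x + b * f' x = a * f 0 + b * f' 0 + integral {0..x} (\<lambda>x. a * g x + b * g' x)"
    unfolding H1_primitive_eq[OF assms(1) x] H1_primitive_eq[OF assms(2) x] by (simp add: algebra_simps)
qed

lemma H1_primitive_diff:
  assumes "H1_primitive f g" "H1_primitive f' g'"
  shows "H1_primitive (\<lambda>x. f x - f' x) (\<lambda>x. g x - g' x)"
  using H1_primitive_lincomb[OF assms, of 1 "-1"] by simp

lemma C0_H1_in_H1: "C0_H1 u \<Longrightarrow> 0 \<le> t \<Longrightarrow> u t \<in> H1"
  by (simp add: C0_H1_def)

lemma H1_imp_L2: "f \<in> H1 \<Longrightarrow> f \<in> L2"
  by (simp add: H1_def)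

lemma H1_imp_continuous: "f \<in> H1 \<Longrightarrow> continuous_on {0..1} f"
  by (simp add: H1_def)

lemma integral_mult_cong_AE:
  assumes "f \<in> L2" "g \<in> L2" "h \<in> L2" "AE x in unit_measure. g x = h x"
  shows "(LINT x|unit_measure. f x * g x) = (LINT x|unit_measure. f x * h x)"
proof (rule integral_cong_AE)
  show "AE x in unit_measure. f x * g x = f x * h x"
    using assms(4) by eventually_elim simp
  show "(\<lambda>x. f x * g x) \<in> borel_measurable unit_measure" "(\<lambda>x. f x * h x) \<in> borel_measurable unit_measure"
    using assms unfolding L2_eq_square_integrable by (auto intro: borel_measurable_times square_integrable_measurable)
qed

text \<open>
  The energy method. The difference \<open>z\<close> of two solutions solves the homogeneous transport equation,
  so the derivative of its squared norm is \<open>- lam * ((z t 1)\<^sup>2 - (z t 0)\<^sup>2)\<close>. The boundary condition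
  removes the second square, the only one with the wrong sign.
\<close>

lemma transport_unique:
  assumes lam: "lam > 0"
    and u: "C0_H1 u" "C1_L2 u" "\<And>t. 0 \<le> t \<Longrightarrow> AE x in unit_measure. time_deriv u t x = - lam * weak_deriv (u t) x"
    and u': "C0_H1 u'" "C1_L2 u'" "\<And>t. 0 \<le> t \<Longrightarrow> AE x in unit_measure. time_deriv u' t x = - lam * weak_deriv (u' t) x"
    and boundary: "\<And>t. 0 \<le> t \<Longrightarrow> u' t 0 = u t 0"
    and initial: "\<And>x. x \<in> {0..1} \<Longrightarrow> u' 0 x = u 0 x"
    and t: "0 \<le> t" and x: "x \<in> {0..1}"
  shows "u' t x = u t x"
proof -
  define z where "z s x = u' s x - u s x" for s x
  define d where "d s x = time_deriv u' s x - time_deriv u s x" for s x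
  define g where "g s x = weak_deriv (u' s) x - weak_deriv (u s) x" for s x
  have L2: "u s \<in> L2" "u' s \<in> L2" if "0 \<le> s" for s
    using C0_H1_in_H1[OF u(1) that] C0_H1_in_H1[OF u'(1) that] H1_imp_L2 by blast+
  have z_L2: "z s \<in> L2" if "0 \<le> s" for s
    unfolding z_def using that by (intro L2_diff L2)
  have d: "has_time_deriv z (d s) s" if "0 \<le> s" for s
    unfolding z_def d_def
    by (rule has_time_deriv_diff[OF L2(2) C1_L2_time_deriv[OF u'(2) that] L2(1) C1_L2_time_deriv[OF u(2) that] that])
  have g: "H1_primitive (z s) (g s)" if "0 \<le> s" for s
    unfolding z_def g_def
    by (intro H1_primitive_diff H1_imp_weak_deriv_primitive C0_H1_in_H1[OF u(1) that] C0_H1_in_H1[OF u'(1) that])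
  have energy: "2 * (LINT x|unit_measure. z s x * d s x) \<le> 0 * sq_norm unit_measure (z s)" if s: "0 \<le> s" for s
  proof -
    have "AE x in unit_measure. d s x = - lam * g s x"
      using u(3)[OF s] u'(3)[OF s] by eventually_elim (simp add: d_def g_def algebra_simps)
    moreover have "d s \<in> L2" using d[OF s] by (simp add: has_time_deriv_def)
    ultimately have "(LINT x|unit_measure. z s x * d s x) = (LINT x|unit_measure. z s x * (- lam * g s x))"
      by (intro integral_mult_cong_AE z_L2 s L2_cmult H1_primitive_L2[OF g[OF s]])
    also have "\<dots> = (LINT x|unit_measure. - lam * (z s x * g s x))"
      by (simp add: mult_ac)
    also have "\<dots> = - lam * (LINT x|unit_measure. z s x * g s x)"
      by (rule integral_mult_right_zero)
    finally have "2 * (LINT x|unit_measure. z s x * d s x) = - lam * (2 * (LINT x|unit_measure. z s x * g s x))"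
      by simp
    also have "\<dots> = - lam * (z s 1)\<^sup>2"
      unfolding H1_primitive_inner_self[OF g[OF s]] using boundary[OF s] by (simp add: z_def)
    also have "\<dots> \<le> 0"
      using lam by simp
    finally show ?thesis by simp
  qed
  have z0: "sq_norm unit_measure (z 0) = 0"
    using sq_norm_unit_bounded[of "z 0" 0] sq_norm_nonneg[of unit_measure "z 0"] initial by (simp add: z_def order_antisym)
  have "sq_norm unit_measure (z t) = 0"
  proof (rule Gronwall_zero[where E = "\<lambda>s. sq_norm unit_measure (z s)"])
    show "((\<lambda>s. sq_norm unit_measure (z s)) has_real_derivative 2 * (LINT x|unit_measure. z s x * d s x)) (at s within {0..})"
      if "0 \<le> s" for s
      by (rule energy_derivative[OF z_L2 d[OF that] that])
      show "2 * (LINT x|unit_measure. z s x * d s x) \<le> 0 * sq_norm unit_measure (z s)" if "0 \<le> s" for s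
      by (rule energy[OF that])
  qed (use z0 t in auto)
  then have "z t x = 0"
    by (rule continuous_sq_norm_zero[OF H1_primitive_continuous[OF g[OF t]] _ x])
  then show ?thesis by (simp add: z_def)
qed

text \<open>
  The same method for the second equation: once the sources agree, the difference satisfies
  \<open>z' = psi * z\<close> and its squared norm grows at most like \<open>exp (2 * psi * t)\<close>.
\<close>

lemma linear_ode_unique:
  assumes v: "C0_H1 v" "C1_L2 v" "\<And>t. 0 \<le> t \<Longrightarrow> AE x in unit_measure. time_deriv v t x = psi * v t x + om * u t x"
    and v': "C0_H1 v'" "C1_L2 v'" "\<And>t. 0 \<le> t \<Longrightarrow> AE x in unit_measure. time_deriv v' t x = psi * v' t x + om * u' t x"
    and source: "\<And>t x. 0 \<le> t \<Longrightarrow> x \<in> {0..1} \<Longrightarrow> u' t x = u t x"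
    and initial: "\<And>x. x \<in> {0..1} \<Longrightarrow> v' 0 x = v 0 x"
    and t: "0 \<le> t" and x: "x \<in> {0..1}"
  shows "v' t x = v t x"
proof -
  define z where "z s x = v' s x - v s x" for s x
  define d where "d s x = time_deriv v' s x - time_deriv v s x" for s x
  have H1: "v s \<in> H1" "v' s \<in> H1" if "0 \<le> s" for s
    using C0_H1_in_H1[OF v(1) that] C0_H1_in_H1[OF v'(1) that] .
  have L2: "v s \<in> L2" "v' s \<in> L2" if "0 \<le> s" for s
    using H1[OF that] H1_imp_L2 by blast+
  have z_L2: "z s \<in> L2" if "0 \<le> s" for s
    unfolding z_def using that by (intro L2_diff L2)
  have d: "has_time_deriv z (d s) s" if "0 \<le> s" for s
    unfolding z_def d_def
    by (rule has_time_deriv_diff[OF L2(2) C1_L2_time_deriv[OF v'(2) that] L2(1) C1_L2_time_deriv[OF v(2) that] that])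
  have energy: "2 * (LINT x|unit_measure. z s x * d s x) \<le> (2 * psi) * sq_norm unit_measure (z s)" if s: "0 \<le> s" for s
  proof -
    have "AE x in unit_measure. d s x = psi * z s x"
      using v(3)[OF s] v'(3)[OF s] AE_space[of unit_measure]
      by eventually_elim (use source[OF s] in \<open>simp add: d_def z_def algebra_simps\<close>)
    moreover have "d s \<in> L2" using d[OF s] by (simp add: has_time_deriv_def)
    ultimately have "(LINT x|unit_measure. z s x * d s x) = (LINT x|unit_measure. z s x * (psi * z s x))"
      by (intro integral_mult_cong_AE z_L2 s L2_cmult)
    also have "\<dots> = (LINT x|unit_measure. psi * (z s x)\<^sup>2)"
      by (simp add: power2_eq_square mult_ac)
    also have "\<dots> = psi * sq_norm unit_measure (z s)"
      unfolding sq_norm_def by (rule integral_mult_right_zero)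
    finally show ?thesis by simp
  qed
  have z0: "sq_norm unit_measure (z 0) = 0"
    using sq_norm_unit_bounded[of "z 0" 0] sq_norm_nonneg[of unit_measure "z 0"] initial by (simp add: z_def order_antisym)
  have "sq_norm unit_measure (z t) = 0"
  proof (rule Gronwall_zero[where E = "\<lambda>s. sq_norm unit_measure (z s)"])
    show "((\<lambda>s. sq_norm unit_measure (z s)) has_real_derivative 2 * (LINT x|unit_measure. z s x * d s x)) (at s within {0..})"
      if "0 \<le> s" for s
      by (rule energy_derivative[OF z_L2 d[OF that] that])
      show "2 * (LINT x|unit_measure. z s x * d s x) \<le> (2 * psi) * sq_norm unit_measure (z s)" if "0 \<le> s" for s
      by (rule energy[OF that])
  qed (use z0 t in auto)
  moreover have "continuous_on {0..1} (z t)"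
    unfolding z_def using H1[OF t] by (intro continuous_on_diff H1_imp_continuous)
  ultimately have "z t x = 0"
    using continuous_sq_norm_zero[of "z t" x] x by blast
  then show ?thesis by (simp add: z_def)
qed

section \<open>Curves of square-integrable and Sobolev functions\<close>

lemma C0_L2_sq_norm:
  "C0_L2 w \<longleftrightarrow> (\<forall>t\<ge>0. w t \<in> L2) \<and>
    (\<forall>t\<ge>0. ((\<lambda>s. sq_norm unit_measure (\<lambda>x. w s x - w t x)) \<longlongrightarrow> 0) (at t within {0..}))"
  unfolding C0_L2_def tendsto_L2_norm_iff ..

lemma sq_norm_tendsto_zeroI:
  assumes "\<And>e. 0 < e \<Longrightarrow> \<forall>\<^sub>F s in F. sq_norm M (f s) \<le> e"
  shows "((\<lambda>s. sq_norm M (f s)) \<longlongrightarrow> 0) F"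
proof (rule order_tendstoI)
  fix e :: real assume "0 < e"
  then have "\<forall>\<^sub>F s in F. sq_norm M (f s) \<le> e / 2"
    by (intro assms) simp
  then show "\<forall>\<^sub>F s in F. sq_norm M (f s) < e"
    by eventually_elim (use \<open>0 < e\<close> in simp)
qed (auto intro!: always_eventually intro: order_less_le_trans[OF _ sq_norm_nonneg])

lemma C0_L2_add:
  assumes "C0_L2 f" "C0_L2 g"
  shows "C0_L2 (\<lambda>t x. f t x + g t x)"
  unfolding C0_L2_sq_norm
proof (intro conjI allI impI)
  have L2: "f t \<in> L2" "g t \<in> L2" if "0 \<le> t" for t
    using assms that by (auto simp: C0_L2_def)
  fix t :: real assume t: "0 \<le> t"
  show "(\<lambda>x. f t x + g t x) \<in> L2"
    by (intro L2_add L2 t)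
  have ev: "\<forall>\<^sub>F s in at t within {0..}. 0 \<le> s"
    by (simp add: eventually_at_filter)
  have "((\<lambda>s. sq_norm unit_measure (\<lambda>x. (f s x - f t x) + (g s x - g t x))) \<longlongrightarrow> 0) (at t within {0..})"
  proof (rule tendsto_sq_norm_add)
    show "\<forall>\<^sub>F s in at t within {0..}. (\<lambda>x. f s x - f t x) \<in> square_integrable unit_measure"
      using ev by eventually_elim (use L2 t L2_diff L2_eq_square_integrable in blast)
    show "\<forall>\<^sub>F s in at t within {0..}. (\<lambda>x. g s x - g t x) \<in> square_integrable unit_measure"
      using ev by eventually_elim (use L2 t L2_diff L2_eq_square_integrable in blast)
  qed (use assms t in \<open>auto simp: C0_L2_sq_norm\<close>)
  then show "((\<lambda>s. sq_norm unit_measure (\<lambda>x. f s x + g s x - (f t x + g t x))) \<longlongrightarrow> 0) (at t within {0..})"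
    by (simp add: algebra_simps)
qed

lemma C0_L2_cmult:
  assumes "C0_L2 f"
  shows "C0_L2 (\<lambda>t x. c * f t x)"
  unfolding C0_L2_sq_norm
proof (intro conjI allI impI)
  fix t :: real assume t: "0 \<le> t"
  show "(\<lambda>x. c * f t x) \<in> L2"
    using assms t by (intro L2_cmult) (simp add: C0_L2_def)
  have "((\<lambda>s. sq_norm unit_measure (\<lambda>x. f s x - f t x)) \<longlongrightarrow> 0) (at t within {0..})"
    using assms t by (simp add: C0_L2_sq_norm)
  from tendsto_mult_right_zero[OF this, of "c\<^sup>2"]
  show "((\<lambda>s. sq_norm unit_measure (\<lambda>x. c * f s x - c * f t x)) \<longlongrightarrow> 0) (at t within {0..})"
    unfolding right_diff_distrib[symmetric] sq_norm_cmult .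
qed

lemma C0_L2_scale:
  assumes c: "continuous_on {0..} c" and f: "f \<in> L2"
  shows "C0_L2 (\<lambda>t x. c t * f x)"
  unfolding C0_L2_sq_norm
proof (intro conjI allI impI)
  fix t :: real assume t: "0 \<le> t"
  show "(\<lambda>x. c t * f x) \<in> L2"
    by (rule L2_cmult[OF f])
  have "(c \<longlongrightarrow> c t) (at t within {0..})"
    using c t by (auto simp: continuous_on_def)
  then have "((\<lambda>s. (c s - c t)\<^sup>2 * sq_norm unit_measure f) \<longlongrightarrow> (c t - c t)\<^sup>2 * sq_norm unit_measure f) (at t within {0..})"
    by (intro tendsto_intros)
  moreover have "sq_norm unit_measure (\<lambda>x. c s * f x - c t * f x) = (c s - c t)\<^sup>2 * sq_norm unit_measure f" for s
    using sq_norm_cmult[of unit_measure "c s - c t" f] by (simp add: algebra_simps)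
  ultimately show "((\<lambda>s. sq_norm unit_measure (\<lambda>x. c s * f x - c t * f x)) \<longlongrightarrow> 0) (at t within {0..})"
    by simp
qed

text \<open>
  The norm of \<open>H1\<close> refers to a chosen representative of the weak derivative of each difference;
  almost everywhere uniqueness allows computing it with the known derivatives.
\<close>

lemma C0_H1I:
  assumes prim: "\<And>t. 0 \<le> t \<Longrightarrow> H1_primitive (f t) (g t)" and f: "C0_L2 f" and g: "C0_L2 g"
  shows "C0_H1 f"
  unfolding C0_H1_def
proof (intro conjI allI impI)
  fix t :: real assume t: "0 \<le> t"
  show "f t \<in> H1"
    by (rule H1_primitive_imp_H1[OF prim[OF t]])
  have norm: "H1_norm (\<lambda>x. f s x - f t x) =
      sqrt (sq_norm unit_measure (\<lambda>x. f s x - f t x) + sq_norm unit_measure (\<lambda>x. g s x - g t x))" if s: "0 \<le> s" for s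
  proof -
    have d: "H1_primitive (\<lambda>x. f s x - f t x) (\<lambda>x. g s x - g t x)"
      by (rule H1_primitive_diff[OF prim[OF s] prim[OF t]])
    have wd: "H1_primitive (\<lambda>x. f s x - f t x) (weak_deriv (\<lambda>x. f s x - f t x))"
      by (rule H1_imp_weak_deriv_primitive[OF H1_primitive_imp_H1[OF d]])
    have "sq_norm unit_measure (weak_deriv (\<lambda>x. f s x - f t x)) = sq_norm unit_measure (\<lambda>x. g s x - g t x)"
      by (rule sq_norm_cong_AE[OF _ _ H1_primitive_unique[OF wd d]])
        (use H1_primitive_L2[OF wd] H1_primitive_L2[OF d] L2_eq_square_integrable in auto)
    then show ?thesis
      by (simp add: H1_norm_def L2_norm_eq_sq_norm)
  qed
  have "((\<lambda>s. sqrt (sq_norm unit_measure (\<lambda>x. f s x - f t x) + sq_norm unit_measure (\<lambda>x. g s x - g t x)))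
    \<longlongrightarrow> sqrt (0 + 0)) (at t within {0..})"
    using f g t by (intro tendsto_real_sqrt tendsto_add) (auto simp: C0_L2_sq_norm)
  moreover have "\<forall>\<^sub>F s in at t within {0..}. sqrt (sq_norm unit_measure (\<lambda>x. f s x - f t x) + sq_norm unit_measure (\<lambda>x. g s x - g t x))
      = H1_norm (\<lambda>x. f s x - f t x)"
  proof -
    have "\<forall>\<^sub>F s in at t within {0..}. 0 \<le> s"
      by (simp add: eventually_at_filter)
    then show ?thesis
      by eventually_elim (rule norm[symmetric])
  qed
  ultimately show "((\<lambda>s. H1_norm (\<lambda>x. f s x - f t x)) \<longlongrightarrow> 0) (at t within {0..})"
    using Lim_transform_eventually by fastforce
qed

text \<open>
  The same transfer for the chosen time derivative.
\<close>

lemma C1_L2I: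
  assumes w: "\<And>t. 0 \<le> t \<Longrightarrow> w t \<in> L2" and d: "\<And>t. 0 \<le> t \<Longrightarrow> has_time_deriv w (d t) t" and c: "C0_L2 d"
  shows "C1_L2 w" and "\<And>t. 0 \<le> t \<Longrightarrow> AE x in unit_measure. time_deriv w t x = d t x"
proof -
  have td: "has_time_deriv w (time_deriv w t) t" if "0 \<le> t" for t
    unfolding time_deriv_def using d[OF that] by (rule someI[of "\<lambda>d. has_time_deriv w d t"])
  show AE: "AE x in unit_measure. time_deriv w t x = d t x" if "0 \<le> t" for t
    by (rule has_time_deriv_unique[OF w td[OF that] d[OF that] that])
  have L2: "time_deriv w t \<in> L2" "d t \<in> L2" if "0 \<le> t" for t
    using td[OF that] d[OF that] by (auto simp: has_time_deriv_def)
  have "C0_L2 (time_deriv w)"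
    unfolding C0_L2_sq_norm
  proof (intro conjI allI impI)
    fix t :: real assume t: "0 \<le> t"
    show "time_deriv w t \<in> L2" by (rule L2(1)[OF t])
    have lim: "((\<lambda>s. sq_norm unit_measure (\<lambda>x. d s x - d t x)) \<longlongrightarrow> 0) (at t within {0..})"
      using c t by (simp add: C0_L2_sq_norm)
    have "\<forall>\<^sub>F s in at t within {0..}. 0 \<le> s"
      by (simp add: eventually_at_filter)
    then have "\<forall>\<^sub>F s in at t within {0..}. sq_norm unit_measure (\<lambda>x. d s x - d t x)
      = sq_norm unit_measure (\<lambda>x. time_deriv w s x - time_deriv w t x)"
    proof eventually_elim
      case (elim s)
      have "AE x in unit_measure. d s x - d t x = time_deriv w s x - time_deriv w t x"
        using AE[OF elim] AE[OF t] by eventually_elim simp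
      then show ?case
        by (intro sq_norm_cong_AE) (use L2_diff L2[OF elim] L2[OF t] L2_eq_square_integrable in auto)
    qed
    from Lim_transform_eventually[OF lim this]
    show "((\<lambda>s. sq_norm unit_measure (\<lambda>x. time_deriv w s x - time_deriv w t x)) \<longlongrightarrow> 0) (at t within {0..})" .
  qed
  then show "C1_L2 w"
    using w d by (auto simp: C1_L2_def)
qed

lemma joint_continuous_slice:
  assumes "continuous_on ({0..} \<times> {0..1}) (\<lambda>z. f (fst z) (snd z))" "0 \<le> t"
  shows "continuous_on {0..1} (f t)"
proof -
  have "continuous_on {0..1} (\<lambda>x. f (fst (t, x)) (snd (t, x)))"
    by (rule continuous_on_compose2[OF assms(1), of "{0..1}" "\<lambda>x. (t, x)"]) (use assms(2) in \<open>auto intro!: continuous_intros\<close>)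
  then show ?thesis by simp
qed

text \<open>
  Uniform continuity on the compact set \<open>[0, t + 1] \<times> [0, 1]\<close>.
\<close>

lemma joint_continuous_uniform:
  fixes f :: "real \<Rightarrow> real \<Rightarrow> real"
  assumes f: "continuous_on ({0..} \<times> {0..1}) (\<lambda>z. f (fst z) (snd z))" and t: "0 \<le> t" and e: "0 < e"
  obtains d where "0 < d" "\<And>s x. 0 \<le> s \<Longrightarrow> \<bar>s - t\<bar> < d \<Longrightarrow> x \<in> {0..1} \<Longrightarrow> \<bar>f s x - f t x\<bar> < e"
proof -
  have "uniformly_continuous_on ({0..t + 1} \<times> {0..1}) (\<lambda>z. f (fst z) (snd z))"
    by (intro compact_uniformly_continuous continuous_on_subset[OF f] compact_Times) auto
  then obtain d where d: "0 < d" "\<And>z z'. z \<in> {0..t + 1} \<times> {0..1} \<Longrightarrow> z' \<in> {0..t + 1} \<times> {0..1} \<Longrightarrow>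
      dist z' z < d \<Longrightarrow> dist (f (fst z') (snd z')) (f (fst z) (snd z)) < e"
    using e unfolding uniformly_continuous_on_def by metis
  show ?thesis
  proof (rule that[of "min d 1"])
    fix s x :: real assume s: "0 \<le> s" "\<bar>s - t\<bar> < min d 1" "x \<in> {0..1}"
    then have "dist (s, x) (t, x) < d"
      by (simp add: dist_Pair_Pair dist_real_def)
    then show "\<bar>f s x - f t x\<bar> < e"
      using d(2)[of "(t, x)" "(s, x)"] s t by (auto simp: dist_real_def)
  qed (use d in simp)
qed

lemma joint_continuous_C0_L2:
  assumes f: "continuous_on ({0..} \<times> {0..1}) (\<lambda>z. f (fst z) (snd z))"
  shows "C0_L2 f"
  unfolding C0_L2_sq_norm
proof (intro conjI allI impI)
  fix t :: real assume t: "0 \<le> t"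
  show "f t \<in> L2"
    by (rule continuous_in_L2[OF joint_continuous_slice[OF f t]])
  show "((\<lambda>s. sq_norm unit_measure (\<lambda>x. f s x - f t x)) \<longlongrightarrow> 0) (at t within {0..})"
  proof (rule sq_norm_tendsto_zeroI)
    fix e :: real assume "0 < e"
    then have "0 < sqrt e" by simp
    then obtain d where d: "0 < d" "\<And>s x. 0 \<le> s \<Longrightarrow> \<bar>s - t\<bar> < d \<Longrightarrow> x \<in> {0..1} \<Longrightarrow> \<bar>f s x - f t x\<bar> < sqrt e"
      by (rule joint_continuous_uniform[OF f t]) blast
    have "sq_norm unit_measure (\<lambda>x. f s x - f t x) \<le> e" if "0 \<le> s" "\<bar>s - t\<bar> < d" for s
      using sq_norm_unit_bounded[of "\<lambda>x. f s x - f t x" "sqrt e"] d(2)[OF that] \<open>0 < e\<close> by (force intro: less_imp_le)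
    then show "\<forall>\<^sub>F s in at t within {0..}. sq_norm unit_measure (\<lambda>x. f s x - f t x) \<le> e"
      unfolding eventually_at using d(1) by (auto simp: dist_real_def)
  qed
qed

text \<open>
  The mean value theorem at each \<open>x\<close> turns the difference quotient into a value of \<open>d\<close> at a nearby
  time, so the convergence is uniform in \<open>x\<close> and hence holds in the mean.
\<close>

lemma pointwise_imp_has_time_deriv:
  fixes w d :: "real \<Rightarrow> real \<Rightarrow> real"
  assumes w: "\<And>t x. 0 \<le> t \<Longrightarrow> x \<in> {0..1} \<Longrightarrow> ((\<lambda>s. w s x) has_real_derivative d t x) (at t within {0..})"
    and d: "continuous_on ({0..} \<times> {0..1}) (\<lambda>z. d (fst z) (snd z))" and t: "0 \<le> t"
  shows "has_time_deriv w (d t) t"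
  unfolding has_time_deriv_sq_norm
proof
  show "d t \<in> L2"
    by (rule continuous_in_L2[OF joint_continuous_slice[OF d t]])
  show "((\<lambda>s. sq_norm unit_measure (\<lambda>x. (w s x - w t x) / (s - t) - d t x)) \<longlongrightarrow> 0) (at t within {0..})"
  proof (rule sq_norm_tendsto_zeroI)
    fix e :: real assume "0 < e"
    then have "0 < sqrt e" by simp
    then obtain \<delta> where \<delta>: "0 < \<delta>" "\<And>s x. 0 \<le> s \<Longrightarrow> \<bar>s - t\<bar> < \<delta> \<Longrightarrow> x \<in> {0..1} \<Longrightarrow> \<bar>d s x - d t x\<bar> < sqrt e"
      by (rule joint_continuous_uniform[OF d t]) blast
    have mvt: "\<exists>r\<in>{a<..<b}. w b x - w a x = d r x * (b - a)" if "0 \<le> a" "a < b" "x \<in> {0..1}" for a b x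
    proof -
      have "((\<lambda>s. w s x) has_derivative (*) (d r x)) (at r within {a..b})" if "a \<le> r" "r \<le> b" for r
        using has_field_derivative_subset[OF w[of r x], of "{a..b}"] that \<open>0 \<le> a\<close> \<open>x \<in> {0..1}\<close>
        by (auto simp: has_field_derivative_def)
      from mvt_simple[OF \<open>a < b\<close> this] show ?thesis by simp
    qed
    have "\<bar>(w s x - w t x) / (s - t) - d t x\<bar> \<le> sqrt e" if s: "0 \<le> s" "s \<noteq> t" "\<bar>s - t\<bar> < \<delta>" and x: "x \<in> {0..1}" for s x
    proof -
      (* the mean value theorem on [s, t] or on [t, s] *)
      have "\<exists>r. 0 \<le> r \<and> \<bar>r - t\<bar> < \<delta> \<and> (w s x - w t x) / (s - t) = d r x"
      proof (cases "s < t")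
        case True
        then obtain r where r: "s < r" "r < t" "w t x - w s x = d r x * (t - s)"
          using mvt[OF s(1) True x] by auto
        from r(3) have "w s x - w t x = d r x * (s - t)" by (simp add: algebra_simps)
        then show ?thesis
          using r(1,2) s True by (intro exI[of _ r]) auto
      next
        case False
        then have "t < s" using s by simp
        then obtain r where "t < r" "r < s" "w s x - w t x = d r x * (s - t)"
          using mvt[OF t _ x, of s] by auto
        then show ?thesis
          using s t by (intro exI[of _ r]) auto
      qed
      then show ?thesis
        using \<delta>(2) x by (metis less_imp_le)
    qed
    then have "sq_norm unit_measure (\<lambda>x. (w s x - w t x) / (s - t) - d t x) \<le> e" if "0 \<le> s" "s \<noteq> t" "\<bar>s - t\<bar> < \<delta>" for s
      using sq_norm_unit_bounded[of "\<lambda>x. (w s x - w t x) / (s - t) - d t x" "sqrt e"] that \<open>0 < e\<close> by force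
    then show "\<forall>\<^sub>F s in at t within {0..}. sq_norm unit_measure (\<lambda>x. (w s x - w t x) / (s - t) - d t x) \<le> e"
      unfolding eventually_at using \<delta>(1) by (auto simp: dist_real_def)
  qed
qed

section \<open>Transport of a profile\<close>

text \<open>
  \<open>W\<close> is a profile on the half-line up to 1 with derivative \<open>w\<close>; only \<open>x - lam * t\<close> with
  \<open>x \<le> 1\<close> and \<open>t \<ge> 0\<close> is ever inserted. Square integrability is required on bounded pieces
  only, because the input that generates the negative part is arbitrary for large times.
\<close>

definition transport_profile :: "(real \<Rightarrow> real) \<Rightarrow> (real \<Rightarrow> real) \<Rightarrow> bool"
  where "transport_profile W w \<longleftrightarrow> w \<in> borel_measurable borel \<and>
    (\<forall>R\<ge>0. (\<lambda>y. indicator {- R..1} y * w y) \<in> square_integrable lborel) \<and>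
    (\<forall>p q. p \<le> q \<longrightarrow> q \<le> 1 \<longrightarrow> (LINT s:{p..q}|lborel. w s) = W q - W p)"

lemma interval_integral_difference:
  fixes w :: "real \<Rightarrow> real"
  assumes w: "integrable lborel w" and "p \<le> q"
  shows "(LINT s:{p..q}|lborel. w s) = (LINT s:{..q}|lborel. w s) - (LINT s:{..p}|lborel. w s)"
proof -
  have i: "integrable lborel (\<lambda>s. indicator A s *\<^sub>R w s)" if "A \<in> sets borel" for A
    using integrable_mult_indicator[OF _ w, of A] that by simp
  have "(LINT s:{..q}|lborel. w s) - (LINT s:{..p}|lborel. w s) = (LINT s|lborel. indicator {..q} s *\<^sub>R w s - indicator {..p} s *\<^sub>R w s)"
    unfolding set_lebesgue_integral_def by (rule Bochner_Integration.integral_diff[symmetric]) (use i in auto)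
  also have "\<dots> = (LINT s:{p..q}|lborel. w s)"
    unfolding set_lebesgue_integral_def
  proof (rule integral_cong_AE)
    have "AE s in lborel. s \<noteq> p" by (rule AE_lborel_singleton)
    then show "AE s in lborel. indicator {..q} s *\<^sub>R w s - indicator {..p} s *\<^sub>R w s = indicator {p..q} s *\<^sub>R w s"
      by eventually_elim (use \<open>p \<le> q\<close> in \<open>auto simp: indicator_def\<close>)
  qed (use w in auto)
  finally show ?thesis ..
qed

lemma sq_norm_unit_le_translate:
  assumes F: "F \<in> borel_measurable borel" "(\<integral>\<^sup>+y. ennreal ((F y)\<^sup>2) \<partial>lborel) \<le> ennreal r" "0 \<le> r"
    and f: "\<And>x. x \<in> {0<..<1} \<Longrightarrow> f x = F (c + x)"
  shows "sq_norm unit_measure f \<le> r"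
  unfolding sq_norm_def
proof (rule integral_real_bounded[OF \<open>0 \<le> r\<close>])
  have "(\<integral>\<^sup>+x. ennreal ((f x)\<^sup>2) \<partial>unit_measure) \<le> (\<integral>\<^sup>+x. ennreal ((F (c + 1 * x))\<^sup>2) \<partial>lborel)"
    unfolding nn_integral_unit_measure by (intro nn_integral_mono) (use f in \<open>auto simp: indicator_def\<close>)
  also have "\<dots> = (\<integral>\<^sup>+y. ennreal ((F y)\<^sup>2) \<partial>lborel)"
    using F(1) by (subst nn_integral_real_affine[of "\<lambda>y. ennreal ((F y)\<^sup>2)" 1 c]) auto
  finally show "(\<integral>\<^sup>+x. ennreal ((f x)\<^sup>2) \<partial>unit_measure) \<le> ennreal r"
    using F(2) by (rule order_trans)
qed

text \<open>
  Up to a given time only a bounded piece of the profile reaches the unit interval. Truncating \<open>w\<close> to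
  that piece gives a function in the range of the translation lemmas.
\<close>

lemma transport_profile_truncated:
  assumes prof: "transport_profile W w" and R: "0 \<le> R"
  defines "c \<equiv> \<lambda>y. indicator {- R..1} y * w y"
  shows "c \<in> square_integrable lborel" and "integrable lborel c"
    and "\<And>p q. p \<in> {- R..1} \<Longrightarrow> q \<in> {- R..1} \<Longrightarrow>
      (LINT s:{..q}|lborel. c s) - (LINT s:{..p}|lborel. c s) = W q - W p"
proof -
  show sq: "c \<in> square_integrable lborel"
    using prof R unfolding transport_profile_def c_def by blast
  then have cm: "c \<in> borel_measurable lborel" and ci: "integrable lborel (\<lambda>y. (c y)\<^sup>2)"
    unfolding square_integrable_def by blast+
  show int: "integrable lborel c"
  proof (rule Bochner_Integration.integrable_bound[OF _ cm])
    show "integrable lborel (\<lambda>y. indicator {- R..1} y + (c y)\<^sup>2)"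
      using ci R by (intro Bochner_Integration.integrable_add integrable_real_indicator) auto
    have "\<bar>a\<bar> \<le> 1 + a\<^sup>2" for a :: real
      using sum_squares_bound[of "\<bar>a\<bar>" 1] zero_le_power2[of a]
      unfolding power2_abs power_one mult_1_right by linarith
    then have "\<bar>c y\<bar> \<le> indicator {- R..1} y + (c y)\<^sup>2" for y
      by (simp add: c_def indicator_def)
    then show "AE y in lborel. norm (c y) \<le> norm (indicator {- R..1} y + (c y)\<^sup>2)"
      by (intro AE_I2) (simp add: order_trans[OF _ abs_ge_self])
  qed
  have le: "(LINT s:{..q}|lborel. c s) - (LINT s:{..p}|lborel. c s) = W q - W p"
    if "p \<in> {- R..1}" "q \<in> {- R..1}" "p \<le> q" for p q
  proof -
    have "(LINT s:{..q}|lborel. c s) - (LINT s:{..p}|lborel. c s) = (LINT s:{p..q}|lborel. c s)"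
      by (rule interval_integral_difference[OF int that(3), symmetric])
    also have "\<dots> = (LINT s:{p..q}|lborel. w s)"
      unfolding set_lebesgue_integral_def
      by (rule Bochner_Integration.integral_cong) (use that in \<open>auto simp: c_def indicator_def\<close>)
    also have "\<dots> = W q - W p"
      using prof that unfolding transport_profile_def by simp
    finally show ?thesis .
  qed
  show "(LINT s:{..q}|lborel. c s) - (LINT s:{..p}|lborel. c s) = W q - W p"
    if "p \<in> {- R..1}" "q \<in> {- R..1}" for p q
    using le[OF that] le[OF that(2,1)] by (cases "p \<le> q") auto
qed

lemma transport_H1_primitive:
  assumes prof: "transport_profile W w" and lam: "lam > 0" and t: "0 \<le> t"
  shows "H1_primitive (\<lambda>x. W (x - lam * t)) (\<lambda>x. w (x - lam * t))"
proof -
  define c where "c y = indicator {- (lam * t)..1} y * w y" for y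
  note trunc = transport_profile_truncated[OF prof mult_nonneg_nonneg[OF less_imp_le[OF lam] t], folded c_def]
  have cm: "c \<in> borel_measurable borel" and wm: "w \<in> borel_measurable borel"
    using trunc(1) prof unfolding square_integrable_def transport_profile_def by simp_all
  define k where "k x = c (x - lam * t)" for x
  have k_sq: "k \<in> square_integrable lborel" and k_int: "integrable lborel k"
    using square_integrable_translate(1)[OF trunc(1), of "- (lam * t)"]
      lborel_integrable_real_affine[OF trunc(2), of 1 "- (lam * t)"] by (simp_all add: k_def[abs_def])
  have km: "k \<in> borel_measurable borel" using k_int by simp
  have eq: "w (x - lam * t) = k x" if "x \<in> {0..1}" for x
    using that mult_nonneg_nonneg[OF less_imp_le[OF lam] t] by (simp add: k_def c_def)
  have "k \<in> L2"
    unfolding L2_eq_square_integrable square_integrable_def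
  proof safe
    show "k \<in> borel_measurable unit_measure" by (rule borel_measurable_unit[OF km])
    have "integrable lborel (\<lambda>x. (k x)\<^sup>2)" using k_sq by (simp add: square_integrable_def)
    then have "integrable lebesgue (\<lambda>x. (k x)\<^sup>2)" using km by (subst integrable_completion) auto
    then show "integrable unit_measure (\<lambda>x. (k x)\<^sup>2)"
      using integrable_mult_indicator[of "{0<..<1}" lebesgue "\<lambda>x. (k x)\<^sup>2"] by (simp add: integrable_restrict_space)
  qed
  moreover have "(\<lambda>x. w (x - lam * t)) \<in> borel_measurable unit_measure"
    using wm by (intro borel_measurable_unit) simp
  moreover have "integrable unit_measure (\<lambda>x. (w (x - lam * t))\<^sup>2) \<longleftrightarrow> integrable unit_measure (\<lambda>x. (k x)\<^sup>2)"
    by (rule Bochner_Integration.integrable_cong) (use eq in auto)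
  ultimately have "(\<lambda>x. w (x - lam * t)) \<in> L2"
    unfolding L2_def by blast
  moreover have "W (x - lam * t) = W (0 - lam * t) + integral {0..x} (\<lambda>x. w (x - lam * t))" if x: "x \<in> {0..1}" for x
  proof -
    have "integral {0..x} (\<lambda>x. w (x - lam * t)) = integral {0..x} k"
      by (rule Henstock_Kurzweil_Integration.integral_cong) (use eq x in auto)
    also have "\<dots> = (LINT s:{0..x}|lborel. k s)"
      by (rule set_borel_integral_eq_integral(2)[symmetric])
        (use integrable_mult_indicator[OF _ k_int, of "{0..x}"] in \<open>simp add: set_integrable_def\<close>)
    also have "\<dots> = (LINT s|lborel. indicator {- (lam * t)..x - lam * t} (- (lam * t) + 1 * s) * c (- (lam * t) + 1 * s))"
      unfolding set_lebesgue_integral_def k_def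
      by (rule Bochner_Integration.integral_cong) (auto simp: indicator_def)
    also have "\<dots> = (LINT s:{- (lam * t)..x - lam * t}|lborel. c s)"
      using lborel_integral_real_affine[of 1 "\<lambda>s. indicator {- (lam * t)..x - lam * t} s * c s" "- (lam * t)"]
      by (simp add: set_lebesgue_integral_def)
    also have "\<dots> = (LINT s:{..x - lam * t}|lborel. c s) - (LINT s:{..- (lam * t)}|lborel. c s)"
      using x by (intro interval_integral_difference trunc(2)) auto
    also have "\<dots> = W (x - lam * t) - W (- (lam * t))"
      using x mult_nonneg_nonneg[OF less_imp_le[OF lam] t] by (intro trunc(3)) auto
    finally show ?thesis by simp
  qed
  ultimately show ?thesis
    unfolding H1_primitive_def by blast
qed

text \<open>
  Continuity in time is continuity of translations, with \<open>h = - lam * (s - t)\<close>.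
\<close>

lemma transport_derivative_C0_L2:
  assumes prof: "transport_profile W w" and lam: "lam > 0"
  shows "C0_L2 (\<lambda>t x. w (x - lam * t))"
  unfolding C0_L2_sq_norm
proof (intro conjI allI impI)
  fix t :: real assume t: "0 \<le> t"
  show "(\<lambda>x. w (x - lam * t)) \<in> L2"
    by (rule H1_primitive_L2[OF transport_H1_primitive[OF prof lam t]])
  (* the points x - lam * s with x in the unit interval and s at distance at most 1 from t lie in [-R, 1] *)
  define R where "R = lam * (t + 1)"
  have R: "0 \<le> R" using lam t by (simp add: R_def)
  define c where "c y = indicator {- R..1} y * w y" for y
  have c: "c \<in> square_integrable lborel"
    using transport_profile_truncated(1)[OF prof R] by (simp add: c_def[abs_def])
  show "((\<lambda>s. sq_norm unit_measure (\<lambda>x. w (x - lam * s) - w (x - lam * t))) \<longlongrightarrow> 0) (at t within {0..})"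
  proof (rule sq_norm_tendsto_zeroI)
    fix e :: real assume e: "0 < e"
    have "((\<lambda>h. sq_norm lborel (\<lambda>y. c (y + h) - c y)) \<longlongrightarrow> 0) (at 0)"
      by (rule translation_continuous_L2[OF c, of "R + 1"]) (use R in \<open>auto simp: c_def indicator_def\<close>)
    then have "\<forall>\<^sub>F h in at 0. sq_norm lborel (\<lambda>y. c (y + h) - c y) < e"
      using e by (rule order_tendstoD(2))
    then obtain d where d: "0 < d" "\<And>h. h \<noteq> 0 \<Longrightarrow> \<bar>h\<bar> < d \<Longrightarrow> sq_norm lborel (\<lambda>y. c (y + h) - c y) < e"
      by (auto simp: eventually_at dist_real_def)
    have "sq_norm unit_measure (\<lambda>x. w (x - lam * s) - w (x - lam * t)) \<le> e"
      if s: "0 \<le> s" "s \<noteq> t" "\<bar>s - t\<bar> < min 1 (d / lam)" for s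
    proof (rule sq_norm_unit_le_translate[where c = "- (lam * t)"])
      define h where "h = - (lam * (s - t))"
      have "\<bar>h\<bar> < d" "h \<noteq> 0"
      proof -
        have "lam * \<bar>s - t\<bar> < d"
          using s lam by (simp add: pos_less_divide_eq mult.commute)
        then show "\<bar>h\<bar> < d" "h \<noteq> 0"
          using s lam by (auto simp: h_def abs_mult)
      qed
      have diff: "(\<lambda>y. c (y + h) - c y) \<in> square_integrable lborel"
        by (rule square_integrable_diff[OF square_integrable_translate(1)[OF c] c])
      then show "(\<lambda>y. c (y + h) - c y) \<in> borel_measurable borel"
        by (simp add: square_integrable_def)
      have "(\<integral>\<^sup>+y. ennreal ((c (y + h) - c y)\<^sup>2) \<partial>lborel) = ennreal (sq_norm lborel (\<lambda>y. c (y + h) - c y))"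
        using nn_integral_square[OF diff] by (simp add: ennreal_power)
      then show "(\<integral>\<^sup>+y. ennreal ((c (y + h) - c y)\<^sup>2) \<partial>lborel) \<le> ennreal e"
        using d(2)[OF \<open>h \<noteq> 0\<close> \<open>\<bar>h\<bar> < d\<close>] by (simp add: ennreal_leI)
      show "0 \<le> e" using e by simp
      fix x :: real assume x: "x \<in> {0<..<1}"
      have "lam * s \<le> R" "0 \<le> lam * s" "lam * t \<le> R" "0 \<le> lam * t"
        using s t lam by (auto simp: R_def)
      then show "w (x - lam * s) - w (x - lam * t) = c (- (lam * t) + x + h) - c (- (lam * t) + x)"
        using x by (simp add: c_def h_def algebra_simps)
    qed
    then show "\<forall>\<^sub>F s in at t within {0..}. sq_norm unit_measure (\<lambda>x. w (x - lam * s) - w (x - lam * t)) \<le> e"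
      unfolding eventually_at using d(1) lam by (intro exI[of _ "min 1 (d / lam)"]) (auto simp: dist_real_def)
  qed
qed

text \<open>
  Moving the profile in time is translating it in space: with \<open>h = - lam * (s - t)\<close> the error of
  the difference quotient is \<open>- lam\<close> times the average in \<open>translation_average_L2\<close>.
\<close>

lemma transport_has_time_deriv:
  assumes prof: "transport_profile W w" and lam: "lam > 0" and t: "0 \<le> t"
  shows "has_time_deriv (\<lambda>t x. W (x - lam * t)) (\<lambda>x. - lam * w (x - lam * t)) t"
  unfolding has_time_deriv_sq_norm
proof
  show "(\<lambda>x. - lam * w (x - lam * t)) \<in> L2"
    by (intro L2_cmult H1_primitive_L2[OF transport_H1_primitive[OF prof lam t]])
  (* the points x - lam * s with x in the unit interval and s at distance at most 1 from t lie in [-R, 1] *)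
  define R where "R = lam * (t + 1)"
  have R: "0 \<le> R" using lam t by (simp add: R_def)
  define c where "c y = indicator {- R..1} y * w y" for y
  note trunc = transport_profile_truncated[OF prof R, folded c_def]
  have [measurable]: "c \<in> borel_measurable borel"
    using trunc(2) by simp
  show "((\<lambda>s. sq_norm unit_measure (\<lambda>x. (W (x - lam * s) - W (x - lam * t)) / (s - t) - - lam * w (x - lam * t))) \<longlongrightarrow> 0)
     (at t within {0..})"
  proof (rule sq_norm_tendsto_zeroI)
    fix e :: real assume "0 < e"
    then have e: "0 < e / lam\<^sup>2" using lam by simp
    have supp: "c x = 0" if "R + 1 < \<bar>x\<bar>" for x
      using that R by (auto simp: c_def indicator_def)
    obtain d where d: "0 < d" "\<And>h. \<bar>h\<bar> < d \<Longrightarrow>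
      (\<integral>\<^sup>+y. ennreal ((LINT r:{0..1}|lborel. c (y + h * r) - c y)\<^sup>2) \<partial>lborel) \<le> ennreal (e / lam\<^sup>2)"
      by (rule translation_average_L2[OF trunc(1), of "R + 1" "e / lam\<^sup>2"]) (use supp e in blast)+
    have "sq_norm unit_measure (\<lambda>x. (W (x - lam * s) - W (x - lam * t)) / (s - t) - - lam * w (x - lam * t)) \<le> e"
      if s: "0 \<le> s" "s \<noteq> t" "\<bar>s - t\<bar> < min 1 (d / lam)" for s
    proof -
      define h where "h = - (lam * (s - t))"
      have h: "\<bar>h\<bar> < d" "h \<noteq> 0"
      proof -
        have "lam * \<bar>s - t\<bar> < d"
          using s lam by (simp add: pos_less_divide_eq mult.commute)
        then show "\<bar>h\<bar> < d" "h \<noteq> 0"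
          using s lam by (auto simp: h_def abs_mult)
      qed
      have "sq_norm unit_measure (\<lambda>x. (W (x - lam * s) - W (x - lam * t)) / h - w (x - lam * t)) \<le> e / lam\<^sup>2"
      proof (rule sq_norm_unit_le_translate[OF _ d(2)[OF h(1)], where c = "- (lam * t)"])
        show "(\<lambda>y. LINT r:{0..1}|lborel. c (y + h * r) - c y) \<in> borel_measurable borel"
          unfolding set_lebesgue_integral_def by measurable
        show "0 \<le> e / lam\<^sup>2" using e by simp
        fix x :: real assume x: "x \<in> {0<..<1}"
        let ?y = "- (lam * t) + x"
        have "lam * s \<le> R" "0 \<le> lam * s" "lam * t \<le> R" "0 \<le> lam * t"
          using s t lam by (auto simp: R_def)
        then have y: "?y \<in> {- R..1}" "?y + h \<in> {- R..1}"
          using x by (auto simp: h_def algebra_simps)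
        have i: "set_integrable lborel {0..1} (\<lambda>r. c (?y + h * r))"
          unfolding set_integrable_def
          by (intro integrable_mult_indicator lborel_integrable_real_affine trunc(2) h(2)) simp
        have "(LINT r:{0..1}|lborel. c (?y + h * r) - c ?y)
          = (LINT r:{0..1}|lborel. c (?y + h * r)) - (LINT r:{0..1::real}|lborel. c ?y)"
          by (rule set_integral_diff(2)[OF i]) (simp add: set_integrable_def)
        also have "\<dots> = ((LINT s:{..?y + h}|lborel. c s) - (LINT s:{..?y}|lborel. c s)) / h - c ?y"
          unfolding average_eq_difference_quotient[OF trunc(2) h(2)] by (simp add: set_lebesgue_integral_def)
        also have "(LINT s:{..?y + h}|lborel. c s) - (LINT s:{..?y}|lborel. c s) = W (?y + h) - W ?y"
          by (rule trunc(3)[OF y])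
        finally have "(LINT r:{0..1}|lborel. c (?y + h * r) - c ?y) = (W (?y + h) - W ?y) / h - c ?y" .
        moreover have "c ?y = w ?y"
          using y(1) by (simp add: c_def)
        moreover have "x - lam * s = ?y + h" "x - lam * t = ?y"
          by (simp_all add: h_def algebra_simps)
        ultimately show "(W (x - lam * s) - W (x - lam * t)) / h - w (x - lam * t) = (LINT r:{0..1}|lborel. c (?y + h * r) - c ?y)"
          by (simp only:)
      qed
      then have "(- lam)\<^sup>2 * sq_norm unit_measure (\<lambda>x. (W (x - lam * s) - W (x - lam * t)) / h - w (x - lam * t)) \<le> e"
        using lam by (simp add: field_simps)
      moreover have "- lam * ((W (x - lam * s) - W (x - lam * t)) / h - w (x - lam * t))
        = (W (x - lam * s) - W (x - lam * t)) / (s - t) - - lam * w (x - lam * t)" for x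
        using lam s(2) by (simp add: h_def field_simps)
      ultimately show ?thesis
        unfolding sq_norm_cmult[symmetric] by simp
    qed
    then show "\<forall>\<^sub>F s in at t within {0..}. sq_norm unit_measure
      (\<lambda>x. (W (x - lam * s) - W (x - lam * t)) / (s - t) - - lam * w (x - lam * t)) \<le> e"
      unfolding eventually_at using d(1) lam by (intro exI[of _ "min 1 (d / lam)"]) (auto simp: dist_real_def)
  qed
qed

text \<open>
  The initial datum occupies the unit interval and the input, run backwards, the negative
  half-line. The compatibility of \<open>U\<close> with \<open>u0\<close> at the corner makes the two pieces fit continuously,
  so that no jump has to be added to the derivative \<open>w\<close>.
\<close>

lemma transport_profile_exists:
  assumes lam: "lam > 0" and u0: "u0 \<in> H1" and U: "C1_halfline U" and compat: "U 0 = u0 0"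
  obtains W w where "transport_profile W w" "continuous_on UNIV W"
    "\<And>x. x \<in> {0..1} \<Longrightarrow> W x = u0 x" "\<And>t. 0 \<le> t \<Longrightarrow> W (- (lam * t)) = U t"
proof -
  obtain U' where U': "continuous_on {0..} U'" "\<And>t. 0 \<le> t \<Longrightarrow> (U has_real_derivative U' t) (at t within {0..})"
    using U by (auto simp: C1_halfline_def)
  note prim = H1_imp_weak_deriv_primitive[OF u0]
  obtain g where g: "g \<in> square_integrable lborel" "integrable lborel g" "\<And>x. x \<notin> {0<..<1} \<Longrightarrow> g x = 0"
    "AE x in unit_measure. g x = weak_deriv u0 x"
    by (rule L2_borel_representative[OF H1_primitive_L2[OF prim]]) blast
  define V where "V y = - (U' (max 0 (- (y / lam))) / lam)" for y
  have V_cont: "continuous_on UNIV V"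
    unfolding V_def using lam by (intro continuous_intros continuous_on_compose2[OF U'(1)]) auto
  have [measurable]: "V \<in> borel_measurable borel" "g \<in> borel_measurable borel"
    using V_cont g(2) by (auto intro: borel_measurable_continuous_onI)
  define w where "w y = (if y < 0 then V y else 0) + g y" for y
  (* Phi carries the input, Psi the initial datum; each is constant where the other one varies *)
  define \<Phi> where "\<Phi> y = U (max 0 (- (y / lam)))" for y
  define \<Psi> where "\<Psi> y = u0 (max 0 (min 1 y))" for y
  define W where "W y = \<Phi> y + \<Psi> y - u0 0" for y
  have U_cont: "continuous_on {0..} U"
    using U'(2) by (auto intro!: DERIV_continuous_on)
  have \<Phi>_deriv: "(\<Phi> has_real_derivative V y) (at y within {a..b})" if "b \<le> 0" "y \<in> {a..b}" for a b y
  proof -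
    have "((\<lambda>y. - (y / lam)) has_real_derivative - (1 / lam)) (at y within {a..b})"
      using lam by (auto intro!: derivative_eq_intros)
    moreover have "(U has_real_derivative U' (- (y / lam))) (at (- (y / lam)) within (\<lambda>y. - (y / lam)) ` {a..b})"
      by (rule has_field_derivative_subset[OF U'(2)]) (use that lam in \<open>auto simp: divide_le_0_iff\<close>)
    ultimately have "(U \<circ> (\<lambda>y. - (y / lam)) has_real_derivative U' (- (y / lam)) * - (1 / lam)) (at y within {a..b})"
      by (rule DERIV_image_chain[rotated])
    moreover have "V y = U' (- (y / lam)) * - (1 / lam)"
      using that lam by (simp add: V_def divide_le_0_iff)
    ultimately have "(U \<circ> (\<lambda>y. - (y / lam)) has_real_derivative V y) (at y within {a..b})"
      by simp
    then show ?thesis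
      by (rule has_field_derivative_transform_within[OF _ zero_less_one])
        (use that lam in \<open>auto simp: \<Phi>_def divide_le_0_iff\<close>)
  qed
  have left: "(LINT s:{p..q}|lborel. if s < 0 then V s else 0) = \<Phi> q - \<Phi> p" if "p \<le> q" for p q
  proof -
    let ?p = "min p 0" and ?q = "min q 0"
    have "(LINT s:{p..q}|lborel. if s < 0 then V s else 0) = (LINT s|lborel. indicator {?p..?q} s *\<^sub>R V s)"
      unfolding set_lebesgue_integral_def
    proof (rule integral_cong_AE)
      have "AE s in lborel. s \<noteq> (0::real)" by (rule AE_lborel_singleton)
      then show "AE s in lborel. indicator {p..q} s *\<^sub>R (if s < 0 then V s else 0) = indicator {?p..?q} s *\<^sub>R V s"
        by eventually_elim (use that in \<open>auto simp: indicator_def\<close>)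
    qed measurable
    also have "\<dots> = \<Phi> ?q - \<Phi> ?p"
      using that by (intro integral_FTC_atLeastAtMost continuous_on_subset[OF V_cont])
        (auto simp: has_real_derivative_iff_has_vector_derivative[symmetric] intro!: \<Phi>_deriv)
    also have "\<Phi> ?q = \<Phi> q"
      using lam by (auto simp: \<Phi>_def min_def)
    also have "\<Phi> ?p = \<Phi> p"
      using lam by (auto simp: \<Phi>_def min_def)
    finally show ?thesis .
  qed
  have right: "(LINT s:{p..q}|lborel. g s) = \<Psi> q - \<Psi> p" if "p \<le> q" for p q
  proof -
    have "(LINT s:{..x}|lborel. g s) = \<Psi> x - u0 0" for x
      using primitive_eq_lborel_clamped[OF H1_primitive_L2[OF prim] g(2-4), of x]
        H1_primitive_eq[OF prim, of "max 0 (min 1 x)"] by (simp add: \<Psi>_def)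
    then show ?thesis
      using interval_integral_difference[OF g(2) that] by simp
  qed
  have left_int: "integrable lborel (\<lambda>s. indicator {p..q} s * (if s < 0 then V s else 0) ^ n)" if "0 < n" for p q n
  proof (rule Bochner_Integration.integrable_bound)
    show "integrable lborel (\<lambda>s. indicator {p..q} s *\<^sub>R (V s ^ n))"
      by (intro borel_integrable_compact continuous_intros continuous_on_subset[OF V_cont]) auto
    show "(\<lambda>s. indicator {p..q} s * (if s < 0 then V s else 0) ^ n) \<in> borel_measurable lborel"
      by measurable
    have "norm (indicator {p..q} s * (if s < 0 then V s else 0) ^ n) \<le> norm (indicator {p..q} s *\<^sub>R (V s ^ n))" for s
      using that by (simp add: indicator_def zero_power)
    then show "AE s in lborel. norm (indicator {p..q} s * (if s < 0 then V s else 0) ^ n)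
      \<le> norm (indicator {p..q} s *\<^sub>R (V s ^ n))"
      by (intro AE_I2)
  qed
  have "transport_profile W w"
    unfolding transport_profile_def
  proof (intro conjI allI impI)
    show wm: "w \<in> borel_measurable borel"
      unfolding w_def by measurable
    show "(\<lambda>y. indicator {- R..1} y * w y) \<in> square_integrable lborel" if "0 \<le> R" for R
    proof -
      have "(\<lambda>y. indicator {- R..1} y * (if y < 0 then V y else 0)) \<in> square_integrable lborel"
      proof -
        have "(indicator {- R..1} y * (if y < 0 then V y else 0))\<^sup>2 = indicator {- R..1} y * (if y < 0 then V y else 0)\<^sup>2" for y
          by (simp add: indicator_def)
        then show ?thesis
          using left_int[of 2 "- R" 1] by (simp add: square_integrable_def)
      qed
      from square_integrable_add[OF this g(1)]
      have "(\<lambda>y. indicator {- R..1} y * (if y < 0 then V y else 0) + g y) \<in> square_integrable lborel" .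
      moreover have "indicator {- R..1} y * (if y < 0 then V y else 0) + g y = indicator {- R..1} y * w y" for y
        using g(3)[of y] that by (auto simp: w_def indicator_def)
      ultimately show ?thesis by simp
    qed
    fix p q :: real assume "p \<le> q" "q \<le> 1"
    have "(LINT s:{p..q}|lborel. w s) = (LINT s:{p..q}|lborel. if s < 0 then V s else 0) + (LINT s:{p..q}|lborel. g s)"
      unfolding w_def
    proof (rule set_integral_add(2))
      show "set_integrable lborel {p..q} (\<lambda>s. if s < 0 then V s else 0)"
        using left_int[of 1 p q] by (simp add: set_integrable_def)
      show "set_integrable lborel {p..q} g"
        unfolding set_integrable_def by (intro integrable_mult_indicator g(2)) simp
    qed
    then show "(LINT s:{p..q}|lborel. w s) = W q - W p"
      unfolding left[OF \<open>p \<le> q\<close>] right[OF \<open>p \<le> q\<close>] by (simp add: W_def)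
  qed
  moreover have "continuous_on UNIV W"
    unfolding W_def \<Phi>_def \<Psi>_def using lam
    by (intro continuous_intros continuous_on_compose2[OF U_cont] continuous_on_compose2[OF H1_imp_continuous[OF u0]]) auto
  moreover have "W x = u0 x" if "x \<in> {0..1}" for x
    using that lam compat by (simp add: W_def \<Phi>_def \<Psi>_def)
  moreover have "W (- (lam * t)) = U t" if "0 \<le> t" for t
  proof -
    have "max 0 (min 1 (- (lam * t))) = 0"
      using mult_nonneg_nonneg[OF less_imp_le[OF lam] that] by linarith
    then show ?thesis
      using that lam by (simp add: W_def \<Phi>_def \<Psi>_def)
  qed
  ultimately show ?thesis
    by (rule that)
qed

section \<open>The explicit solution\<close>

text \<open>
  The integral of the source along time, substituted by \<open>y = x - lam * s\<close>, becomes an integral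
  over the profile with this exponential weight.
\<close>

definition weighted_antiderivative :: "real \<Rightarrow> (real \<Rightarrow> real) \<Rightarrow> (real \<Rightarrow> real) \<Rightarrow> bool"
  where "weighted_antiderivative a W G \<longleftrightarrow> (\<forall>y. (G has_real_derivative exp (a * y) * W y) (at y))"

text \<open>
  The variation-of-constants formula for \<open>v\<close>, with its time integral expressed by the antiderivative
  \<open>G\<close> of the weighted profile. Its dependence on space is that of a
  multiple of \<open>v0\<close> plus a continuously differentiable function.
\<close>

definition v_solution :: "real \<Rightarrow> real \<Rightarrow> real \<Rightarrow> (real \<Rightarrow> real) \<Rightarrow> (real \<Rightarrow> real) \<Rightarrow> real \<Rightarrow> real \<Rightarrow> real"
  where "v_solution lam psi om v0 G t x =
    exp (psi * t) * (v0 x + om / lam * exp (- (psi / lam) * x) * (G x - G (x - lam * t)))"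

lemma v_solution_is_solution:
  assumes lam: "lam > 0" and prof: "transport_profile W w" and W: "continuous_on UNIV W"
    and G: "weighted_antiderivative (psi / lam) W G" and v0: "v0 \<in> H1"
    and initial: "\<And>x. x \<in> {0..1} \<Longrightarrow> W x = u0 x" and boundary: "\<And>t. 0 \<le> t \<Longrightarrow> W (- (lam * t)) = U t"
  shows "is_solution lam psi om u0 v0 U (\<lambda>t x. W (x - lam * t)) (v_solution lam psi om v0 G)"
proof -
  define a where "a = psi / lam"
  have a_lam: "a * lam = psi" using lam by (simp add: a_def)
  define g where "g y = exp (a * y) * W y" for y
  have G': "(G has_real_derivative g y) (at y)" for y
    using G by (simp add: weighted_antiderivative_def g_def a_def)
  have g_cont: "continuous_on UNIV g"
    unfolding g_def by (intro continuous_intros W)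
  have G_cont: "continuous_on UNIV G"
    using G' by (meson DERIV_isCont continuous_at_imp_continuous_on)
  let ?u = "\<lambda>t x. W (x - lam * t)"
  let ?v = "v_solution lam psi om v0 G"
  note u_prim = transport_H1_primitive[OF prof lam]
  have joint_u: "continuous_on ({0..} \<times> {0..1}) (\<lambda>z. W (snd z - lam * fst z))"
    by (intro continuous_on_compose2[OF W] continuous_intros) auto
  have u_L2: "C0_L2 ?u"
    by (rule joint_continuous_C0_L2) (use joint_u in simp)
  have u_dL2: "C0_L2 (\<lambda>t x. - lam * w (x - lam * t))"
    by (rule C0_L2_cmult[OF transport_derivative_C0_L2[OF prof lam]])
  have u_H1: "C0_H1 ?u"
    by (rule C0_H1I[OF u_prim u_L2 transport_derivative_C0_L2[OF prof lam]])
  have u_mem: "?u t \<in> L2" if "0 \<le> t" for t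
    using u_L2 that by (simp add: C0_L2_def)
  have u_td: "has_time_deriv ?u (\<lambda>x. - lam * w (x - lam * t)) t" if "0 \<le> t" for t
    by (rule transport_has_time_deriv[OF prof lam that])
  have u_C1: "C1_L2 ?u"
    by (rule C1_L2I(1)[OF u_mem u_td u_dL2])
  have u_pde: "AE x in unit_measure. time_deriv ?u t x = - lam * weak_deriv (?u t) x" if t: "0 \<le> t" for t
  proof -
    have "AE x in unit_measure. weak_deriv (?u t) x = w (x - lam * t)"
      using H1_primitive_unique[OF H1_imp_weak_deriv_primitive[OF H1_primitive_imp_H1[OF u_prim[OF t]]] u_prim[OF t]] .
    moreover have "AE x in unit_measure. time_deriv ?u t x = - lam * w (x - lam * t)"
      by (rule C1_L2I(2)[OF u_mem u_td u_dL2 t])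
    ultimately show ?thesis
      by eventually_elim simp
  qed

  (* the classical space derivative of the part of v that does not come from v0 *)
  define k where "k t x = om / lam * exp (psi * t) * (exp (- a * x) * (g x - g (x - lam * t))
    - a * exp (- a * x) * (G x - G (x - lam * t)))" for t x
  define dv where "dv t x = psi * ?v t x + om * W (x - lam * t)" for t x
  have char_cont: "continuous_on S (\<lambda>z :: real \<times> real. snd z - lam * fst z)" for S
    by (intro continuous_intros)
  have joint_G: "continuous_on S (\<lambda>z :: real \<times> real. G (snd z - lam * fst z))" "continuous_on S (\<lambda>z :: real \<times> real. G (snd z))" for S
    by (rule continuous_on_compose2[OF G_cont char_cont subset_UNIV]
        continuous_on_compose2[OF G_cont continuous_on_snd[OF continuous_on_id] subset_UNIV])+
  have joint_g: "continuous_on S (\<lambda>z :: real \<times> real. g (snd z - lam * fst z))" "continuous_on S (\<lambda>z :: real \<times> real. g (snd z))" for S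
    by (rule continuous_on_compose2[OF g_cont char_cont subset_UNIV]
        continuous_on_compose2[OF g_cont continuous_on_snd[OF continuous_on_id] subset_UNIV])+
  have joint_v0: "continuous_on ({0..} \<times> {0..1}) (\<lambda>z. v0 (snd z))"
    by (rule continuous_on_compose2[OF H1_imp_continuous[OF v0] continuous_on_snd[OF continuous_on_id]]) auto
  have joint_v: "continuous_on ({0..} \<times> {0..1}) (\<lambda>z. ?v (fst z) (snd z))"
    unfolding v_solution_def by (intro continuous_intros joint_v0 joint_G) (use lam in auto)
  have joint_dv: "continuous_on ({0..} \<times> {0..1}) (\<lambda>z. dv (fst z) (snd z))"
    unfolding dv_def by (intro continuous_intros joint_v joint_u)
  have joint_k: "continuous_on ({0..} \<times> {0..1}) (\<lambda>z. k (fst z) (snd z))"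
    unfolding k_def by (intro continuous_intros joint_G joint_g) (use lam in auto)
  have v_prim: "H1_primitive (?v t) (\<lambda>x. exp (psi * t) * weak_deriv v0 x + 1 * k t x)" if t: "0 \<le> t" for t
  proof -
    have "((\<lambda>x. om / lam * exp (psi * t) * (exp (- a * x) * (G x - G (x - lam * t)))) has_real_derivative k t x) (at x)" for x
    proof -
      have "((\<lambda>x. G (x - lam * t)) has_real_derivative g (x - lam * t)) (at x)"
      proof -
        have "((\<lambda>x. x - lam * t) has_real_derivative 1) (at x)"
          by (auto intro!: derivative_eq_intros)
        from DERIV_chain2[OF G' this] show ?thesis by simp
      qed
      then have "((\<lambda>x. exp (- a * x) * (G x - G (x - lam * t))) has_real_derivative
        exp (- a * x) * (g x - g (x - lam * t)) - a * exp (- a * x) * (G x - G (x - lam * t))) (at x)"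
        by (auto intro!: derivative_eq_intros G' simp: algebra_simps)
      then show ?thesis
        unfolding k_def by (rule DERIV_cmult)
    qed
    then have "H1_primitive (\<lambda>x. om / lam * exp (psi * t) * (exp (- a * x) * (G x - G (x - lam * t)))) (k t)"
      by (rule C1_imp_H1_primitive) (rule joint_continuous_slice[OF joint_k t])
    from H1_primitive_lincomb[OF H1_imp_weak_deriv_primitive[OF v0] this, of "exp (psi * t)" 1]
    have "H1_primitive (\<lambda>x. exp (psi * t) * v0 x + 1 * (om / lam * exp (psi * t) * (exp (- a * x) * (G x - G (x - lam * t)))))
      (\<lambda>x. exp (psi * t) * weak_deriv v0 x + 1 * k t x)" .
    moreover have "?v t x = exp (psi * t) * v0 x + 1 * (om / lam * exp (psi * t) * (exp (- a * x) * (G x - G (x - lam * t))))" for x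
      by (simp add: v_solution_def a_def distrib_left mult_ac)
    ultimately show ?thesis
      by presburger
  qed
  have v_L2: "C0_L2 ?v"
    by (rule joint_continuous_C0_L2[OF joint_v])
  have "C0_L2 (\<lambda>t x. exp (psi * t) * weak_deriv v0 x)"
    by (intro C0_L2_scale continuous_intros H1_primitive_L2[OF H1_imp_weak_deriv_primitive[OF v0]])
  then have v_H1: "C0_H1 ?v"
    using C0_L2_add[OF _ joint_continuous_C0_L2[OF joint_k]]
    by (intro C0_H1I[OF v_prim v_L2]) simp_all
  have v_deriv: "((\<lambda>s. ?v s x) has_real_derivative dv t x) (at t within {0..})" for t x
  proof -
    have "((\<lambda>s. G (x - lam * s)) has_real_derivative - lam * g (x - lam * t)) (at t)"
    proof -
      have "((\<lambda>s. x - lam * s) has_real_derivative - lam) (at t)"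
        by (auto intro!: derivative_eq_intros)
      from DERIV_chain2[OF G' this] show ?thesis by (simp add: mult.commute)
    qed
    then have "((\<lambda>s. exp (psi * s) * (v0 x + C * (G x - G (x - lam * s)))) has_real_derivative
      psi * (exp (psi * t) * (v0 x + C * (G x - G (x - lam * t)))) + exp (psi * t) * (C * (lam * g (x - lam * t)))) (at t)" for C
      by (auto intro!: derivative_eq_intros simp: algebra_simps)
    from this[of "om / lam * exp (- a * x)"] have "((\<lambda>s. ?v s x) has_real_derivative psi * ?v t x
      + exp (psi * t) * (om / lam * exp (- a * x) * (lam * g (x - lam * t)))) (at t)"
      unfolding v_solution_def a_def .
    moreover have "exp (psi * t) * (om / lam * exp (- a * x) * (lam * g (x - lam * t))) = om * W (x - lam * t)"
    proof -
      (* the weight of the antiderivative cancels both exponential factors, leaving exactly the source om * u *)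
      have "exp (psi * t) * exp (- a * x) * exp (a * (x - lam * t)) = exp (psi * t + - a * x + a * (x - lam * t))"
        by (simp only: exp_add)
      also have "psi * t + - a * x + a * (x - lam * t) = 0"
        by (simp add: a_lam[symmetric] algebra_simps)
      finally have one: "exp (psi * t) * exp (- a * x) * exp (a * (x - lam * t)) = 1"
        by simp
      have "exp (psi * t) * (om / lam * exp (- a * x) * (lam * g (x - lam * t)))
        = om * (exp (psi * t) * exp (- a * x) * exp (a * (x - lam * t))) * W (x - lam * t)"
        using lam by (simp add: g_def)
      then show ?thesis
        unfolding one by simp
    qed
    ultimately show ?thesis
      by (auto simp: dv_def intro: has_field_derivative_at_within)
  qed
  have v_mem: "?v t \<in> L2" if "0 \<le> t" for t
    using v_L2 that by (simp add: C0_L2_def)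
  have v_td: "has_time_deriv ?v (dv t) t" if "0 \<le> t" for t
    by (rule pointwise_imp_has_time_deriv[OF v_deriv joint_dv that])
  have v_C1: "C1_L2 ?v"
    by (rule C1_L2I(1)[OF v_mem v_td joint_continuous_C0_L2[OF joint_dv]])
  show ?thesis
    unfolding is_solution_def
  proof (intro conjI allI impI ballI)
    show "AE x in unit_measure. time_deriv ?v t x = psi * ?v t x + om * W (x - lam * t)" if "0 \<le> t" for t
      unfolding dv_def[symmetric] by (rule C1_L2I(2)[OF v_mem v_td joint_continuous_C0_L2[OF joint_dv] that])
    show "?v 0 x = v0 x" for x
      by (simp add: v_solution_def)
  qed (use u_H1 u_C1 v_H1 v_C1 u_pde initial boundary in auto)
qed

section \<open>Failure of convergence\<close>

text \<open>
  The identity behind the theorem. The input enters \<open>v\<close> only through \<open>G (x - lam * t)\<close>, which is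
  constant along characteristics, so the values at \<open>x\<close> and, earlier by the travel time \<open>x / lam\<close>,
  at 0 contain the same contribution of the input. What remains is fixed by the initial data and
  is \<open>P_op\<close>.
\<close>

lemma P_op_propagates:
  assumes lam: "lam > 0" and W: "continuous_on UNIV W" and G: "weighted_antiderivative (psi / lam) W G"
    and u0: "u0 \<in> H1" and initial: "\<And>x. x \<in> {0..1} \<Longrightarrow> W x = u0 x" and x: "x \<in> {0..1}"
  shows "v_solution lam psi om v0 G (t + x / lam) x
    = exp (psi * (t + x / lam)) * P_op lam psi om (u0, v0) x + v_solution lam psi om v0 G t 0"
proof -
  define a where "a = psi / lam"
  have c: "continuous_on {0..x} (\<lambda>s. exp (- a * (x - s)) * u0 s)"
    using x by (intro continuous_intros continuous_on_subset[OF H1_imp_continuous[OF u0]]) auto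
  have "((\<lambda>s. exp (- a * (x - s)) * u0 s) has_integral exp (- a * x) * G x - exp (- a * x) * G 0) {0..x}"
  proof (rule fundamental_theorem_of_calculus)
    fix s assume s: "s \<in> {0..x}"
    have "(G has_real_derivative exp (a * s) * W s) (at s)"
      using G by (simp add: weighted_antiderivative_def a_def)
    from DERIV_cmult[OF has_field_derivative_at_within[OF this]]
    have "((\<lambda>s. exp (- a * x) * G s) has_real_derivative exp (- a * x) * (exp (a * s) * W s)) (at s within {0..x})" .
    moreover have "exp (- a * x) * (exp (a * s) * W s) = exp (- a * (x - s)) * u0 s"
    proof -
      have "exp (- a * x) * (exp (a * s) * W s) = exp (- a * x + a * s) * W s"
        by (simp only: exp_add mult.assoc)
      moreover have "- a * x + a * s = - a * (x - s)"
        by (simp add: algebra_simps)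
      moreover have "W s = u0 s"
        using s x by (intro initial) auto
      ultimately show ?thesis
        by (simp only:)
    qed
    ultimately show "((\<lambda>s. exp (- a * x) * G s) has_vector_derivative exp (- a * (x - s)) * u0 s) (at s within {0..x})"
      by (simp add: has_real_derivative_iff_has_vector_derivative)
  qed (use x in simp)
  then have "(LINT s:{0..x}|lebesgue. exp (- a * (x - s)) * u0 s) = exp (- a * x) * (G x - G 0)"
    using set_lebesgue_integral_eq_integral(2)[OF absolutely_integrable_continuous_real[OF c]]
    by (simp add: integral_unique algebra_simps)
  then have P: "P_op lam psi om (u0, v0) x = v0 x - exp (- a * x) * v0 0 + om / lam * (exp (- a * x) * (G x - G 0))"
    by (simp add: P_op_def a_def)
  have shift: "exp (psi * (t + x / lam)) * exp (- a * x) = exp (psi * t)"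
    by (simp add: mult_exp_exp a_def algebra_simps)
  have "x - lam * (t + x / lam) = - (lam * t)"
    using lam by (simp add: field_simps)
  then have "v_solution lam psi om v0 G (t + x / lam) x = exp (psi * (t + x / lam)) * v0 x
      + om / lam * (exp (psi * (t + x / lam)) * exp (- a * x)) * (G x - G (- (lam * t)))"
    by (simp add: v_solution_def a_def algebra_simps)
  also have "\<dots> = exp (psi * (t + x / lam)) * v0 x - (exp (psi * (t + x / lam)) * exp (- a * x)) * v0 0
      + om / lam * (exp (psi * (t + x / lam)) * exp (- a * x)) * (G x - G 0)
      + exp (psi * t) * (v0 0 + om / lam * (G 0 - G (- (lam * t))))"
    unfolding shift by (simp add: algebra_simps diff_divide_distrib)
  also have "\<dots> = exp (psi * (t + x / lam)) * P_op lam psi om (u0, v0) x + v_solution lam psi om v0 G t 0"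
    unfolding P by (simp add: v_solution_def algebra_simps diff_divide_distrib)
  finally show ?thesis .
qed

theorem proposition2p3:
  fixes lam psi om :: real
    and u0 v0 U :: "real \<Rightarrow> real"
  assumes "lam > 0" and "psi \<ge> 0"
    and "(u0, v0) \<in> (H1 \<times> H1) - S_set lam psi om"
    and "C1_halfline U" and "U 0 = u0 0"
  shows "\<exists>u v. is_solution lam psi om u0 v0 U u v \<and>
    (\<forall>u' v'. is_solution lam psi om u0 v0 U u' v' \<longrightarrow>
      (\<forall>t\<ge>0. \<forall>x\<in>{0..1}. u' t x = u t x \<and> v' t x = v t x)) \<and>
    \<not> (\<forall>x\<in>{0..1}. ((\<lambda>t. v t x) \<longlongrightarrow> 0) at_top)"
proof -
  have H1: "u0 \<in> H1" "v0 \<in> H1" using assms(3) by auto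
  obtain W w where prof: "transport_profile W w" and W: "continuous_on UNIV W"
    and initial: "\<And>x. x \<in> {0..1} \<Longrightarrow> W x = u0 x" and boundary: "\<And>t. 0 \<le> t \<Longrightarrow> W (- (lam * t)) = U t"
    by (rule transport_profile_exists[OF assms(1) H1(1) assms(4,5)]) blast
  have "continuous_on UNIV (\<lambda>y. exp (psi / lam * y) * W y)"
    by (intro continuous_intros W)
  then obtain G where G: "weighted_antiderivative (psi / lam) W G"
    using einterval_antiderivative[of "-\<infinity>" "\<infinity>" "\<lambda>y. exp (psi / lam * y) * W y"]
    by (auto simp: weighted_antiderivative_def continuous_on_eq_continuous_at has_real_derivative_iff_has_vector_derivative)
  let ?u = "\<lambda>t x. W (x - lam * t)" and ?v = "v_solution lam psi om v0 G"
  have sol: "is_solution lam psi om u0 v0 U ?u ?v"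
    by (rule v_solution_is_solution[OF assms(1) prof W G H1(2) initial boundary])
  have unique: "u' t x = ?u t x \<and> v' t x = ?v t x"
    if sol': "is_solution lam psi om u0 v0 U u' v'" and t: "0 \<le> t" and x: "x \<in> {0..1}" for u' v' t x
  proof -
    have u: "C0_H1 ?u" "C1_L2 ?u" "\<And>t. 0 \<le> t \<Longrightarrow> AE x in unit_measure. time_deriv ?u t x = - lam * weak_deriv (?u t) x"
      and v: "C0_H1 ?v" "C1_L2 ?v" "\<And>t. 0 \<le> t \<Longrightarrow> AE x in unit_measure. time_deriv ?v t x = psi * ?v t x + om * ?u t x"
      and data: "\<And>t. 0 \<le> t \<Longrightarrow> ?u t 0 = U t" "\<And>x. x \<in> {0..1} \<Longrightarrow> ?u 0 x = u0 x" "\<And>x. x \<in> {0..1} \<Longrightarrow> ?v 0 x = v0 x"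
      using sol unfolding is_solution_def by blast+
    have u': "C0_H1 u'" "C1_L2 u'" "\<And>t. 0 \<le> t \<Longrightarrow> AE x in unit_measure. time_deriv u' t x = - lam * weak_deriv (u' t) x"
      and v': "C0_H1 v'" "C1_L2 v'" "\<And>t. 0 \<le> t \<Longrightarrow> AE x in unit_measure. time_deriv v' t x = psi * v' t x + om * u' t x"
      and data': "\<And>t. 0 \<le> t \<Longrightarrow> u' t 0 = U t" "\<And>x. x \<in> {0..1} \<Longrightarrow> u' 0 x = u0 x" "\<And>x. x \<in> {0..1} \<Longrightarrow> v' 0 x = v0 x"
      using sol' unfolding is_solution_def by blast+
    have u_eq: "u' t x = ?u t x" if "0 \<le> t" "x \<in> {0..1}" for t x
    proof (rule transport_unique[OF assms(1) u u' _ _ that])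
      show "u' t 0 = ?u t 0" if "0 \<le> t" for t
        by (simp only: data(1)[OF that] data'(1)[OF that])
      show "u' 0 x = ?u 0 x" if "x \<in> {0..1}" for x
        by (simp only: data(2)[OF that] data'(2)[OF that])
    qed
    have "v' t x = ?v t x"
    proof (rule linear_ode_unique[OF v v' u_eq _ t x])
      show "v' 0 x = ?v 0 x" if "x \<in> {0..1}" for x
        by (simp only: data(3)[OF that] data'(3)[OF that])
    qed
    with u_eq[OF t x] show ?thesis by simp
  qed
  have "\<not> (\<forall>x\<in>{0..1}. ((\<lambda>t. ?v t x) \<longlongrightarrow> 0) at_top)"
  proof
    assume stable: "\<forall>x\<in>{0..1}. ((\<lambda>t. ?v t x) \<longlongrightarrow> 0) at_top"
    obtain x where x: "x \<in> {0..1}" and P: "P_op lam psi om (u0, v0) x \<noteq> 0"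
      using assms(3) by (auto simp: S_set_def)
    have "((\<lambda>t. ?v (t + x / lam) x - ?v t 0) \<longlongrightarrow> 0 - 0) at_top"
    proof (rule tendsto_diff)
      have "filterlim (\<lambda>t. x / lam + t) at_top at_top"
        by (rule filterlim_tendsto_add_at_top[OF tendsto_const filterlim_ident])
      from filterlim_compose[OF bspec[OF stable x] this]
      show "((\<lambda>t. ?v (t + x / lam) x) \<longlongrightarrow> 0) at_top"
        by (simp only: add.commute)
      show "((\<lambda>t. ?v t 0) \<longlongrightarrow> 0) at_top"
        using stable by simp
    qed
    moreover have "?v (t + x / lam) x - ?v t 0 = exp (psi * (t + x / lam)) * P_op lam psi om (u0, v0) x" for t
      using P_op_propagates[OF assms(1) W G H1(1) initial x] by simp
    ultimately have "((\<lambda>t. exp (psi * (t + x / lam)) * P_op lam psi om (u0, v0) x) \<longlongrightarrow> 0) at_top"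
      by simp
    then have "((\<lambda>t. \<bar>exp (psi * (t + x / lam)) * P_op lam psi om (u0, v0) x\<bar>) \<longlongrightarrow> 0) at_top"
      by (rule tendsto_rabs_zero)
    then have "\<bar>P_op lam psi om (u0, v0) x\<bar> \<le> 0"
    proof (rule tendsto_lowerbound)
      show "\<forall>\<^sub>F t in at_top. \<bar>P_op lam psi om (u0, v0) x\<bar> \<le> \<bar>exp (psi * (t + x / lam)) * P_op lam psi om (u0, v0) x\<bar>"
        using eventually_ge_at_top[of 0]
      proof eventually_elim
        case (elim t)
        (* psi is nonnegative, so the exponential factor cannot make the P_op term decay *)
        have "0 \<le> psi * (t + x / lam)"
          using elim x assms(1,2) by simp
        then have "1 \<le> exp (psi * (t + x / lam))"
          by simp
        from mult_right_mono[OF this abs_ge_zero] show ?case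
          by (simp add: abs_mult)
      qed
    qed simp
    with P show False by simp
  qed
  with sol unique show ?thesis
    by blast
qed

end
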